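(* Let $N\ge 2$ be an integer and let $k\in\mathbb{R}$ be arbitrary. Let $\ell\in\mathbb{N}\cup\{0\}$ satisfy $$\lambda_\ell:=\ell(N-2+\ell)\ \ge\ -\frac{(N-2)^2}{4}-k,$$ and let $P\not\equiv 0$ be an eigenfunction of $-\Delta_{S^{N-1}}$ corresponding to the eigenvalue $\lambda_\ell$. Define $$F_P:=\{x\in\mathbb{R}^N\setminus\{0\} : x=\rho\omega,\ \rho>0,\ \omega\in S^{N-1},\ P(\omega)=0\}\cup\{0\},$$ and let $H_P$ be the operator in $L^2(\mathbb{R}^N)$ with domain $D(H_P):=C_0^\infty(\mathbb{R}^N\setminus F_P)$ given by $$H_Pu:=-\Delta u+\frac{k}{|x|^2}u .$$ Then $H_P$ is densely defined in $L^2(\mathbb{R}^N)$ and has a Friedrichs extension, and the lower bound (infimum) of the spectrum of this Friedrichs extension is zero. Consequently, for an arbitrary $k\in\mathbb{R}$, there exists the motion of a quantum mechanical particle under the inverse square potential $k|x|^{-2}$ in $\mathbb{R}^N$, $N\ge 2$, in the following sense: there exist $\ell\in\mathbb{N}\cup\{0\}$ with $\ell(N-2+\ell)\ge-\frac{(N-2)^2}{4}-k$ and an eigenfunction $P\not\equiv 0$ of $-\Delta_{S^{N-1}}$ corresponding to the eigenvalue $\lambda_\ell=\ell(N-2+\ell)$ such that the operator $H_P$ has a selfadjoint extension in $L^2(\mathbb{R}^N)$ whose spectrum is bounded below.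
   Context: $L^2(\mathbb{R}^N)$ is the Hilbert space of complex-valued square-integrable functions with respect to Lebesgue measure. $C_0^\infty(\Omega)$ denotes the complex-valued smooth functions with compact support in the open set $\Omega$. $\Delta$ is the Laplacian on $\mathbb{R}^N$, and $-\Delta_{S^{N-1}}$ is the negative (i.e. nonnegative) Laplace-Beltrami operator on the unit sphere $S^{N-1}\subset\mathbb{R}^N$, whose eigenvalues are $\lambda_\ell=\ell(N-2+\ell)$, $\ell\in\mathbb{N}\cup\{0\}$. The Friedrichs extension of a densely defined symmetric operator that is bounded below is the selfadjoint operator associated with the closure of its quadratic form $u\mapsto\int (H_Pu)\overline{u}\,dx$.
   Formalization: The eigenfunction P is taken to be real-valued; for complex P the claim fails, e.g. N=2, k=-1, l=1, P=e^{iθ}, where F_P={0} and -Δ-|x|^{-2} is not bounded below. *)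

theory Defs
  imports "HOL-Analysis.Analysis"
begin

section \<open>The complex Hilbert space $L^2$\<close>

definition sq_integrable :: "('a::euclidean_space \<Rightarrow> complex) \<Rightarrow> bool" where
  "sq_integrable f \<longleftrightarrow>
     f \<in> borel_measurable lborel \<and> integrable lborel (\<lambda>x. (cmod (f x))\<^sup>2)"

lemma sq_integrable_zero: "sq_integrable (\<lambda>_. 0)"
  by (simp add: sq_integrable_def)

lemma sq_integrable_mult_cnj:
  assumes "sq_integrable f" "sq_integrable g"
  shows "integrable lborel (\<lambda>x. f x * cnj (g x))"
proof (rule Bochner_Integration.integrable_bound)
  show "integrable lborel (\<lambda>x. (cmod (f x))\<^sup>2 + (cmod (g x))\<^sup>2)"
    using assms by (auto simp: sq_integrable_def)
  have [measurable]: "f \<in> borel_measurable borel" "g \<in> borel_measurable borel"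
    using assms by (auto simp: sq_integrable_def)
  have "(\<lambda>x. cnj (g x)) \<in> borel_measurable borel"
    by (rule measurable_compose[OF _ borel_measurable_continuous_onI]) (auto intro: continuous_intros)
  then show "(\<lambda>x. f x * cnj (g x)) \<in> borel_measurable lborel"
    by simp
  have "cmod (f x * cnj (g x)) \<le> (cmod (f x))\<^sup>2 + (cmod (g x))\<^sup>2" for x
  proof -
    have "2 * (cmod (f x) * cmod (g x)) \<le> (cmod (f x))\<^sup>2 + (cmod (g x))\<^sup>2"
      using sum_squares_bound[of "cmod (f x)" "cmod (g x)"] by (simp add: mult.assoc)
    moreover have "0 \<le> cmod (f x) * cmod (g x)" by simp
    ultimately have "cmod (f x) * cmod (g x) \<le> (cmod (f x))\<^sup>2 + (cmod (g x))\<^sup>2" by linarith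
    then show ?thesis by (simp add: norm_mult)
  qed
  then show "AE x in lborel. norm (f x * cnj (g x)) \<le> norm ((cmod (f x))\<^sup>2 + (cmod (g x))\<^sup>2)"
    by (auto simp: abs_of_nonneg)
qed

lemma sq_integrable_add:
  assumes "sq_integrable f" "sq_integrable g"
  shows "sq_integrable (\<lambda>x. f x + g x)"
  unfolding sq_integrable_def
proof
  have [measurable]: "f \<in> borel_measurable borel" "g \<in> borel_measurable borel"
    using assms by (auto simp: sq_integrable_def)
  show "(\<lambda>x. f x + g x) \<in> borel_measurable lborel" by simp
  show "integrable lborel (\<lambda>x. (cmod (f x + g x))\<^sup>2)"
  proof (rule Bochner_Integration.integrable_bound)
    show "integrable lborel (\<lambda>x. 2 * (cmod (f x))\<^sup>2 + 2 * (cmod (g x))\<^sup>2)"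
      using assms by (auto simp: sq_integrable_def)
    have "(cmod (f x + g x))\<^sup>2 \<le> 2 * (cmod (f x))\<^sup>2 + 2 * (cmod (g x))\<^sup>2" for x
    proof -
      have "(cmod (f x + g x))\<^sup>2 \<le> (cmod (f x) + cmod (g x))\<^sup>2"
        by (intro power_mono norm_triangle_ineq) simp
      also have "\<dots> \<le> 2 * (cmod (f x))\<^sup>2 + 2 * (cmod (g x))\<^sup>2"
        using sum_squares_bound[of "cmod (f x)" "cmod (g x)"] by (simp add: power2_sum)
      finally show ?thesis .
    qed
    then show "AE x in lborel. norm ((cmod (f x + g x))\<^sup>2)
        \<le> norm (2 * (cmod (f x))\<^sup>2 + 2 * (cmod (g x))\<^sup>2)"
      by (auto simp: abs_of_nonneg)
  qed simp
qed

lemma sq_integrable_mult_left: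
  assumes "sq_integrable f"
  shows "sq_integrable (\<lambda>x. c * f x)"
  using assms by (auto simp: sq_integrable_def norm_mult power_mult_distrib)

lemma sq_integrable_minus: "sq_integrable f \<Longrightarrow> sq_integrable (\<lambda>x. - f x)"
  using sq_integrable_mult_left[of f "-1"] by simp

quotient_type (overloaded) 'a L2 = "'a::euclidean_space \<Rightarrow> complex" /
  partial: "\<lambda>f g. sq_integrable f \<and> sq_integrable g \<and> (AE x in lborel. f x = g x)"
proof (rule part_equivpI)
  show "\<exists>f. sq_integrable f \<and> sq_integrable f \<and> (AE x in lborel. f x = f x)"
    using sq_integrable_zero by auto
qed (auto intro!: sympI transpI elim: eventually_elim2 eventually_mono)

instantiation L2 :: (euclidean_space) real_vector
begin

lift_definition zero_L2 :: "'a L2" is "\<lambda>_. 0"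
  by (simp add: sq_integrable_zero)

lift_definition plus_L2 :: "'a L2 \<Rightarrow> 'a L2 \<Rightarrow> 'a L2" is "\<lambda>f g x. f x + g x"
  by (auto intro: sq_integrable_add elim: eventually_elim2)

lift_definition uminus_L2 :: "'a L2 \<Rightarrow> 'a L2" is "\<lambda>f x. - f x"
  by (auto intro: sq_integrable_minus)

definition minus_L2 :: "'a L2 \<Rightarrow> 'a L2 \<Rightarrow> 'a L2" where
  "minus_L2 f g = f + (- g)"

lift_definition scaleR_L2 :: "real \<Rightarrow> 'a L2 \<Rightarrow> 'a L2" is "\<lambda>r f x. complex_of_real r * f x"
  by (auto intro: sq_integrable_mult_left)

instance
proof
  fix f g h :: "'a L2" and a b :: real
  show "f + g + h = f + (g + h)"
    by transfer (auto simp: algebra_simps intro!: sq_integrable_add)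
  show "f + g = g + f"
    by transfer (auto simp: algebra_simps intro!: sq_integrable_add)
  show "0 + f = f" by transfer auto
  show "- f + f = 0" by transfer (auto simp: sq_integrable_zero)
  show "f - g = f + - g" by (simp add: minus_L2_def)
  show "a *\<^sub>R (f + g) = a *\<^sub>R f + a *\<^sub>R g"
    by transfer (auto simp: distrib_left intro!: sq_integrable_add sq_integrable_mult_left)
  show "(a + b) *\<^sub>R f = a *\<^sub>R f + b *\<^sub>R f"
    by transfer (auto simp: distrib_right intro!: sq_integrable_add sq_integrable_mult_left)
  show "a *\<^sub>R b *\<^sub>R f = (a * b) *\<^sub>R f"
    by transfer (auto simp: mult.assoc intro!: sq_integrable_mult_left)
  show "1 *\<^sub>R f = f" by transfer auto
qed

end

lift_definition scaleC :: "complex \<Rightarrow> 'a::euclidean_space L2 \<Rightarrow> 'a L2" (infixr "*\<^sub>C" 75)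
  is "\<lambda>c f x. c * f x"
  by (auto intro: sq_integrable_mult_left)

lift_definition cinner :: "'a::euclidean_space L2 \<Rightarrow> 'a L2 \<Rightarrow> complex"
  is "\<lambda>f g. integral\<^sup>L lborel (\<lambda>x. f x * cnj (g x))"
proof -
  fix f f' g g' :: "'a \<Rightarrow> complex"
  assume f: "sq_integrable f \<and> sq_integrable f' \<and> (AE x in lborel. f x = f' x)"
    and g: "sq_integrable g \<and> sq_integrable g' \<and> (AE x in lborel. g x = g' x)"
  show "integral\<^sup>L lborel (\<lambda>x. f x * cnj (g x)) = integral\<^sup>L lborel (\<lambda>x. f' x * cnj (g' x))"
  proof (rule integral_cong_AE)
    show "(\<lambda>x. f x * cnj (g x)) \<in> borel_measurable lborel"
      "(\<lambda>x. f' x * cnj (g' x)) \<in> borel_measurable lborel"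
      using f g sq_integrable_mult_cnj borel_measurable_integrable by blast+
    show "AE x in lborel. f x * cnj (g x) = f' x * cnj (g' x)"
      using conjunct2[OF conjunct2[OF f]] conjunct2[OF conjunct2[OF g]] by eventually_elim simp
  qed
qed

text \<open>The norm and topology of \<open>L\<^sup>2\<close> come from the underlying real Hilbert space, whose inner
  product is the real part of the complex one.\<close>

instantiation L2 :: (euclidean_space) real_inner
begin

definition inner_L2 :: "'a L2 \<Rightarrow> 'a L2 \<Rightarrow> real" where
  "inner_L2 f g = Re (cinner f g)"

definition norm_L2 :: "'a L2 \<Rightarrow> real" where
  "norm_L2 f = sqrt (inner f f)"

definition sgn_L2 :: "'a L2 \<Rightarrow> 'a L2" where
  "sgn_L2 f = f /\<^sub>R norm f"

definition dist_L2 :: "'a L2 \<Rightarrow> 'a L2 \<Rightarrow> real" where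
  "dist_L2 f g = norm (f - g)"

definition uniformity_L2 :: "('a L2 \<times> 'a L2) filter" where
  "uniformity_L2 = (INF e\<in>{0 <..}. principal {(f, g). dist f g < e})"

definition open_L2 :: "'a L2 set \<Rightarrow> bool" where
  "open_L2 U \<longleftrightarrow> (\<forall>f\<in>U. eventually (\<lambda>(f', g). f' = f \<longrightarrow> g \<in> U) uniformity)"

instance
proof
  fix f g h :: "'a L2" and r :: real and U :: "'a L2 set"
  show "dist f g = norm (f - g)" by (simp add: dist_L2_def)
  show "sgn f = f /\<^sub>R norm f" by (simp add: sgn_L2_def)
  show "(uniformity :: ('a L2 \<times> 'a L2) filter) = (INF e\<in>{0 <..}. principal {(f, g). dist f g < e})"
    by (simp add: uniformity_L2_def)
  show "open U \<longleftrightarrow> (\<forall>f\<in>U. eventually (\<lambda>(f', g). f' = f \<longrightarrow> g \<in> U) uniformity)"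
    by (simp add: open_L2_def)
  show "norm f = sqrt (inner f f)" by (simp add: norm_L2_def)
  have "cinner f g = cnj (cinner g f)"
    by transfer (simp add: mult.commute flip: Bochner_Integration.integral_cnj)
  then show "inner f g = inner g f" by (simp add: inner_L2_def)
  have "cinner (f + g) h = cinner f h + cinner g h"
    by transfer
      (simp add: distrib_right Bochner_Integration.integral_add sq_integrable_mult_cnj)
  then show "inner (f + g) h = inner f h + inner g h" by (simp add: inner_L2_def)
  have "cinner (r *\<^sub>R f) g = complex_of_real r * cinner f g"
    by transfer (simp add: mult.assoc)
  then show "inner (r *\<^sub>R f) g = r * inner f g" by (simp add: inner_L2_def)
  have sq: "inner f f = integral\<^sup>L lborel (\<lambda>x. (cmod (u x))\<^sup>2)"
    if "f = abs_L2 u" "sq_integrable u" for u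
  proof -
    have "cinner f f = integral\<^sup>L lborel (\<lambda>x. u x * cnj (u x))"
      using that by (simp add: cinner.abs_eq)
    also have "\<dots> = integral\<^sup>L lborel (\<lambda>x. complex_of_real ((cmod (u x))\<^sup>2))"
      by (simp only: complex_norm_square)
    finally show ?thesis by (simp add: inner_L2_def del: of_real_power)
  qed
  obtain u where u: "f = abs_L2 u" "sq_integrable u"
    using Quotient3_abs_rep[OF Quotient3_L2, of f] Quotient3_rep_reflp[OF Quotient3_L2, of f]
    by metis
  show "0 \<le> inner f f" by (simp add: sq[OF u])
  have "inner f f = 0 \<longleftrightarrow> (AE x in lborel. (cmod (u x))\<^sup>2 = 0)"
    unfolding sq[OF u] using u(2)
    by (intro integral_nonneg_eq_0_iff_AE) (auto simp: sq_integrable_def)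
  also have "\<dots> \<longleftrightarrow> f = 0"
    unfolding u(1) zero_L2_def using u(2) sq_integrable_zero
      Quotient3_rel[OF Quotient3_L2, of u "\<lambda>_. 0"] by auto
  finally show "inner f f = 0 \<longleftrightarrow> f = 0" .
qed

end

section \<open>Unbounded operators, identified with their graphs\<close>

type_synonym 'a L2_op = "('a L2 \<times> 'a L2) set"

definition linear_op :: "'a::euclidean_space L2_op \<Rightarrow> bool" where
  "linear_op T \<longleftrightarrow> single_valued T \<and> (0, 0) \<in> T
     \<and> (\<forall>(u, v) \<in> T. \<forall>(u', v') \<in> T. (u + u', v + v') \<in> T)
     \<and> (\<forall>c. \<forall>(u, v) \<in> T. (c *\<^sub>C u, c *\<^sub>C v) \<in> T)"

definition app_op :: "'a::euclidean_space L2_op \<Rightarrow> 'a L2 \<Rightarrow> 'a L2" where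
  "app_op T u = (THE v. (u, v) \<in> T)"

definition densely_defined :: "'a::euclidean_space L2_op \<Rightarrow> bool" where
  "densely_defined T \<longleftrightarrow> closure (Domain T) = UNIV"

definition adjoint_op :: "'a::euclidean_space L2_op \<Rightarrow> 'a L2_op" where
  "adjoint_op T = {(v, w). \<forall>(x, y) \<in> T. cinner y v = cinner x w}"

definition symmetric_op :: "'a::euclidean_space L2_op \<Rightarrow> bool" where
  "symmetric_op T \<longleftrightarrow> (\<forall>(u, u') \<in> T. \<forall>(v, v') \<in> T. cinner u' v = cinner u v')"

definition bounded_below_op :: "'a::euclidean_space L2_op \<Rightarrow> bool" where
  "bounded_below_op T \<longleftrightarrow> (\<exists>c::real. \<forall>(u, v) \<in> T. c * (norm u)\<^sup>2 \<le> Re (cinner v u))"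

definition selfadjoint_op :: "'a::euclidean_space L2_op \<Rightarrow> bool" where
  "selfadjoint_op T \<longleftrightarrow> linear_op T \<and> densely_defined T \<and> adjoint_op T = T"

definition resolvent_set :: "'a::euclidean_space L2_op \<Rightarrow> complex set" where
  "resolvent_set T = {z. bij_betw (\<lambda>(u, v). v - z *\<^sub>C u) T UNIV
     \<and> (\<exists>C. \<forall>(u, v) \<in> T. norm u \<le> C * norm (v - z *\<^sub>C u))}"

definition spectrum :: "'a::euclidean_space L2_op \<Rightarrow> complex set" where
  "spectrum T = - resolvent_set T"

section \<open>The Friedrichs extension\<close>

definition form_of :: "'a::euclidean_space L2_op \<Rightarrow> 'a L2 \<Rightarrow> 'a L2 \<Rightarrow> complex" where
  "form_of T u v = cinner (app_op T u) v"

definition form_converges :: "'a::euclidean_space L2_op \<Rightarrow> (nat \<Rightarrow> 'a L2) \<Rightarrow> 'a L2 \<Rightarrow> bool" where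
  "form_converges T s u \<longleftrightarrow> range s \<subseteq> Domain T \<and> s \<longlonglongrightarrow> u
     \<and> (\<forall>e>0. \<exists>M. \<forall>m\<ge>M. \<forall>n\<ge>M. cmod (form_of T (s m - s n) (s m - s n)) < e)"

definition closed_form_domain :: "'a::euclidean_space L2_op \<Rightarrow> 'a L2 set" where
  "closed_form_domain T = {u. \<exists>s. form_converges T s u}"

text \<open>The limit below exists and is independent of the approximating sequences whenever \<open>T\<close> is
  densely defined, symmetric and bounded below.\<close>

definition closed_form :: "'a::euclidean_space L2_op \<Rightarrow> 'a L2 \<Rightarrow> 'a L2 \<Rightarrow> complex" where
  "closed_form T u v = (THE c. \<forall>s t. form_converges T s u \<longrightarrow> form_converges T t v \<longrightarrow>
     (\<lambda>n. form_of T (s n) (t n)) \<longlonglongrightarrow> c)"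

definition friedrichs_extension :: "'a::euclidean_space L2_op \<Rightarrow> 'a L2_op" where
  "friedrichs_extension T = {(u, w). u \<in> closed_form_domain T
     \<and> (\<forall>v \<in> closed_form_domain T. closed_form T u v = cinner w v)}"

definition has_friedrichs_extension :: "'a::euclidean_space L2_op \<Rightarrow> bool" where
  "has_friedrichs_extension T \<longleftrightarrow>
     linear_op T \<and> densely_defined T \<and> symmetric_op T \<and> bounded_below_op T
     \<and> T \<subseteq> friedrichs_extension T \<and> selfadjoint_op (friedrichs_extension T)"

section \<open>Smooth functions and the Laplacian\<close>

abbreviation dir_deriv ::
  "'a::euclidean_space \<Rightarrow> ('a \<Rightarrow> 'b::real_normed_vector) \<Rightarrow> 'a \<Rightarrow> 'b" where
  "dir_deriv v f \<equiv> (\<lambda>x. frechet_derivative f (at x) v)"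

text \<open>Meant for open \<open>S\<close> only.\<close>

fun Ck_on :: "nat \<Rightarrow> 'a::euclidean_space set \<Rightarrow> ('a \<Rightarrow> 'b::real_normed_vector) \<Rightarrow> bool" where
  "Ck_on 0 S f \<longleftrightarrow> continuous_on S f"
| "Ck_on (Suc n) S f \<longleftrightarrow> (\<forall>x\<in>S. f differentiable (at x)) \<and> (\<forall>v. Ck_on n S (dir_deriv v f))"

definition smooth_on :: "'a::euclidean_space set \<Rightarrow> ('a \<Rightarrow> 'b::real_normed_vector) \<Rightarrow> bool" where
  "smooth_on S f \<longleftrightarrow> (\<forall>n. Ck_on n S f)"

text \<open>Elements of \<open>C\<^sub>0\<^sup>\<infinity>(\<Omega>)\<close>, extended by zero to the whole space.\<close>

definition test_functions :: "'a::euclidean_space set \<Rightarrow> ('a \<Rightarrow> complex) set" where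
  "test_functions \<Omega> = {u. smooth_on UNIV u \<and> compact (closure {x. u x \<noteq> 0})
     \<and> closure {x. u x \<noteq> 0} \<subseteq> \<Omega>}"

definition laplacian ::
  "('a::euclidean_space \<Rightarrow> 'b::real_normed_vector) \<Rightarrow> 'a \<Rightarrow> 'b" where
  "laplacian f x = (\<Sum>b\<in>Basis. dir_deriv b (dir_deriv b f) x)"

section \<open>The Laplace-Beltrami operator on the unit sphere\<close>

text \<open>Functions and vector fields on the unit sphere are represented by functions on the ambient
  space, of which only the values on the sphere matter. They are differentiated via their extension
  \<open>f \<circ> sgn\<close>, i.e. \<open>x \<mapsto> f (x / \<bar>x\<bar>)\<close>, which is constant in the normal direction: the gradient of
  this extension is the tangential gradient, and the trace of its derivative is the tangential
  divergence.\<close>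

definition sphere_grad :: "('a::euclidean_space \<Rightarrow> real) \<Rightarrow> 'a \<Rightarrow> 'a" where
  "sphere_grad f \<omega> = (\<Sum>b\<in>Basis. dir_deriv b (f \<circ> sgn) \<omega> *\<^sub>R b)"

definition sphere_div :: "('a::euclidean_space \<Rightarrow> 'a) \<Rightarrow> 'a \<Rightarrow> real" where
  "sphere_div X \<omega> = (\<Sum>b\<in>Basis. dir_deriv b (X \<circ> sgn) \<omega> \<bullet> b)"

definition laplace_beltrami :: "('a::euclidean_space \<Rightarrow> real) \<Rightarrow> 'a \<Rightarrow> real" where
  "laplace_beltrami f = sphere_div (sphere_grad f)"

text \<open>Eigenfunctions of minus the Laplace-Beltrami operator are real-valued here; for complex-valued
  ones the zero set can be too small for the spectral bound to hold.\<close>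

definition sphere_eigenfunction :: "('a::euclidean_space \<Rightarrow> real) \<Rightarrow> real \<Rightarrow> bool" where
  "sphere_eigenfunction P \<mu> \<longleftrightarrow> smooth_on (- {0}) (P \<circ> sgn)
     \<and> (\<exists>\<omega>\<in>sphere 0 1. P \<omega> \<noteq> 0)
     \<and> (\<forall>\<omega>\<in>sphere 0 1. - laplace_beltrami P \<omega> = \<mu> * P \<omega>)"

section \<open>The Schroedinger operator with inverse square potential\<close>

definition nodal_cone :: "('a::euclidean_space \<Rightarrow> real) \<Rightarrow> 'a set" where
  "nodal_cone P = {x. x \<noteq> 0 \<and> (\<exists>\<rho>>0. \<exists>\<omega>\<in>sphere 0 1. x = \<rho> *\<^sub>R \<omega> \<and> P \<omega> = 0)} \<union> {0}"

text \<open>\<open>abs_L2\<close> sends a square-integrable function to its class in \<open>L\<^sup>2\<close>.\<close>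

definition H_op :: "real \<Rightarrow> ('a::euclidean_space \<Rightarrow> real) \<Rightarrow> 'a L2_op" where
  "H_op k P = {(abs_L2 u, abs_L2 (\<lambda>x. - laplacian u x + complex_of_real (k / (norm x)\<^sup>2) * u x)) | u.
     u \<in> test_functions (UNIV - nodal_cone P)}"

definition sphere_eigenvalue :: "nat \<Rightarrow> nat \<Rightarrow> real" where
  "sphere_eigenvalue N l = real l * (real N - 2 + real l)"

end

theory Submission
  imports Defs
begin

text \<open>
  Let \<open>f x = P (x / \<bar>x\<bar>)\<close>. The function \<open>\<psi> x = \<bar>x\<bar> powr (- (N - 2) / 2) * f x\<close> does not vanish off the
  nodal cone and solves \<open>- \<Delta> \<psi> = (\<lambda>\<^sub>l + (N - 2)\<^sup>2 / 4) \<bar>x\<bar>\<^sup>-\<^sup>2 \<psi>\<close>; the ground state substitution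
  \<open>u = \<psi> w\<close> therefore shows that the quadratic form of \<open>H\<^sub>P\<close> is nonnegative. A nonnegative, symmetric,
  densely defined operator has a Friedrichs extension, whose spectrum lies in \<open>Re z \<ge> 0\<close>. Since the
  domain is a cone and \<open>H\<^sub>P\<close> is homogeneous of degree \<open>-2\<close> under dilations, \<open>0\<close> belongs to the spectrum.

  The operator is densely defined because the nodal cone is a null set: \<open>\<bar>x\<bar>\<^sup>l f x\<close> is harmonic off the
  origin, and the zeros of a nonzero harmonic function form a null set by analyticity. For the
  existence part, \<open>Re (x\<^sub>1 + \<i> x\<^sub>2)\<^sup>l\<close> restricts to an eigenfunction for every \<open>l\<close>.
\<close>

section \<open>The complex Hilbert space\<close>

text \<open>Removing the nodal cone is what makes an arbitrary k possible. The ground state only has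
  to be nonzero off the cone, so it may contain P, and the Hardy constant rises from (N - 2)^2 / 4
  to \<lambda> + (N - 2)^2 / 4, which the hypothesis makes at least - k. The exponent - (N - 2) / 2
  minimizes s (s + N - 2), so no other power of |x| gives a larger constant. The price is density:
  the zero set of a general eigenfunction has no known structure, hence the detour through
  analyticity. It is derived from the maximum principle alone: that bounds the gradient of a
  harmonic function, iteration over n balls of radius r / n bounds the nth derivative by (C n / r)^n
  M, and n^n \<le> 3^n n! makes Taylor remainders on a short segment tend to 0. The form is
  nonnegative but has no positive lower bound, so the extension A is reached through A + a with a >
  0. Solving (A + a) u = w by minimization needs only completeness of L2; it yields selfadjointness
  and, by a fixed point argument, the resolvent on the left half-plane.\<close>

lemma L2_cases:
  obtains u where "sq_integrable u" "f = abs_L2 u"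
  using Quotient3_abs_rep[OF Quotient3_L2, of f] Quotient3_rep_reflp[OF Quotient3_L2, of f]
  by metis

lemma abs_L2_eq_iff:
  assumes "sq_integrable u" "sq_integrable v"
  shows "abs_L2 u = abs_L2 v \<longleftrightarrow> (AE x in lborel. u x = v x)"
  using Quotient3_rel[OF Quotient3_L2, of u v] assms by auto

lemma cinner_abs_L2:
  assumes "sq_integrable u" "sq_integrable v"
  shows "cinner (abs_L2 u) (abs_L2 v) = (\<integral>x. u x * cnj (v x) \<partial>lborel)"
  using assms by (simp add: cinner.abs_eq)

lemma plus_abs_L2:
  assumes "sq_integrable u" "sq_integrable v"
  shows "abs_L2 u + abs_L2 v = abs_L2 (\<lambda>x. u x + v x)"
  using assms by (simp add: plus_L2.abs_eq)

lemma scaleC_abs_L2: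
  assumes "sq_integrable u"
  shows "c *\<^sub>C abs_L2 u = abs_L2 (\<lambda>x. c * u x)"
  using assms by (simp add: scaleC.abs_eq)

lemma minus_abs_L2:
  assumes "sq_integrable u" "sq_integrable v"
  shows "abs_L2 u - abs_L2 v = abs_L2 (\<lambda>x. u x - v x)"
  using assms by (simp add: minus_L2_def uminus_L2.abs_eq plus_abs_L2 sq_integrable_minus)

lemma sq_integrable_diff:
  "sq_integrable u \<Longrightarrow> sq_integrable v \<Longrightarrow> sq_integrable (\<lambda>x. u x - v x)"
  using sq_integrable_add[of u "\<lambda>x. - v x"] sq_integrable_minus[of v] by simp

section \<open>Sesquilinearity and norm identities\<close>

lemma cinner_commute: "cinner f g = cnj (cinner g f)"
  by transfer (simp add: mult.commute flip: Bochner_Integration.integral_cnj)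

lemma cinner_add_left: "cinner (f + g) h = cinner f h + cinner g h"
  by transfer
    (simp add: distrib_right Bochner_Integration.integral_add sq_integrable_mult_cnj)

lemma cinner_scaleC_left: "cinner (c *\<^sub>C f) g = c * cinner f g"
  by transfer (simp add: mult.assoc)

lemma cinner_add_right: "cinner f (g + h) = cinner f g + cinner f h"
  by (metis cinner_commute cinner_add_left complex_cnj_add)

lemma cinner_scaleC_right: "cinner f (c *\<^sub>C g) = cnj c * cinner f g"
  by (metis cinner_commute cinner_scaleC_left complex_cnj_mult)

lemma scaleR_conv_scaleC: "r *\<^sub>R f = complex_of_real r *\<^sub>C f"
  by transfer (auto intro: sq_integrable_mult_left)

lemma uminus_conv_scaleC: "- f = (-1) *\<^sub>C f"
  using scaleR_conv_scaleC[of "-1" f] by simp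

lemma diff_conv_scaleC: "f - g = f + (-1) *\<^sub>C (g :: 'a::euclidean_space L2)"
  by (simp flip: uminus_conv_scaleC)

lemma cinner_diff_left: "cinner (f - g) h = cinner f h - cinner g h"
  by (simp add: diff_conv_scaleC cinner_add_left cinner_scaleC_left)

lemma cinner_diff_right: "cinner f (g - h) = cinner f g - cinner f h"
  by (simp add: diff_conv_scaleC cinner_add_right cinner_scaleC_right)

lemma cinner_zero_left [simp]: "cinner 0 f = 0"
  using cinner_diff_left[of f f f] by simp

lemma cinner_zero_right [simp]: "cinner f 0 = 0"
  using cinner_diff_right[of f f f] by simp

lemma scaleC_add_right: "c *\<^sub>C (f + g) = c *\<^sub>C f + c *\<^sub>C g"
  by transfer (auto simp: distrib_left intro!: sq_integrable_mult_left sq_integrable_add)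

lemma scaleC_add_left: "(c + d) *\<^sub>C f = c *\<^sub>C f + d *\<^sub>C f"
  by transfer (auto simp: distrib_right intro!: sq_integrable_mult_left sq_integrable_add)

lemma scaleC_scaleC: "c *\<^sub>C d *\<^sub>C f = (c * d) *\<^sub>C f"
  by transfer (auto simp: mult.assoc intro!: sq_integrable_mult_left)

lemma scaleC_diff_right: "c *\<^sub>C (f - g) = c *\<^sub>C f - c *\<^sub>C g"
  by (simp add: diff_conv_scaleC scaleC_add_right scaleC_scaleC)

lemma scaleC_diff_left: "(c - d) *\<^sub>C f = c *\<^sub>C f - d *\<^sub>C f"
  using scaleC_add_left[of "c - d" d f] by (simp add: algebra_simps)

lemma scaleC_zero_right [simp]: "c *\<^sub>C (0 :: 'a::euclidean_space L2) = 0"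
  using scaleC_diff_right[of c 0 0] by simp

lemma scaleC_zero_left [simp]: "0 *\<^sub>C f = 0"
  using scaleC_diff_left[of 0 0 f] by simp

lemma scaleC_one [simp]: "1 *\<^sub>C f = f"
  using scaleR_conv_scaleC[of 1 f] by simp

lemma cinner_self: "cinner f f = complex_of_real ((norm f)\<^sup>2)"
proof -
  have "Im (cinner f f) = 0"
    using arg_cong[OF cinner_commute[of f f], of Im] by simp
  moreover have "Re (cinner f f) = (norm f)\<^sup>2"
    by (simp add: power2_norm_eq_inner inner_L2_def)
  ultimately show ?thesis
    by (simp add: complex_eq_iff del: of_real_power)
qed

lemma norm_abs_L2:
  assumes "sq_integrable u"
  shows "(norm (abs_L2 u))\<^sup>2 = (\<integral>x. (cmod (u x))\<^sup>2 \<partial>lborel)"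
proof -
  have "complex_of_real ((norm (abs_L2 u))\<^sup>2) = (\<integral>x. u x * cnj (u x) \<partial>lborel)"
    using assms by (simp add: cinner_abs_L2 flip: cinner_self del: of_real_power)
  also have "\<dots> = (\<integral>x. complex_of_real ((cmod (u x))\<^sup>2) \<partial>lborel)"
    by (simp only: complex_norm_square)
  finally show ?thesis by (simp del: of_real_power)
qed

lemma nn_norm_abs_L2:
  assumes "sq_integrable u"
  shows "ennreal ((norm (abs_L2 u))\<^sup>2) = (\<integral>\<^sup>+x. ennreal ((cmod (u x))\<^sup>2) \<partial>lborel)"
  unfolding norm_abs_L2[OF assms] using assms
  by (subst nn_integral_eq_integral) (auto simp: sq_integrable_def)

lemma norm_scaleC: "norm (c *\<^sub>C f) = cmod c * norm f"
proof -
  have "complex_of_real ((norm (c *\<^sub>C f))\<^sup>2) = c * cnj c * of_real ((norm f)\<^sup>2)"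
    by (simp add: cinner_scaleC_left cinner_scaleC_right mult_ac flip: cinner_self del: of_real_power)
  also have "\<dots> = of_real ((cmod c * norm f)\<^sup>2)"
    by (simp only: complex_norm_square power_mult_distrib of_real_mult)
  finally have "(norm (c *\<^sub>C f))\<^sup>2 = (cmod c * norm f)\<^sup>2"
    using of_real_eq_iff by blast
  then show ?thesis by (simp add: power2_eq_iff_nonneg)
qed

text \<open>The real inner product sees only the real part of \<open>cinner\<close>. Multiplying
  \<open>f\<close> by a unimodular constant turns \<open>cinner f g\<close> into its own modulus, so
  nothing is lost by taking real parts.\<close>

lemma cinner_Cauchy_Schwarz: "cmod (cinner f g) \<le> norm f * norm g"
proof (cases "cinner f g = 0")
  case False
  define c where "c = cnj (sgn (cinner f g))"
  have c: "cmod c = 1" using False by (simp add: c_def norm_sgn)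
  have "c * cinner f g = of_real (cmod (cinner f g))"
    using False complex_norm_square[of "cinner f g"]
    by (simp add: c_def sgn_eq field_simps power2_eq_square)
  then have "cmod (cinner f g) = Re (cinner (c *\<^sub>C f) g)"
    by (simp add: cinner_scaleC_left)
  also have "\<dots> \<le> norm (c *\<^sub>C f) * norm g"
    using norm_cauchy_schwarz[of "c *\<^sub>C f" g] by (simp add: inner_L2_def)
  finally show ?thesis by (simp add: norm_scaleC c)
qed simp

lemma bounded_bilinear_cinner: "bounded_bilinear (cinner :: 'a::euclidean_space L2 \<Rightarrow> _)"
proof (rule bounded_bilinear.intro)
  show "\<exists>K. \<forall>a b. cmod (cinner a b) \<le> norm (a::'a L2) * norm b * K"
    by (rule exI[of _ 1]) (simp add: cinner_Cauchy_Schwarz)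
qed (simp_all add: cinner_add_left cinner_add_right scaleR_conv_scaleC cinner_scaleC_left
    cinner_scaleC_right scaleR_conv_of_real)

lemmas tendsto_cinner = bounded_bilinear.tendsto[OF bounded_bilinear_cinner]

lemma tendsto_scaleC:
  fixes f :: "'b \<Rightarrow> 'a::euclidean_space L2"
  assumes "(f \<longlongrightarrow> l) F"
  shows "((\<lambda>x. c *\<^sub>C f x) \<longlongrightarrow> c *\<^sub>C l) F"
proof -
  have "bounded_linear ((*\<^sub>C) c :: 'a L2 \<Rightarrow> _)"
    by (rule bounded_linear_intro[where K="cmod c"])
      (simp_all add: scaleC_add_right scaleR_conv_scaleC scaleC_scaleC mult.commute norm_scaleC)
  then show ?thesis using assms by (rule bounded_linear.tendsto)
qed

section \<open>Completeness of L2\<close>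

lemma AE_Cauchy_of_fast:
  fixes d :: "nat \<Rightarrow> 'a::euclidean_space \<Rightarrow> complex"
  assumes d: "\<And>n. sq_integrable (\<lambda>x. d (Suc n) x - d n x)"
    and le: "\<And>n. norm (abs_L2 (\<lambda>x. d (Suc n) x - d n x)) \<le> (1/2)^n"
  shows "AE x in lborel. Cauchy (\<lambda>n. d n x)"
proof -
  define e where "e n x = d (Suc n) x - d n x" for n x
  have [measurable]: "e n \<in> borel_measurable borel" for n
    using d[of n] unfolding sq_integrable_def e_def by simp
  have "(\<integral>\<^sup>+x. (\<Sum>n. ennreal (2^n * (cmod (e n x))\<^sup>2)) \<partial>lborel)
      = (\<Sum>n. \<integral>\<^sup>+x. ennreal (2^n * (cmod (e n x))\<^sup>2) \<partial>lborel)"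
    by (rule nn_integral_suminf) simp
  also have "\<dots> \<le> (\<Sum>n. ennreal ((1/2)^n))"
  \<comment> \<open>The squared norms are at most 4^-n, so the weight 2^n still leaves a summable
    2^-n. Finiteness of the weighted sum at x then forces |e n x| \<le> 2^(-n/2) eventually, a
    geometric bound.\<close>
  proof (intro suminf_le)
    fix n
    have "(\<integral>\<^sup>+x. ennreal (2^n * (cmod (e n x))\<^sup>2) \<partial>lborel)
        = ennreal (2^n) * ennreal ((norm (abs_L2 (e n)))\<^sup>2)"
      using d[of n] unfolding e_def[symmetric] by (simp add: ennreal_mult' nn_norm_abs_L2 nn_integral_cmult)
    also have "\<dots> \<le> ennreal (2^n * ((1/2)^n)\<^sup>2)"
      using le[of n] by (simp add: e_def[abs_def] power_mono ennreal_leI flip: ennreal_mult')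
    also have "2^n * ((1/2)^n)\<^sup>2 = (1/2::real)^n"
      by (simp add: power2_eq_square field_simps)
    finally show "(\<integral>\<^sup>+x. ennreal (2^n * (cmod (e n x))\<^sup>2) \<partial>lborel) \<le> ennreal ((1/2)^n)" .
  qed auto
  also have "\<dots> < \<infinity>"
    by (subst suminf_ennreal2) (auto intro: summable_geometric)
  finally have "AE x in lborel. (\<Sum>n. ennreal (2^n * (cmod (e n x))\<^sup>2)) \<noteq> \<infinity>"
    by (intro nn_integral_PInf_AE) auto
  then show ?thesis
  proof eventually_elim
    case (elim x)
    then have s: "summable (\<lambda>n. 2^n * (cmod (e n x))\<^sup>2)"
      by (intro summable_suminf_not_top) auto
    then have "(\<lambda>n. 2^n * (cmod (e n x))\<^sup>2) \<longlonglongrightarrow> 0" by (rule summable_LIMSEQ_zero)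
    then have ev: "eventually (\<lambda>n. 2^n * (cmod (e n x))\<^sup>2 < 1) sequentially"
      by (rule order_tendstoD) simp
    have "summable (\<lambda>n. e n x)"
    proof (rule summable_comparison_test_ev)
      show "eventually (\<lambda>n. norm (e n x) \<le> (sqrt (1/2))^n) sequentially"
        using ev
      proof eventually_elim
        case (elim n)
        then have "(cmod (e n x))\<^sup>2 \<le> (1/2)^n" by (simp add: field_simps)
        then have "cmod (e n x) \<le> sqrt ((1/2)^n)" by (rule real_le_rsqrt)
        then show ?case by (simp add: real_sqrt_power)
      qed
      show "summable (\<lambda>n. (sqrt (1/2))^n)"
        by (intro summable_geometric) (simp add: real_sqrt_divide)
    qed
    then have "convergent (\<lambda>n. \<Sum>i<n. e i x)"
      by (simp add: summable_iff_convergent)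
    then have "convergent (\<lambda>n. (\<Sum>i<n. e i x) + d 0 x)"
      by (intro convergent_add convergent_const)
    moreover have "(\<Sum>i<n. e i x) + d 0 x = d n x" for n
      unfolding e_def by (subst sum_lessThan_telescope) simp
    ultimately show ?case by (simp add: Cauchy_convergent_iff)
  qed
qed

text \<open>Riesz-Fischer: a fast subsequence converges almost everywhere, and Fatou's lemma turns
  the Cauchy bounds into norm bounds against the pointwise limit. Completeness serves the minimizing
  sequence and the fixed point behind the resolvent.\<close>

instance L2 :: (euclidean_space) complete_space
proof
  fix X :: "nat \<Rightarrow> 'a L2"
  assume X: "Cauchy X"
  have "\<exists>r::nat\<Rightarrow>nat. \<forall>n. (\<forall>m\<ge>r n. norm (X m - X (r n)) \<le> (1/2)^n) \<and> r n < r (Suc n)"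
  proof (rule dependent_nat_choice)
    show "\<exists>x. \<forall>m\<ge>x. norm (X m - X x) \<le> (1 / 2) ^ 0"
      using CauchyD[OF X, of 1] by (force intro: less_imp_le)
  next
    fix x n :: nat
    obtain M where M: "\<And>m k. m \<ge> M \<Longrightarrow> k \<ge> M \<Longrightarrow> norm (X m - X k) < (1/2)^Suc n"
      using CauchyD[OF X, of "(1/2)^Suc n"] by auto
    show "\<exists>y. (\<forall>m\<ge>y. norm (X m - X y) \<le> (1 / 2) ^ Suc n) \<and> x < y"
      by (rule exI[of _ "Suc (max M x)"]) (auto intro!: less_imp_le M simp del: power_Suc)
  qed
  then obtain r :: "nat \<Rightarrow> nat" where
    r: "\<And>n m. m \<ge> r n \<Longrightarrow> norm (X m - X (r n)) \<le> (1/2)^n" and lt: "\<And>n. r n < r (Suc n)" by auto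
  have mono: "strict_mono r" using lt by (rule strict_monoI_Suc)
  have "\<forall>n. \<exists>u. sq_integrable u \<and> X (r n) = abs_L2 u" by (metis L2_cases)
  then obtain U where U: "\<And>n. sq_integrable (U n)" "\<And>n. X (r n) = abs_L2 (U n)" by metis
  have [measurable]: "U n \<in> borel_measurable borel" for n
    using U(1)[of n] by (simp add: sq_integrable_def)
  have "AE x in lborel. Cauchy (\<lambda>n. U n x)"
  proof (rule AE_Cauchy_of_fast)
    show "sq_integrable (\<lambda>x. U (Suc n) x - U n x)" for n by (intro sq_integrable_diff U)
    show "norm (abs_L2 (\<lambda>x. U (Suc n) x - U n x)) \<le> (1/2)^n" for n
      using r[of n "r (Suc n)"] lt[of n] U by (simp add: minus_abs_L2)
  qed
  then have lim: "AE x in lborel. (\<lambda>n. U n x) \<longlonglongrightarrow> lim (\<lambda>n. U n x)"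
    by eventually_elim (simp add: Cauchy_convergent_iff convergent_LIMSEQ_iff)
  \<comment> \<open>Where the sequence diverges \<open>lim\<close> has an unspecified value; this
    concerns only a null set, and \<open>u\<close> is still measurable.\<close>
  define u where "u x = lim (\<lambda>n. U n x)" for x
  have um [measurable]: "u \<in> borel_measurable borel" unfolding u_def by measurable
  have bound: "(\<integral>\<^sup>+x. ennreal ((cmod (U n x - u x))\<^sup>2) \<partial>lborel) \<le> ennreal (((1/2)^n)\<^sup>2)" for n
  proof -
    have "(\<integral>\<^sup>+x. ennreal ((cmod (U n x - u x))\<^sup>2) \<partial>lborel)
        = (\<integral>\<^sup>+x. liminf (\<lambda>m. ennreal ((cmod (U n x - U m x))\<^sup>2)) \<partial>lborel)"
    proof (rule nn_integral_cong_AE)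
      show "AE x in lborel. ennreal ((cmod (U n x - u x))\<^sup>2)
          = liminf (\<lambda>m. ennreal ((cmod (U n x - U m x))\<^sup>2))"
        using lim
      proof eventually_elim
        case (elim x)
        then have "(\<lambda>m. ennreal ((cmod (U n x - U m x))\<^sup>2)) \<longlonglongrightarrow> ennreal ((cmod (U n x - u x))\<^sup>2)"
          unfolding u_def by (intro tendsto_intros)
        then show ?case by (intro lim_imp_Liminf[symmetric]) auto
      qed
    qed
    also have "\<dots> \<le> liminf (\<lambda>m. \<integral>\<^sup>+x. ennreal ((cmod (U n x - U m x))\<^sup>2) \<partial>lborel)"
      by (rule nn_integral_liminf) simp
    also have "\<dots> \<le> ennreal (((1/2)^n)\<^sup>2)"
    proof (rule Liminf_le[OF sequentially_bot])
      show "eventually (\<lambda>m. (\<integral>\<^sup>+x. ennreal ((cmod (U n x - U m x))\<^sup>2) \<partial>lborel)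
          \<le> ennreal (((1/2)^n)\<^sup>2)) sequentially"
        using eventually_ge_at_top[of n]
      proof eventually_elim
        case (elim m)
        have "norm (X (r n) - X (r m)) \<le> (1/2)^n"
          using r[of n "r m"] elim mono by (simp add: norm_minus_commute strict_mono_less_eq)
        then have "ennreal ((norm (X (r n) - X (r m)))\<^sup>2) \<le> ennreal (((1/2)^n)\<^sup>2)"
          by (intro ennreal_leI power_mono) auto
        then show ?case
          using U by (simp add: minus_abs_L2 nn_norm_abs_L2 sq_integrable_diff)
      qed
    qed
    finally show ?thesis .
  qed
  have D: "sq_integrable (\<lambda>x. U n x - u x)" for n
    unfolding sq_integrable_def
    using order.strict_trans1[OF bound[of n]] by (auto intro!: integrableI_bounded)
  \<comment> \<open>So far only the differences \<open>U n - u\<close> are known to be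
    square-integrable; \<open>u\<close> is recovered from one of them.\<close>
  have "sq_integrable (\<lambda>x. U 0 x - (U 0 x - u x))" by (intro sq_integrable_diff D U)
  then have u: "sq_integrable u" by simp
  have norm: "norm (X (r n) - abs_L2 u) \<le> (1/2)^n" for n
  proof -
    have "ennreal ((norm (X (r n) - abs_L2 u))\<^sup>2) \<le> ennreal (((1/2)^n)\<^sup>2)"
      using bound[of n] by (simp add: U u minus_abs_L2 nn_norm_abs_L2 D)
    then show ?thesis by (simp add: power2_le_iff_abs_le)
  qed
  have "(\<lambda>n. X (r n)) \<longlonglongrightarrow> abs_L2 u"
  proof (rule Lim_null_comparison[where g="\<lambda>n. (1/2)^n", THEN LIM_zero_cancel])
    show "(\<lambda>n. (1/2::real)^n) \<longlonglongrightarrow> 0" by (intro LIMSEQ_power_zero) simp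
  qed (use norm in auto)
  then show "convergent X"
    using Cauchy_converges_subseq[OF X mono] by (auto simp: convergent_def o_def)
qed

section \<open>The Friedrichs extension of a nonnegative symmetric operator\<close>

locale nonneg_symmetric_op =
  fixes T :: "'a::euclidean_space L2_op"
  assumes linear: "linear_op T"
    and dense: "densely_defined T"
    and symmetric: "symmetric_op T"
    and nonneg: "(u, v) \<in> T \<Longrightarrow> 0 \<le> Re (cinner v u)"
begin

abbreviation q where "q \<equiv> form_of T"
abbreviation D where "D \<equiv> Domain T"
abbreviation F where "F \<equiv> closed_form_domain T"
abbreviation B where "B \<equiv> closed_form T"
abbreviation A where "A \<equiv> friedrichs_extension T"

section \<open>The quadratic form and its seminorm\<close>

definition seminorm :: "'a L2 \<Rightarrow> real" where
  "seminorm u = sqrt (Re (q u u))"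

lemma app_eq: "(u, v) \<in> T \<Longrightarrow> app_op T u = v"
  using linear unfolding app_op_def linear_op_def by (blast intro: the_equality dest: single_valuedD)

lemma app_graph: "u \<in> D \<Longrightarrow> (u, app_op T u) \<in> T"
  using app_eq by (metis DomainE)

lemma graph_add: "(u, v) \<in> T \<Longrightarrow> (u', v') \<in> T \<Longrightarrow> (u + u', v + v') \<in> T"
  using linear unfolding linear_op_def by fast

lemma graph_scale: "(u, v) \<in> T \<Longrightarrow> (c *\<^sub>C u, c *\<^sub>C v) \<in> T"
  using linear unfolding linear_op_def by fast

lemma D_zero: "0 \<in> D"
  using linear unfolding linear_op_def by blast

lemma D_add: "u \<in> D \<Longrightarrow> v \<in> D \<Longrightarrow> u + v \<in> D"
  using graph_add by blast

lemma D_scale: "u \<in> D \<Longrightarrow> c *\<^sub>C u \<in> D"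
  using graph_scale by blast

lemma D_diff: "u \<in> D \<Longrightarrow> v \<in> D \<Longrightarrow> u - v \<in> D"
  unfolding diff_conv_scaleC by (intro D_add D_scale)

lemma app_add: "u \<in> D \<Longrightarrow> v \<in> D \<Longrightarrow> app_op T (u + v) = app_op T u + app_op T v"
  using app_eq[OF graph_add[OF app_graph app_graph]] by blast

lemma app_scale: "u \<in> D \<Longrightarrow> app_op T (c *\<^sub>C u) = c *\<^sub>C app_op T u"
  using app_eq[OF graph_scale[OF app_graph]] by blast

lemma q_add_left: "u \<in> D \<Longrightarrow> v \<in> D \<Longrightarrow> q (u + v) w = q u w + q v w"
  by (simp add: form_of_def app_add cinner_add_left)

lemma q_scale_left: "u \<in> D \<Longrightarrow> q (c *\<^sub>C u) w = c * q u w"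
  by (simp add: form_of_def app_scale cinner_scaleC_left)

lemma q_add_right: "q w (u + v) = q w u + q w v"
  by (simp add: form_of_def cinner_add_right)

lemma q_scale_right: "q w (c *\<^sub>C u) = cnj c * q w u"
  by (simp add: form_of_def cinner_scaleC_right)

lemma q_diff_left: "u \<in> D \<Longrightarrow> v \<in> D \<Longrightarrow> q (u - v) w = q u w - q v w"
  by (simp add: diff_conv_scaleC q_add_left q_scale_left D_scale)

lemma q_diff_right: "q w (u - v) = q w u - q w v"
  by (simp add: diff_conv_scaleC q_add_right q_scale_right)

lemma q_hermitian:
  assumes "u \<in> D" "v \<in> D"
  shows "q u v = cnj (q v u)"
proof -
  have "cinner (app_op T u) v = cinner u (app_op T v)"
    using symmetric app_graph[OF assms(1)] app_graph[OF assms(2)]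
    unfolding symmetric_op_def by fast
  then show ?thesis by (metis cinner_commute form_of_def)
qed

lemma q_nonneg: "u \<in> D \<Longrightarrow> 0 \<le> Re (q u u)"
  using nonneg[OF app_graph] by (simp add: form_of_def)

lemma q_self: "u \<in> D \<Longrightarrow> q u u = of_real ((seminorm u)\<^sup>2)"
  using q_hermitian[of u u] q_nonneg[of u]
  by (auto simp: complex_eq_iff seminorm_def simp del: of_real_power)

lemma Re_q_self: "u \<in> D \<Longrightarrow> Re (q u u) = (seminorm u)\<^sup>2"
  by (simp add: q_self del: of_real_power)

lemma seminorm_nonneg: "u \<in> D \<Longrightarrow> 0 \<le> seminorm u"
  by (simp add: seminorm_def q_nonneg)

lemma q_expand:
  assumes "u \<in> D" "v \<in> D"
  shows "(seminorm (u + c *\<^sub>C v))\<^sup>2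
    = (seminorm u)\<^sup>2 + 2 * Re (cnj c * q u v) + (cmod c)\<^sup>2 * (seminorm v)\<^sup>2"
proof -
  have "(seminorm (u + c *\<^sub>C v))\<^sup>2 = Re (q (u + c *\<^sub>C v) (u + c *\<^sub>C v))"
    using assms by (simp add: Re_q_self D_add D_scale)
  also have "q (u + c *\<^sub>C v) (u + c *\<^sub>C v)
      = q u u + (cnj c * q u v + cnj (cnj c * q u v)) + (c * cnj c) * q v v"
    using assms q_hermitian[of v u]
    by (simp add: q_add_left q_add_right q_scale_left q_scale_right D_scale D_add algebra_simps)
  also have "Re \<dots> = (seminorm u)\<^sup>2 + 2 * Re (cnj c * q u v) + (cmod c)\<^sup>2 * (seminorm v)\<^sup>2"
    using assms by (simp add: q_self flip: complex_norm_square of_real_power of_real_mult)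
  finally show ?thesis .
qed

text \<open>The argument for a possibly degenerate form: expand the squared seminorm of u - t (q u
  v) v for real t. If \<open>seminorm v\<close> is 0, what remains is linear in t and forces q u v =
  0; otherwise t = 1 / (seminorm v)^2 is optimal.\<close>

lemma q_Cauchy_Schwarz:
  assumes "u \<in> D" "v \<in> D"
  shows "cmod (q u v) \<le> seminorm u * seminorm v"
proof -
  let ?a = "(cmod (q u v))\<^sup>2"
  have *: "2 * t * ?a \<le> (seminorm u)\<^sup>2 + t\<^sup>2 * ?a * (seminorm v)\<^sup>2" for t
  proof -
    have "cnj (of_real (- t) * q u v) * q u v = of_real (- t * ?a)"
      using complex_norm_square[of "q u v"] by (simp add: mult.commute)
    then have "0 \<le> (seminorm u)\<^sup>2 - 2 * t * ?a + t\<^sup>2 * ?a * (seminorm v)\<^sup>2"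
      using q_expand[OF assms, of "of_real (- t) * q u v"]
        zero_le_power2[of "seminorm (u + (of_real (- t) * q u v) *\<^sub>C v)"]
      by (simp add: norm_mult power_mult_distrib del: of_real_power of_real_mult of_real_minus)
    then show ?thesis by simp
  qed
  have "?a \<le> (seminorm u)\<^sup>2 * (seminorm v)\<^sup>2"
  proof (cases "seminorm v = 0")
    case True
    have "?a = 0"
    proof (rule ccontr)
      assume "?a \<noteq> 0"
      then show False
        using *[of "((seminorm u)\<^sup>2 + 1) / (2 * ?a)"] True by simp
    qed
    then show ?thesis using True by simp
  next
    case False
    have "2 * ?a / (seminorm v)\<^sup>2 \<le> (seminorm u)\<^sup>2 + ?a / (seminorm v)\<^sup>2"
      using *[of "1 / (seminorm v)\<^sup>2"] False by (simp add: power2_eq_square)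
    then have "?a / (seminorm v)\<^sup>2 \<le> (seminorm u)\<^sup>2" by simp
    then show ?thesis using False by (simp add: pos_divide_le_eq)
  qed
  then have "?a \<le> (seminorm u * seminorm v)\<^sup>2" by (simp add: power_mult_distrib)
  then show ?thesis
    by (rule power2_le_imp_le) (simp add: seminorm_nonneg assms)
qed

lemma seminorm_triangle:
  assumes "u \<in> D" "v \<in> D"
  shows "seminorm (u + v) \<le> seminorm u + seminorm v"
proof (rule power2_le_imp_le)
  have "Re (q u v) \<le> seminorm u * seminorm v"
    using complex_Re_le_cmod q_Cauchy_Schwarz[OF assms] by (rule order_trans)
  then show "(seminorm (u + v))\<^sup>2 \<le> (seminorm u + seminorm v)\<^sup>2"
    using q_expand[OF assms, of 1] by (simp add: power2_sum)
qed (simp add: seminorm_nonneg assms)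

lemma seminorm_scale: "u \<in> D \<Longrightarrow> seminorm (c *\<^sub>C u) = cmod c * seminorm u"
proof -
  assume u: "u \<in> D"
  have "(seminorm (c *\<^sub>C u))\<^sup>2 = (cmod c * seminorm u)\<^sup>2"
  proof -
    have "q (c *\<^sub>C u) (c *\<^sub>C u) = (c * cnj c) * q u u"
      using u by (simp add: q_scale_left q_scale_right)
    then have "complex_of_real ((seminorm (c *\<^sub>C u))\<^sup>2) = of_real ((cmod c * seminorm u)\<^sup>2)"
      using u by (simp only: q_self D_scale complex_norm_square[symmetric] of_real_mult power_mult_distrib)
    then show ?thesis using of_real_eq_iff by blast
  qed
  then show ?thesis using u by (simp add: power2_eq_iff_nonneg seminorm_nonneg D_scale)
qed

lemma q_diff_bound:
  assumes "a \<in> D" "b \<in> D" "c \<in> D" "d \<in> D"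
  shows "cmod (q a b - q c d) \<le> seminorm (a - c) * seminorm b + seminorm c * seminorm (b - d)"
proof -
  have "q a b - q c d = q (a - c) b + q c (b - d)"
    using assms by (simp add: q_diff_left q_diff_right)
  then have "cmod (q a b - q c d) \<le> cmod (q (a - c) b) + cmod (q c (b - d))"
    by (simp add: norm_triangle_ineq)
  then show ?thesis
    using q_Cauchy_Schwarz[of "a - c" b] q_Cauchy_Schwarz[of c "b - d"] assms
    by (simp add: D_diff)
qed

section \<open>Convergence in the form sense\<close>

lemma form_converges_iff:
  "form_converges T s u \<longleftrightarrow> (\<forall>n. s n \<in> D) \<and> s \<longlonglongrightarrow> u
    \<and> (\<forall>e>0. \<exists>M. \<forall>m\<ge>M. \<forall>n\<ge>M. seminorm (s m - s n) < e)" (is "?l \<longleftrightarrow> ?r")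
proof -
  have eq: "cmod (q (s m - s n) (s m - s n)) = (seminorm (s m - s n))\<^sup>2" if "range s \<subseteq> D" for m n
    using that by (subst q_self) (auto intro!: D_diff simp: norm_power)
  show ?thesis
  proof
    assume l: ?l
    then have r: "range s \<subseteq> D" by (simp add: form_converges_def)
    have "\<exists>M. \<forall>m\<ge>M. \<forall>n\<ge>M. seminorm (s m - s n) < e" if "e > 0" for e
    proof -
      have "e\<^sup>2 > 0" using that by simp
      then obtain M where "\<forall>m\<ge>M. \<forall>n\<ge>M. (seminorm (s m - s n))\<^sup>2 < e\<^sup>2"
        using l unfolding form_converges_def eq[OF r] by blast
      then show ?thesis
        using that by (auto intro!: exI[of _ M] power2_less_imp_less[of _ e])
    qed
    then show ?r using l by (auto simp: form_converges_def)
  next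
    assume r: ?r
    then have s: "range s \<subseteq> D" by auto
    have "\<exists>M. \<forall>m\<ge>M. \<forall>n\<ge>M. (seminorm (s m - s n))\<^sup>2 < e" if "e > 0" for e
    proof -
      have "sqrt e > 0" using that by simp
      then obtain M where M: "\<forall>m\<ge>M. \<forall>n\<ge>M. seminorm (s m - s n) < sqrt e" using r by blast
      have "(seminorm (s m - s n))\<^sup>2 < (sqrt e)\<^sup>2" if "m \<ge> M" "n \<ge> M" for m n
        using M that r by (intro power_strict_mono seminorm_nonneg D_diff) auto
      then show ?thesis using that by auto
    qed
    then show ?l using r s unfolding form_converges_def by (simp add: eq)
  qed
qed

lemma form_converges_D: "form_converges T s u \<Longrightarrow> s n \<in> D"
  by (simp add: form_converges_iff)

lemma form_converges_tendsto: "form_converges T s u \<Longrightarrow> s \<longlonglongrightarrow> u"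
  by (simp add: form_converges_iff)

lemma form_converges_Cauchy:
  assumes "form_converges T s u" "e > 0"
  obtains M where "\<And>m n. m \<ge> M \<Longrightarrow> n \<ge> M \<Longrightarrow> seminorm (s m - s n) < e"
  using assms unfolding form_converges_iff by meson

lemma form_converges_const: "u \<in> D \<Longrightarrow> form_converges T (\<lambda>_. u) u"
  using seminorm_scale[of 0 0] D_zero by (auto simp: form_converges_iff)

lemma form_converges_scale:
  assumes "form_converges T s u"
  shows "form_converges T (\<lambda>n. c *\<^sub>C s n) (c *\<^sub>C u)"
  unfolding form_converges_iff
proof (intro conjI allI impI)
  show "c *\<^sub>C s n \<in> D" for n using assms by (intro D_scale form_converges_D)
  show "(\<lambda>n. c *\<^sub>C s n) \<longlonglongrightarrow> c *\<^sub>C u"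
    using assms by (intro tendsto_scaleC form_converges_tendsto)
  fix e :: real assume "e > 0"
  \<comment> \<open>Dividing by \<open>cmod c + 1\<close> instead of \<open>cmod c\<close> also
    covers c = 0.\<close>
  then have "e / (cmod c + 1) > 0" by (simp add: add_nonneg_pos)
  then obtain M where M: "\<And>m n. m \<ge> M \<Longrightarrow> n \<ge> M \<Longrightarrow> seminorm (s m - s n) < e / (cmod c + 1)"
    using form_converges_Cauchy[OF assms] by blast
  have "seminorm (c *\<^sub>C s m - c *\<^sub>C s n) < e" if "m \<ge> M" "n \<ge> M" for m n
  proof -
    have p: "s m - s n \<in> D" using assms by (intro D_diff form_converges_D)
    have "seminorm (c *\<^sub>C s m - c *\<^sub>C s n) = cmod c * seminorm (s m - s n)"
      using seminorm_scale[OF p, of c] by (simp add: scaleC_diff_right)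
    also have "\<dots> \<le> (cmod c + 1) * seminorm (s m - s n)"
      using seminorm_nonneg[OF p] by (intro mult_right_mono) auto
    also have "\<dots> < e"
      using M[OF that] by (simp add: add_nonneg_pos pos_less_divide_eq mult.commute)
    finally show ?thesis .
  qed
  then show "\<exists>M. \<forall>m\<ge>M. \<forall>n\<ge>M. seminorm (c *\<^sub>C s m - c *\<^sub>C s n) < e" by blast
qed

lemma form_converges_add:
  assumes s: "form_converges T s u" and t: "form_converges T t v"
  shows "form_converges T (\<lambda>n. s n + t n) (u + v)"
  unfolding form_converges_iff
proof (intro conjI allI impI)
  show "s n + t n \<in> D" for n using s t by (intro D_add form_converges_D)
  show "(\<lambda>n. s n + t n) \<longlonglongrightarrow> u + v"
    using s t by (intro tendsto_add form_converges_tendsto)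
  fix e :: real assume e: "e > 0"
  obtain M where M: "\<And>m n. m \<ge> M \<Longrightarrow> n \<ge> M \<Longrightarrow> seminorm (s m - s n) < e / 2"
    using form_converges_Cauchy[OF s, of "e / 2"] e by auto
  obtain M' where M': "\<And>m n. m \<ge> M' \<Longrightarrow> n \<ge> M' \<Longrightarrow> seminorm (t m - t n) < e / 2"
    using form_converges_Cauchy[OF t, of "e / 2"] e by auto
  have "seminorm ((s m + t m) - (s n + t n)) < e" if "m \<ge> max M M'" "n \<ge> max M M'" for m n
  proof -
    have "seminorm ((s m - s n) + (t m - t n)) \<le> seminorm (s m - s n) + seminorm (t m - t n)"
      using s t by (intro seminorm_triangle D_diff form_converges_D)
    then show ?thesis
      using M[of m n] M'[of m n] that by (simp add: algebra_simps)
  qed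
  then show "\<exists>M. \<forall>m\<ge>M. \<forall>n\<ge>M. seminorm ((s m + t m) - (s n + t n)) < e" by blast
qed

lemma form_converges_diff:
  "form_converges T s u \<Longrightarrow> form_converges T t v \<Longrightarrow> form_converges T (\<lambda>n. s n - t n) (u - v)"
  unfolding diff_conv_scaleC by (intro form_converges_add form_converges_scale)

lemma form_converges_bounded:
  assumes s: "form_converges T s u"
  obtains b where "b > 0" "\<And>n. seminorm (s n) \<le> b"
proof -
  obtain M where M: "\<And>m n. m \<ge> M \<Longrightarrow> n \<ge> M \<Longrightarrow> seminorm (s m - s n) < 1"
    using form_converges_Cauchy[OF s, of 1] by auto
  define b where "b = Max (insert 0 ((\<lambda>n. seminorm (s n)) ` {..M})) + 1"
  have fin: "finite (insert 0 ((\<lambda>n. seminorm (s n)) ` {..M}))" by simp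
  have b0: "b > 0" using Max_ge[OF fin, of 0] by (simp add: b_def)
  have b1: "seminorm (s n) \<le> b - 1" if "n \<le> M" for n
    using that Max_ge[OF fin, of "seminorm (s n)"] by (auto simp: b_def)
  have "seminorm (s n) \<le> b" for n
  proof (cases "n \<le> M")
    case True
    then show ?thesis using b1[of n] by simp
  next
    case False
    have "seminorm ((s n - s M) + s M) \<le> seminorm (s n - s M) + seminorm (s M)"
      using s by (intro seminorm_triangle D_diff form_converges_D)
    then show ?thesis using M[of n M] b1[of M] False by simp
  qed
  with b0 show thesis by (rule that)
qed

text \<open>This is closability of the form: it is where symmetry of the operator, and not only
  nonnegativity, enters.\<close>

lemma seminorm_tendsto_zero:
  assumes s: "form_converges T s 0"
  shows "(\<lambda>n. seminorm (s n)) \<longlonglongrightarrow> 0"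
proof -
  obtain b where b: "b > 0" "\<And>n. seminorm (s n) \<le> b"
    using form_converges_bounded[OF s] by blast
  have "(\<lambda>n. (seminorm (s n))\<^sup>2) \<longlonglongrightarrow> 0"
  proof (rule LIMSEQ_I)
    fix e :: real assume e: "e > 0"
    obtain M where M: "\<And>m n. m \<ge> M \<Longrightarrow> n \<ge> M \<Longrightarrow> seminorm (s m - s n) < e / (2 * b)"
      using form_converges_Cauchy[OF s, of "e / (2 * b)"] e b by auto
    have "(seminorm (s n))\<^sup>2 \<le> e / 2" if n: "n \<ge> M" for n
    \<comment> \<open>Keep n fixed and let m tend to infinity: \<open>q (s n) (s m)\<close> is the
      inner product of the fixed vector \<open>app_op T (s n)\<close> with \<open>s m\<close>, so it
      tends to 0 although nothing bounds \<open>app_op T (s m)\<close>.\<close>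
    proof (rule tendsto_upperbound)
      show "(\<lambda>m. (seminorm (s n))\<^sup>2 - Re (q (s n) (s m))) \<longlonglongrightarrow> (seminorm (s n))\<^sup>2"
        using tendsto_diff[OF tendsto_const[of "(seminorm (s n))\<^sup>2"]
            tendsto_Re[OF tendsto_cinner[OF tendsto_const form_converges_tendsto[OF s]]]]
        by (simp add: form_of_def)
      show "eventually (\<lambda>m. (seminorm (s n))\<^sup>2 - Re (q (s n) (s m)) \<le> e / 2) sequentially"
        using eventually_ge_at_top[of M]
      proof eventually_elim
        case (elim m)
        have D: "s k \<in> D" for k using s by (rule form_converges_D)
        have "(seminorm (s n))\<^sup>2 - Re (q (s n) (s m)) = Re (q (s n) (s n - s m))"
          using D by (simp add: q_diff_right flip: Re_q_self)
        also have "\<dots> \<le> seminorm (s n) * seminorm (s n - s m)"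
          using q_Cauchy_Schwarz[OF D D_diff[OF D D]] complex_Re_le_cmod by (rule order_trans[rotated])
        also have "\<dots> \<le> b * (e / (2 * b))"
          using b M[OF n elim] seminorm_nonneg[OF D_diff[OF D D]]
          by (intro mult_mono) (auto intro: less_imp_le)
        finally show ?case using b by simp
      qed
    qed auto
    then show "\<exists>N. \<forall>n\<ge>N. norm ((seminorm (s n))\<^sup>2 - 0) < e"
      using e by (intro exI[of _ M]) (force intro: le_less_trans)
  qed
  then have "(\<lambda>n. sqrt ((seminorm (s n))\<^sup>2)) \<longlonglongrightarrow> sqrt 0" by (rule tendsto_real_sqrt)
  then show ?thesis using s by (simp add: seminorm_nonneg form_converges_D)
qed

section \<open>The closed form\<close>

lemma q_converges:
  assumes s: "form_converges T s u" and t: "form_converges T t v"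
  shows "convergent (\<lambda>n. q (s n) (t n))"
proof -
  obtain b where b: "b > 0" "\<And>n. seminorm (s n) \<le> b"
    using form_converges_bounded[OF s] by blast
  obtain b' where b': "b' > 0" "\<And>n. seminorm (t n) \<le> b'"
    using form_converges_bounded[OF t] by blast
  have "Cauchy (\<lambda>n. q (s n) (t n))"
  proof (rule CauchyI)
    fix e :: real assume e: "e > 0"
    obtain M where M: "\<And>m n. m \<ge> M \<Longrightarrow> n \<ge> M \<Longrightarrow> seminorm (s m - s n) < e / (2 * b')"
      using form_converges_Cauchy[OF s, of "e / (2 * b')"] e b' by auto
    obtain M' where M': "\<And>m n. m \<ge> M' \<Longrightarrow> n \<ge> M' \<Longrightarrow> seminorm (t m - t n) < e / (2 * b)"
      using form_converges_Cauchy[OF t, of "e / (2 * b)"] e b by auto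
    have "cmod (q (s m) (t m) - q (s n) (t n)) < e" if "m \<ge> max M M'" "n \<ge> max M M'" for m n
    proof -
      have D: "s k \<in> D" "t k \<in> D" for k using s t by (auto intro: form_converges_D)
      have "cmod (q (s m) (t m) - q (s n) (t n))
          \<le> seminorm (s m - s n) * seminorm (t m) + seminorm (s n) * seminorm (t m - t n)"
        by (intro q_diff_bound D)
      also have "\<dots> \<le> seminorm (s m - s n) * b' + b * seminorm (t m - t n)"
        using b b' D by (intro add_mono mult_mono seminorm_nonneg D_diff) (auto intro: less_imp_le)
      also have "\<dots> < e / (2 * b') * b' + b * (e / (2 * b))"
        using M[of m n] M'[of m n] that b b'
        by (intro add_strict_mono mult_strict_right_mono mult_strict_left_mono) auto
      also have "\<dots> = e" using b b' by simp
      finally show ?thesis .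
    qed
    then show "\<exists>M. \<forall>m\<ge>M. \<forall>n\<ge>M. cmod (q (s m) (t m) - q (s n) (t n)) < e" by blast
  qed
  then show ?thesis by (simp add: Cauchy_convergent_iff)
qed

text \<open>The difference of two sequences that approximate the same vector converges to 0 in the
  form sense, so its seminorms vanish in the limit by closability.\<close>

lemma q_limit_unique:
  assumes s: "form_converges T s u" "form_converges T s' u"
    and t: "form_converges T t v" "form_converges T t' v"
    and lim: "(\<lambda>n. q (s n) (t n)) \<longlonglongrightarrow> c"
  shows "(\<lambda>n. q (s' n) (t' n)) \<longlonglongrightarrow> c"
proof -
  obtain b where b: "b > 0" "\<And>n. seminorm (s n) \<le> b"
    using form_converges_bounded[OF s(1)] by blast
  obtain b' where b': "b' > 0" "\<And>n. seminorm (t' n) \<le> b'"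
    using form_converges_bounded[OF t(2)] by blast
  have D: "s k \<in> D" "t k \<in> D" "s' k \<in> D" "t' k \<in> D" for k
    using s t by (auto intro: form_converges_D)
  have S: "(\<lambda>n. seminorm (s' n - s n)) \<longlonglongrightarrow> 0"
    using form_converges_diff[OF s(2,1)] by (intro seminorm_tendsto_zero) simp
  have S': "(\<lambda>n. seminorm (t' n - t n)) \<longlonglongrightarrow> 0"
    using form_converges_diff[OF t(2,1)] by (intro seminorm_tendsto_zero) simp
  have "(\<lambda>n. q (s' n) (t' n) - q (s n) (t n)) \<longlonglongrightarrow> 0"
  proof (rule Lim_null_comparison)
    show "eventually (\<lambda>n. norm (q (s' n) (t' n) - q (s n) (t n))
        \<le> seminorm (s' n - s n) * b' + b * seminorm (t' n - t n)) sequentially"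
    proof (intro always_eventually allI)
      fix n
      have "norm (q (s' n) (t' n) - q (s n) (t n))
          \<le> seminorm (s' n - s n) * seminorm (t' n) + seminorm (s n) * seminorm (t' n - t n)"
        by (intro q_diff_bound D)
      also have "\<dots> \<le> seminorm (s' n - s n) * b' + b * seminorm (t' n - t n)"
        using b b' D by (intro add_mono mult_mono seminorm_nonneg D_diff) (auto intro: less_imp_le)
      finally show "norm (q (s' n) (t' n) - q (s n) (t n))
        \<le> seminorm (s' n - s n) * b' + b * seminorm (t' n - t n)" .
    qed
    show "(\<lambda>n. seminorm (s' n - s n) * b' + b * seminorm (t' n - t n)) \<longlonglongrightarrow> 0"
      using tendsto_add[OF tendsto_mult_left_zero[OF S] tendsto_mult_right_zero[OF S']] by simp
  qed
  then show ?thesis using tendsto_add[OF _ lim] by fastforce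
qed

text \<open>Discharges the definite description in \<open>closed_form\<close>: existence by
  \<open>q_converges\<close>, uniqueness by \<open>q_limit_unique\<close>. The algebra of the closed
  form is afterwards read off from limits.\<close>

lemma closed_form_tendsto:
  assumes s: "form_converges T s u" and t: "form_converges T t v"
  shows "(\<lambda>n. q (s n) (t n)) \<longlonglongrightarrow> B u v"
proof -
  obtain c where c: "(\<lambda>n. q (s n) (t n)) \<longlonglongrightarrow> c"
    using q_converges[OF s t] by (auto simp: convergent_def)
  have "\<forall>s t. form_converges T s u \<longrightarrow> form_converges T t v \<longrightarrow> (\<lambda>n. q (s n) (t n)) \<longlonglongrightarrow> B u v"
    unfolding closed_form_def
  proof (rule theI[where a=c])
    show "\<forall>s t. form_converges T s u \<longrightarrow> form_converges T t v \<longrightarrow> (\<lambda>n. q (s n) (t n)) \<longlonglongrightarrow> c"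
      using q_limit_unique[OF s _ t _ c] by blast
    show "x = c" if "\<forall>s t. form_converges T s u \<longrightarrow> form_converges T t v \<longrightarrow>
        (\<lambda>n. q (s n) (t n)) \<longlonglongrightarrow> x" for x
      using that s t c LIMSEQ_unique by blast
  qed
  then show ?thesis using s t by blast
qed

lemma F_iff: "u \<in> F \<longleftrightarrow> (\<exists>s. form_converges T s u)"
  by (simp add: closed_form_domain_def)

lemma D_subset_F: "u \<in> D \<Longrightarrow> u \<in> F"
  using form_converges_const F_iff by blast

lemma F_add: "u \<in> F \<Longrightarrow> v \<in> F \<Longrightarrow> u + v \<in> F"
  using form_converges_add F_iff by blast

lemma F_scale: "u \<in> F \<Longrightarrow> c *\<^sub>C u \<in> F"
  using form_converges_scale F_iff by blast

lemma closed_form_add_left: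
  assumes "u \<in> F" "v \<in> F" "w \<in> F"
  shows "B (u + v) w = B u w + B v w"
proof -
  obtain r s t where r: "form_converges T r u" and s: "form_converges T s v"
    and t: "form_converges T t w"
    using assms F_iff by auto
  have "(\<lambda>n. q (r n + s n) (t n)) \<longlonglongrightarrow> B u w + B v w"
    using tendsto_add[OF closed_form_tendsto[OF r t] closed_form_tendsto[OF s t]] r s
    by (simp add: q_add_left form_converges_D)
  then show ?thesis
    using closed_form_tendsto[OF form_converges_add[OF r s] t] LIMSEQ_unique by blast
qed

lemma closed_form_scale_left:
  assumes "u \<in> F" "w \<in> F"
  shows "B (c *\<^sub>C u) w = c * B u w"
proof -
  obtain r t where r: "form_converges T r u" and t: "form_converges T t w"
    using assms F_iff by auto
  have "(\<lambda>n. q (c *\<^sub>C r n) (t n)) \<longlonglongrightarrow> c * B u w"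
    using tendsto_mult_left[OF closed_form_tendsto[OF r t], of c] r
    by (simp add: q_scale_left form_converges_D)
  then show ?thesis
    using closed_form_tendsto[OF form_converges_scale[OF r] t] LIMSEQ_unique by blast
qed

lemma closed_form_hermitian:
  assumes "u \<in> F" "v \<in> F"
  shows "B u v = cnj (B v u)"
proof -
  obtain s t where s: "form_converges T s u" and t: "form_converges T t v"
    using assms F_iff by auto
  have "(\<lambda>n. q (s n) (t n)) \<longlonglongrightarrow> cnj (B v u)"
    using tendsto_cnj[OF closed_form_tendsto[OF t s]] s t
    by (simp add: q_hermitian[symmetric] form_converges_D)
  then show ?thesis using closed_form_tendsto[OF s t] LIMSEQ_unique by blast
qed

lemma closed_form_nonneg:
  assumes "u \<in> F"
  shows "0 \<le> Re (B u u)"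
proof -
  obtain s where s: "form_converges T s u" using assms F_iff by auto
  show ?thesis
    using tendsto_Re[OF closed_form_tendsto[OF s s]] s
    by (rule_tac tendsto_lowerbound) (auto intro!: always_eventually q_nonneg form_converges_D)
qed

lemma closed_form_on_domain:
  assumes "(u, w) \<in> T" "v \<in> F"
  shows "B u v = cinner w v"
proof -
  obtain t where t: "form_converges T t v" using assms F_iff by auto
  have "form_converges T (\<lambda>_. u) u" using assms(1) form_converges_const by blast
  from closed_form_tendsto[OF this t] have "(\<lambda>n. cinner w (t n)) \<longlonglongrightarrow> B u v"
    by (simp add: form_of_def app_eq[OF assms(1)])
  moreover have "(\<lambda>n. cinner w (t n)) \<longlonglongrightarrow> cinner w v"
    using t by (intro tendsto_cinner tendsto_const form_converges_tendsto)
  ultimately show ?thesis by (rule LIMSEQ_unique)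
qed

text \<open>Density is why a weak equation determines its right-hand side, and hence why the
  extension is single-valued.\<close>

lemma dense_cinner_eq_zero:
  assumes "\<And>v. v \<in> D \<Longrightarrow> cinner w v = 0"
  shows "w = 0"
proof -
  have "w \<in> closure D" using dense by (simp add: densely_defined_def)
  then obtain s where s: "\<And>n. s n \<in> D" "s \<longlonglongrightarrow> w"
    unfolding closure_sequential by auto
  have "(\<lambda>n. cinner w (s n)) \<longlonglongrightarrow> cinner w w"
    by (intro tendsto_cinner tendsto_const s)
  then have "cinner w w = 0" using assms s(1) LIMSEQ_unique[OF _ tendsto_const] by simp
  then show ?thesis by (simp add: cinner_self)
qed

section \<open>The extension as a symmetric linear operator\<close>

lemma friedrichs_iff: "(u, w) \<in> A \<longleftrightarrow> u \<in> F \<and> (\<forall>v\<in>F. B u v = cinner w v)"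
  by (simp add: friedrichs_extension_def)

lemma extends: "T \<subseteq> A"
  using closed_form_on_domain D_subset_F[OF DomainI] friedrichs_iff by auto

lemma friedrichs_symmetric: "(u, w) \<in> A \<Longrightarrow> (v, z) \<in> A \<Longrightarrow> cinner w v = cinner u z"
  using closed_form_hermitian cinner_commute by (metis friedrichs_iff)

lemma friedrichs_nonneg: "(u, w) \<in> A \<Longrightarrow> 0 \<le> Re (cinner w u)"
  using closed_form_nonneg by (metis friedrichs_iff)

lemma friedrichs_add: "(u, w) \<in> A \<Longrightarrow> (v, z) \<in> A \<Longrightarrow> (u + v, w + z) \<in> A"
  by (simp add: friedrichs_iff F_add closed_form_add_left cinner_add_left)

lemma friedrichs_scale: "(u, w) \<in> A \<Longrightarrow> (c *\<^sub>C u, c *\<^sub>C w) \<in> A"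
  by (simp add: friedrichs_iff F_scale closed_form_scale_left cinner_scaleC_left)

lemma friedrichs_diff: "(u, w) \<in> A \<Longrightarrow> (v, z) \<in> A \<Longrightarrow> (u - v, w - z) \<in> A"
  unfolding diff_conv_scaleC by (intro friedrichs_add friedrichs_scale)

lemma friedrichs_zero: "(0, w) \<in> A \<Longrightarrow> w = 0"
proof (rule dense_cinner_eq_zero)
  fix v assume "(0, w) \<in> A" "v \<in> D"
  moreover have "(0, 0) \<in> A" using linear extends by (auto simp: linear_op_def)
  ultimately show "cinner w v = 0"
    using D_subset_F by (metis cinner_zero_left friedrichs_iff)
qed

lemma linear_friedrichs: "linear_op A"
  unfolding linear_op_def
proof (intro conjI)
  show "single_valued A"
    unfolding single_valued_def
    using friedrichs_diff friedrichs_zero by (metis diff_self eq_iff_diff_eq_0)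
  show "(0, 0) \<in> A" using linear extends by (auto simp: linear_op_def)
qed (use friedrichs_add friedrichs_scale in auto)

lemma densely_defined_friedrichs: "densely_defined A"
  using dense closure_mono[OF Domain_mono[OF extends]] unfolding densely_defined_def by auto

text \<open>The functional whose critical points satisfy q x v + a (x, v) = (w, v) for all v, the
  weak form of (A + a) x = w.\<close>

definition energy :: "real \<Rightarrow> 'a L2 \<Rightarrow> 'a L2 \<Rightarrow> real" where
  "energy a w x = (seminorm x)\<^sup>2 + a * (norm x)\<^sup>2 - 2 * Re (cinner w x)"

lemma energy_expand:
  assumes "x \<in> D" "v \<in> D"
  shows "energy a w (x + of_real t *\<^sub>C v) = energy a w x
    + 2 * t * Re (q x v + a * cinner x v - cinner w v)
    + t\<^sup>2 * ((seminorm v)\<^sup>2 + a * (norm v)\<^sup>2)"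
proof -
  have "complex_of_real ((norm (x + of_real t *\<^sub>C v))\<^sup>2)
      = cinner x x + of_real t * (cinner x v + cnj (cinner x v)) + of_real (t\<^sup>2) * cinner v v"
    using cinner_commute[of v x]
    by (simp add: cinner_add_left cinner_add_right cinner_scaleC_left cinner_scaleC_right
        algebra_simps power2_eq_square[of t] flip: cinner_self del: of_real_power)
  then have "(norm (x + of_real t *\<^sub>C v))\<^sup>2
      = Re (cinner x x + of_real t * (cinner x v + cnj (cinner x v)) + of_real (t\<^sup>2) * cinner v v)"
    by (metis Re_complex_of_real)
  then have "(norm (x + of_real t *\<^sub>C v))\<^sup>2
      = (norm x)\<^sup>2 + 2 * t * Re (cinner x v) + t\<^sup>2 * (norm v)\<^sup>2"
    by (simp add: cinner_self del: of_real_power)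
  then show ?thesis
    using q_expand[OF assms, of "of_real t"]
    by (simp add: energy_def cinner_add_right cinner_scaleC_right algebra_simps)
qed

text \<open>Along the segment from x to y the energy is a quadratic polynomial whose leading
  coefficient is the squared energy distance of x and y. Comparing its values at 0, 1/2 and 1
  eliminates the linear term.\<close>

lemma energy_parallelogram:
  assumes "x \<in> D" "y \<in> D"
  shows "energy a w x + energy a w y = 2 * energy a w (x + of_real (1/2) *\<^sub>C (y - x))
    + ((seminorm (x - y))\<^sup>2 + a * (norm (x - y))\<^sup>2) / 2"
proof -
  have d: "y - x \<in> D" using assms by (intro D_diff)
  have sw: "seminorm (y - x) = seminorm (x - y)"
    using seminorm_scale[OF D_diff[OF assms], of "-1"] by (simp flip: uminus_conv_scaleC)
  define K where "K = (seminorm (x - y))\<^sup>2 + a * (norm (x - y))\<^sup>2"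
  have "energy a w (x + of_real t *\<^sub>C (y - x)) = energy a w x
      + 2 * t * Re (q x (y - x) + a * cinner x (y - x) - cinner w (y - x)) + t\<^sup>2 * K" for t
    using energy_expand[OF assms(1) d] by (simp add: K_def sw norm_minus_commute[of y x])
  from this[of "1/2"] this[of 1] show ?thesis
    unfolding K_def[symmetric] by (simp add: power2_eq_square del: of_real_divide)
qed

text \<open>The linear term is absorbed into a (norm x)^2 by a weighted arithmetic-geometric
  inequality. This is where a > 0 enters, since the form itself may have no positive lower
  bound.\<close>

lemma energy_lower_bound:
  assumes "a > 0" "x \<in> D"
  shows "- ((norm w)\<^sup>2 / a) \<le> energy a w x"
proof -
  have "Re (cinner w x) \<le> norm w * norm x"
    using complex_Re_le_cmod cinner_Cauchy_Schwarz by (rule order_trans)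
  moreover have "2 * (norm w * norm x) \<le> a * (norm x)\<^sup>2 + (norm w)\<^sup>2 / a"
    using sum_squares_bound[of "sqrt a * norm x" "norm w / sqrt a"] assms(1)
    by (simp add: power_mult_distrib power_divide field_simps)
  ultimately show ?thesis
    using zero_le_power2[of "seminorm x"] unfolding energy_def by linarith
qed

text \<open>The weak solution of \<open>(A + a) u = w\<close> is obtained as limit of a minimizing sequence of the
  energy; the parallelogram law makes such a sequence converge in the form sense.\<close>

lemma friedrichs_surj:
  assumes a: "a > 0"
  shows "\<exists>u. (u, w - complex_of_real a *\<^sub>C u) \<in> A"
proof -
  define J where "J = energy a w"
  define d where "d = Inf (J ` D)"
  have bdd: "bdd_below (J ` D)"
    using energy_lower_bound[OF a] by (auto simp: J_def intro!: bdd_belowI)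
  have d: "d \<le> J x" if "x \<in> D" for x
    unfolding d_def using that bdd by (intro cInf_lower) auto
  have "\<exists>x\<in>D. J x < d + 1 / real (Suc n)" for n
  proof -
    have "Inf (J ` D) < d + 1 / real (Suc n)" by (simp add: d_def)
    then show ?thesis using cInf_lessD[of "J ` D"] D_zero by blast
  qed
  then obtain x where xD: "\<And>n. x n \<in> D" and x: "\<And>n. J (x n) < d + 1 / real (Suc n)" by metis
  \<comment> \<open>Midpoints of the sequence lie in \<open>D\<close> and have energy at least d, so
    the parallelogram identity bounds the distance of two near-minimizers by their excess
    energies.\<close>
  have close: "(seminorm (x m - x n))\<^sup>2 + a * (norm (x m - x n))\<^sup>2
      \<le> 2 / real (Suc m) + 2 / real (Suc n)" for m n
  proof -
    have "x m + of_real (1/2) *\<^sub>C (x n - x m) \<in> D" by (intro D_add D_scale D_diff xD)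
    moreover have "2 / real (Suc i) = 2 * (1 / real (Suc i))" for i by simp
    ultimately show ?thesis
      using d[of "x m + of_real (1/2) *\<^sub>C (x n - x m)"]
        energy_parallelogram[OF xD xD, of a w m n] x[of m] x[of n] unfolding J_def by argo
  qed
  have small: "\<exists>M. \<forall>m\<ge>M. \<forall>n\<ge>M. 2 / real (Suc m) + 2 / real (Suc n) < e" if "e > 0" for e :: real
  proof -
    have "(\<lambda>n. 2 * (1 / real (Suc n))) \<longlonglongrightarrow> 2 * 0"
      using LIMSEQ_inverse_real_of_nat by (intro tendsto_mult_left) (simp add: inverse_eq_divide)
    then have "eventually (\<lambda>n. 2 * (1 / real (Suc n)) < e / 2) sequentially"
      using that by (intro order_tendstoD) auto
    then obtain M where "\<forall>n\<ge>M. 2 / real (Suc n) < e / 2"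
      unfolding eventually_sequentially by auto
    then show ?thesis by (intro exI[of _ M]) (smt (verit) field_sum_of_halves)
  qed
  have "Cauchy x"
  proof (rule CauchyI)
    fix e :: real assume "e > 0"
    then obtain M where M: "\<forall>m\<ge>M. \<forall>n\<ge>M. 2 / real (Suc m) + 2 / real (Suc n) < a * e\<^sup>2"
      using small[of "a * e\<^sup>2"] a by auto
    have "norm (x m - x n) < e" if "m \<ge> M" "n \<ge> M" for m n
    proof -
      have "a * (norm (x m - x n))\<^sup>2 < a * e\<^sup>2"
        using close[of m n] M[rule_format, OF that] zero_le_power2[of "seminorm (x m - x n)"]
        by linarith
      then show ?thesis using a \<open>e > 0\<close> by (intro power2_less_imp_less[of _ e]) auto
    qed
    then show "\<exists>M. \<forall>m\<ge>M. \<forall>n\<ge>M. norm (x m - x n) < e" by blast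
  qed
  then obtain u where u: "x \<longlonglongrightarrow> u" by (auto simp: Cauchy_convergent_iff convergent_def)
  have xu: "form_converges T x u"
    unfolding form_converges_iff
  proof (intro conjI allI impI)
    fix e :: real assume "e > 0"
    then obtain M where M: "\<forall>m\<ge>M. \<forall>n\<ge>M. 2 / real (Suc m) + 2 / real (Suc n) < e\<^sup>2"
      using small[of "e\<^sup>2"] by auto
    have "seminorm (x m - x n) < e" if "m \<ge> M" "n \<ge> M" for m n
    proof -
      have "0 \<le> a * (norm (x m - x n))\<^sup>2" using a by simp
      then have "(seminorm (x m - x n))\<^sup>2 < e\<^sup>2"
        using close[of m n] M[rule_format, OF that] by linarith
      then show ?thesis using \<open>e > 0\<close> by (intro power2_less_imp_less[of _ e]) auto
    qed
    then show "\<exists>M. \<forall>m\<ge>M. \<forall>n\<ge>M. seminorm (x m - x n) < e" by blast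
  qed (fact xD, fact u)
  \<comment> \<open>Half the first variation of the energy at \<open>x n\<close> in direction
    v.\<close>
  define L where "L n v = Re (q (x n) v + a * cinner (x n) v - cinner w v)" for n v
  have L: "(L n v)\<^sup>2 \<le> ((seminorm v)\<^sup>2 + a * (norm v)\<^sup>2 + 1) / real (Suc n)" if v: "v \<in> D" for n v
  proof -
    define K where "K = (seminorm v)\<^sup>2 + a * (norm v)\<^sup>2"
    have K: "K \<ge> 0" using a by (simp add: K_def)
    \<comment> \<open>Nearly the minimizer of the quadratic in t; K + 1 in place of K keeps the
      denominator positive when K = 0.\<close>
    define t where "t = - L n v / (K + 1)"
    have "d \<le> J (x n) + 2 * t * L n v + t\<^sup>2 * K"
      using d[OF D_add[OF xD D_scale[OF v]], of n "of_real t"]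
        energy_expand[OF xD[of n] v, of a w t] by (simp add: J_def L_def K_def)
    also have "t\<^sup>2 * K \<le> t\<^sup>2 * (K + 1)" by (simp add: mult_left_mono)
    also have "t\<^sup>2 * (K + 1) = (L n v)\<^sup>2 / (K + 1)"
      using K by (simp add: t_def power2_eq_square)
    also have "2 * t * L n v = - (2 * ((L n v)\<^sup>2 / (K + 1)))"
      by (simp add: t_def power2_eq_square)
    finally have "(L n v)\<^sup>2 / (K + 1) \<le> 1 / real (Suc n)" using x[of n] by simp
    then show ?thesis using K by (simp add: pos_divide_le_eq K_def)
  qed
  \<comment> \<open>The bound on \<open>L n v\<close> depends on v only through its seminorm and
    norm, so it is uniform along a form-convergent sequence, and one diagonal limit passes from v in
    \<open>D\<close> to v in \<open>F\<close>.\<close>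
  have re: "Re (B u v + a * cinner u v - cinner w v) = 0" if v: "v \<in> F" for v
  proof -
    obtain t where t: "form_converges T t v" using v F_iff by auto
    obtain b where b: "b > 0" "\<And>n. seminorm (t n) \<le> b"
      using form_converges_bounded[OF t] by blast
    have "Bseq t"
      using form_converges_tendsto[OF t] convergent_imp_Bseq convergent_def by blast
    then obtain b' where b': "b' > 0" "\<And>n. norm (t n) \<le> b'" by (auto simp: Bseq_def)
    have "(\<lambda>n. L n (t n)) \<longlonglongrightarrow> Re (B u v + a * cinner u v - cinner w v)"
      unfolding L_def
      by (intro tendsto_intros closed_form_tendsto xu t tendsto_cinner form_converges_tendsto u)
    moreover have "(\<lambda>n. L n (t n)) \<longlonglongrightarrow> 0"
    proof -
      have "(\<lambda>n. (L n (t n))\<^sup>2) \<longlonglongrightarrow> 0"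
      proof (rule Lim_null_comparison)
        show "eventually (\<lambda>n. norm ((L n (t n))\<^sup>2)
            \<le> (b\<^sup>2 + a * b'\<^sup>2 + 1) * (1 / real (Suc n))) sequentially"
        proof (intro always_eventually allI)
          fix n
          have "(L n (t n))\<^sup>2 \<le> ((seminorm (t n))\<^sup>2 + a * (norm (t n))\<^sup>2 + 1) / real (Suc n)"
            by (intro L form_converges_D[OF t])
          also have "\<dots> \<le> (b\<^sup>2 + a * b'\<^sup>2 + 1) / real (Suc n)"
            using b b' a form_converges_D[OF t]
            by (intro divide_right_mono add_mono mult_left_mono power_mono seminorm_nonneg) auto
          finally show "norm ((L n (t n))\<^sup>2) \<le> (b\<^sup>2 + a * b'\<^sup>2 + 1) * (1 / real (Suc n))" by simp
        qed
        show "(\<lambda>n. (b\<^sup>2 + a * b'\<^sup>2 + 1) * (1 / real (Suc n))) \<longlonglongrightarrow> 0"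
          using LIMSEQ_inverse_real_of_nat
          by (intro tendsto_mult_right_zero) (simp add: inverse_eq_divide)
      qed
      then show ?thesis by (simp add: tendsto_null_power)
    qed
    ultimately show ?thesis by (rule LIMSEQ_unique)
  qed
  have uF: "u \<in> F" using xu F_iff by blast
  \<comment> \<open>Real variations control only real parts; replacing v by \<i> v recovers the
    imaginary part.\<close>
  have "B u v = cinner (w - of_real a *\<^sub>C u) v" if v: "v \<in> F" for v
  proof -
    have "B u (\<i> *\<^sub>C v) = - \<i> * B u v"
      using closed_form_hermitian[OF uF F_scale[OF v]] closed_form_hermitian[OF uF v]
        closed_form_scale_left[OF v uF] by simp
    then have "Im (B u v + a * cinner u v - cinner w v) = 0"
      using re[OF F_scale[OF v, of \<i>]] by (simp add: cinner_scaleC_right)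
    with re[OF v] have "B u v + a * cinner u v - cinner w v = 0" by (simp add: complex_eq_iff)
    then show ?thesis by (simp add: cinner_diff_left cinner_scaleC_left algebra_simps)
  qed
  then show ?thesis using uF friedrichs_iff by blast
qed

text \<open>A symmetric operator with A + 1 surjective is selfadjoint: for (v, w) in the adjoint
  solve (A + 1) u = w + v; then u and v have the same inner product with every (A + 1) x, that is,
  with every vector.\<close>

lemma selfadjoint_friedrichs: "selfadjoint_op A"
  unfolding selfadjoint_op_def
proof (intro conjI linear_friedrichs densely_defined_friedrichs)
  show "adjoint_op A = A"
  proof (intro subset_antisym subrelI)
    fix v w assume "(v, w) \<in> A"
    then show "(v, w) \<in> adjoint_op A"
      using friedrichs_symmetric by (auto simp: adjoint_op_def)
  next
    fix v w assume "(v, w) \<in> adjoint_op A"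
    then have adj: "cinner y v = cinner x w" if "(x, y) \<in> A" for x y
      using that by (auto simp: adjoint_op_def)
    obtain u where u: "(u, (w + v) - 1 *\<^sub>C u) \<in> A"
      using friedrichs_surj[of 1 "w + v"] by auto
    have "cinner p v = cinner p u" for p
    proof -
      obtain x where x: "(x, p - 1 *\<^sub>C x) \<in> A"
        using friedrichs_surj[of 1 p] by auto
      show ?thesis
        using adj[OF x] friedrichs_symmetric[OF x u]
        by (simp add: cinner_diff_left cinner_diff_right cinner_add_right algebra_simps)
    qed
    then have "cinner (v - u) (v - u) = 0" by (simp add: cinner_diff_right)
    then have "v = u" by (simp add: cinner_self)
    then show "(v, w) \<in> A" using u by simp
  qed
qed

lemma has_friedrichs: "has_friedrichs_extension T"
  unfolding has_friedrichs_extension_def bounded_below_op_def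
  using linear dense symmetric extends selfadjoint_friedrichs nonneg
  by (auto intro!: exI[of _ 0])

section \<open>The spectrum lies in the closed right half-plane\<close>

lemma friedrichs_coercive:
  assumes "(u, w) \<in> A"
  shows "- Re z * norm u \<le> norm (w - z *\<^sub>C u)"
proof (cases "u = 0")
  case False
  have "- Re z * (norm u)\<^sup>2 \<le> Re (cinner (w - z *\<^sub>C u) u)"
    using friedrichs_nonneg[OF assms]
    by (simp add: cinner_diff_left cinner_scaleC_left cinner_self del: of_real_power)
  also have "\<dots> \<le> norm (w - z *\<^sub>C u) * norm u"
    using complex_Re_le_cmod cinner_Cauchy_Schwarz by (rule order_trans)
  finally have "(- Re z * norm u) * norm u \<le> norm (w - z *\<^sub>C u) * norm u"
    by (simp only: power2_eq_square mult.assoc)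
  then show ?thesis using False by (simp only: mult_le_cancel_right) simp
qed simp

text \<open>Surjectivity is so far known only at the negative real points - a. With R the inverse of
  A + a, the equation (A - z) u = w becomes u = R (w + (z + a) u), a contraction of factor |z + a| /
  a as soon as z lies in the open disc of centre - a and radius a.\<close>

lemma friedrichs_resolvent:
  assumes z: "Re z < 0"
  shows "z \<in> resolvent_set A"
proof -
  \<comment> \<open>Every a above |z|^2 / (- 2 Re z) puts z into that disc. This is twice the
    threshold, so that |z + a|^2 = a^2 - |z|^2.\<close>
  define a where "a = (cmod z)\<^sup>2 / (- Re z)"
  have z0: "z \<noteq> 0" using z by auto
  have a: "a > 0" using z z0 by (simp add: a_def divide_pos_neg)
  have "(cmod (z + a))\<^sup>2 = (cmod z)\<^sup>2 + 2 * a * Re z + a\<^sup>2"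
    by (simp add: cmod_power2 power2_sum algebra_simps)
  also have "\<dots> < a\<^sup>2"
  proof -
    have "a * Re z = - ((cmod z)\<^sup>2)" using z by (simp add: a_def)
    moreover have "(cmod z)\<^sup>2 > 0" using z0 by simp
    ultimately show ?thesis by linarith
  qed
  finally have az: "cmod (z + a) < a" using a by (rule power2_less_imp_less[OF _ less_imp_le])
  obtain R where R: "\<And>w. (R w, w - of_real a *\<^sub>C R w) \<in> A"
    using friedrichs_surj[OF a] by metis
  have R_lip: "a * norm (R w - R w') \<le> norm (w - w')" for w w'
    using friedrichs_coercive[OF friedrichs_diff[OF R[of w] R[of w']], of "- of_real a"]
    using scaleC_diff_left[of 0 "of_real a" "R w - R w'"]
    by (simp add: scaleC_diff_right algebra_simps)
  have surj: "\<exists>(u, v) \<in> A. v - z *\<^sub>C u = w" for w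
  proof -
    define f where "f u = R (w + (z + a) *\<^sub>C u)" for u
    have "\<exists>!u. f u = u"
    proof (rule banach_fix_type)
      show "0 \<le> cmod (z + a) / a" "cmod (z + a) / a < 1" using a az by auto
      show "\<forall>x y. dist (f x) (f y) \<le> cmod (z + a) / a * dist x y"
      proof (intro allI)
        fix x y
        have "a * norm (f x - f y) \<le> cmod (z + a) * norm (x - y)"
          using R_lip[of "w + (z + a) *\<^sub>C x" "w + (z + a) *\<^sub>C y"]
          by (simp add: f_def norm_scaleC flip: scaleC_diff_right)
        then show "dist (f x) (f y) \<le> cmod (z + a) / a * dist x y"
          using a by (simp add: dist_norm field_simps)
      qed
    qed
    then obtain u where u: "f u = u" by blast
    have "(u, w + (z + a) *\<^sub>C u - of_real a *\<^sub>C u) \<in> A"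
      using R[of "w + (z + a) *\<^sub>C u"] u by (simp add: f_def)
    then have "(u, w + z *\<^sub>C u) \<in> A" by (simp add: scaleC_add_left)
    then show ?thesis by force
  qed
  have inj: "u = u' \<and> v = v'"
    if "(u, v) \<in> A" "(u', v') \<in> A" and eq: "v - z *\<^sub>C u = v' - z *\<^sub>C u'" for u u' v v'
  proof -
    have uv: "(u - u', v - v') \<in> A" using that friedrichs_diff by blast
    have e: "v - v' = z *\<^sub>C (u - u')" using eq by (simp add: scaleC_diff_right algebra_simps)
    then have "- Re z * norm (u - u') \<le> 0" using friedrichs_coercive[OF uv, of z] by simp
    then have "u = u'" using z by (simp add: zero_le_mult_iff)
    then show ?thesis using e by simp
  qed
  have "bij_betw (\<lambda>(u, v). v - z *\<^sub>C u) A UNIV"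
  proof (rule bij_betw_imageI)
    show "inj_on (\<lambda>(u, v). v - z *\<^sub>C u) A"
    proof (rule inj_onI)
      fix p p' assume "p \<in> A" "p' \<in> A"
        "(case p of (u, v) \<Rightarrow> v - z *\<^sub>C u) = (case p' of (u, v) \<Rightarrow> v - z *\<^sub>C u)"
      then show "p = p'" using inj[of "fst p" "snd p" "fst p'" "snd p'"]
        by (simp add: split_beta prod_eq_iff)
    qed
    show "(\<lambda>(u, v). v - z *\<^sub>C u) ` A = UNIV"
    proof (intro equalityI subset_UNIV subsetI)
      fix w :: "'a L2"
      obtain p where "p \<in> A" "(case p of (u, v) \<Rightarrow> v - z *\<^sub>C u) = w"
        using surj[of w] by auto
      then show "w \<in> (\<lambda>(u, v). v - z *\<^sub>C u) ` A" by blast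
    qed
  qed
  moreover have "\<forall>(u, v) \<in> A. norm u \<le> 1 / (- Re z) * norm (v - z *\<^sub>C u)"
  proof safe
    fix u v assume "(u, v) \<in> A"
    then have "norm u * (- Re z) \<le> norm (v - z *\<^sub>C u)"
      using friedrichs_coercive[of u v z] by (simp add: mult.commute)
    then have "norm u \<le> norm (v - z *\<^sub>C u) / (- Re z)" using z by (subst pos_le_divide_eq) auto
    then show "norm u \<le> 1 / (- Re z) * norm (v - z *\<^sub>C u)" by simp
  qed
  ultimately show ?thesis unfolding resolvent_set_def by blast
qed

lemma spectrum_friedrichs: "z \<in> spectrum A \<Longrightarrow> 0 \<le> Re z"
  using friedrichs_resolvent unfolding spectrum_def by (meson ComplD not_le)

end

section \<open>Smooth functions\<close>

lemma dir_deriv_eq: "(f has_derivative f') (at x) \<Longrightarrow> dir_deriv v f x = f' v"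
  by (metis frechet_derivative_at)

lemma dir_deriv_works:
  "f differentiable (at x) \<Longrightarrow> (f has_derivative (\<lambda>v. dir_deriv v f x)) (at x)"
  by (simp add: frechet_derivative_works)

text \<open>Holds without differentiability: \<open>frechet_derivative\<close> chooses from the set
  of derivatives, and f and g have the same such set at x even if it is empty. This keeps side
  conditions out of local rewriting.\<close>

lemma dir_deriv_cong:
  assumes "open S" "x \<in> S" "\<And>y. y \<in> S \<Longrightarrow> f y = g y"
  shows "dir_deriv v f x = dir_deriv v g x"
proof (cases "f differentiable at x")
  case True
  then show ?thesis
    using frechet_derivative_transform_within_open[OF True assms(1,2)] assms(3) by metis
next
  case False
  have "(\<lambda>f'. (f has_derivative f') (at x)) = (\<lambda>f'. (g has_derivative f') (at x))"
  proof (rule ext)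
    show "(f has_derivative f') (at x) = (g has_derivative f') (at x)" for f'
      using assms has_derivative_transform_within_open by (metis (no_types, lifting))
  qed
  then show ?thesis by (simp add: frechet_derivative_def)
qed

section \<open>Closure properties of the classes C^k\<close>

lemma Ck_on_cong:
  assumes S: "open S" and eq: "\<And>x. x \<in> S \<Longrightarrow> f x = g x" and f: "Ck_on n S f"
  shows "Ck_on n S g"
  using eq f
proof (induction n arbitrary: f g)
  case 0
  then show ?case by (simp cong: continuous_on_cong)
next
  case (Suc n)
  have "g differentiable (at x)" if "x \<in> S" for x
    using Suc.prems that differentiable_transform_within[of f x UNIV]
    by (metis (no_types, lifting) Ck_on.simps(2) S differentiable_def has_derivative_transform_within_open)
  moreover have "Ck_on n S (dir_deriv v g)" for v
  proof (rule Suc.IH)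
    show "Ck_on n S (dir_deriv v f)" using Suc.prems(2) by simp
    show "dir_deriv v f x = dir_deriv v g x" if "x \<in> S" for x
      using dir_deriv_cong[OF S that] Suc.prems(1) by blast
  qed
  ultimately show ?case by simp
qed

lemma Ck_on_SucD: "Ck_on (Suc n) S f \<Longrightarrow> Ck_on n S f"
proof (induction n arbitrary: f)
  case 0
  then show ?case
    by (auto intro!: differentiable_imp_continuous_on differentiable_at_imp_differentiable_on)
next
  case (Suc n)
  then have "Ck_on n S (dir_deriv v f)" for v using Suc.IH by simp
  then show ?case using Suc.prems by simp
qed

lemma Ck_on_subset: "Ck_on n S f \<Longrightarrow> T \<subseteq> S \<Longrightarrow> Ck_on n T f"
  by (induction n arbitrary: f) (auto intro: continuous_on_subset)

lemma Ck_on_const: "Ck_on n S (\<lambda>_. c)"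
  by (induction n arbitrary: c) auto

lemma Ck_on_bounded_linear:
  assumes L: "bounded_linear L" and S: "open S" and "Ck_on n S f"
  shows "Ck_on n S (\<lambda>x. L (f x))"
  using assms(3)
proof (induction n arbitrary: f)
  case 0
  then show ?case by (simp add: bounded_linear.continuous_on[OF L])
next
  case (Suc n)
  have der: "((\<lambda>x. L (f x)) has_derivative (\<lambda>v. L (dir_deriv v f x))) (at x)" if "x \<in> S" for x
    using Suc.prems that by (intro bounded_linear.has_derivative[OF L] dir_deriv_works) auto
  have "Ck_on n S (dir_deriv v (\<lambda>x. L (f x)))" for v
  proof (rule Ck_on_cong[OF S])
    show "Ck_on n S (\<lambda>x. L (dir_deriv v f x))" using Suc by simp
    show "L (dir_deriv v f x) = dir_deriv v (\<lambda>x. L (f x)) x" if "x \<in> S" for x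
      using dir_deriv_eq[OF der[OF that]] by simp
  qed
  then show ?case using der by (auto simp: differentiable_def)
qed

lemma Ck_on_add:
  assumes S: "open S" and "Ck_on n S f" "Ck_on n S g"
  shows "Ck_on n S (\<lambda>x. f x + g x)"
  using assms(2,3)
proof (induction n arbitrary: f g)
  case 0
  then show ?case by (simp add: continuous_on_add)
next
  case (Suc n)
  have der: "((\<lambda>x. f x + g x) has_derivative (\<lambda>v. dir_deriv v f x + dir_deriv v g x)) (at x)"
    if "x \<in> S" for x
    using Suc.prems that by (intro has_derivative_add dir_deriv_works) auto
  have "Ck_on n S (dir_deriv v (\<lambda>x. f x + g x))" for v
  proof (rule Ck_on_cong[OF S])
    show "Ck_on n S (\<lambda>x. dir_deriv v f x + dir_deriv v g x)" using Suc by simp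
    show "dir_deriv v f x + dir_deriv v g x = dir_deriv v (\<lambda>x. f x + g x) x" if "x \<in> S" for x
      using dir_deriv_eq[OF der[OF that]] by simp
  qed
  then show ?case using der by (auto simp: differentiable_def)
qed

lemma Ck_on_bilinear:
  assumes B: "bounded_bilinear B" and S: "open S" and "Ck_on n S f" "Ck_on n S g"
  shows "Ck_on n S (\<lambda>x. B (f x) (g x))"
  using assms(3,4)
proof (induction n arbitrary: f g)
  case 0
  then show ?case by (simp add: bounded_bilinear.continuous_on[OF B])
next
  case (Suc n)
  have der: "((\<lambda>x. B (f x) (g x)) has_derivative
      (\<lambda>v. B (f x) (dir_deriv v g x) + B (dir_deriv v f x) (g x))) (at x)"
    if "x \<in> S" for x
    using Suc.prems that by (intro bounded_bilinear.FDERIV[OF B] dir_deriv_works) auto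
  have "Ck_on n S (dir_deriv v (\<lambda>x. B (f x) (g x)))" for v
  proof (rule Ck_on_cong[OF S])
    have fg: "Ck_on n S f" "Ck_on n S g" using Suc.prems Ck_on_SucD by blast+
    show "Ck_on n S (\<lambda>x. B (f x) (dir_deriv v g x) + B (dir_deriv v f x) (g x))"
      using Suc.prems fg by (intro Ck_on_add[OF S] Suc.IH) auto
    show "B (f x) (dir_deriv v g x) + B (dir_deriv v f x) (g x) = dir_deriv v (\<lambda>x. B (f x) (g x)) x"
      if "x \<in> S" for x
      using dir_deriv_eq[OF der[OF that]] by simp
  qed
  then show ?case using der by (auto simp: differentiable_def)
qed

lemmas Ck_on_mult = Ck_on_bilinear[OF bounded_bilinear_mult]

lemma Ck_on_affine:
  assumes "bounded_linear L"
  shows "Ck_on n S (\<lambda>x. L x + c)"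
proof (cases n)
  case 0
  then show ?thesis
    by (auto intro!: continuous_intros bounded_linear.continuous_on[OF assms])
next
  case (Suc k)
  have der: "((\<lambda>x. L x + c) has_derivative L) (at x)" for x
    using assms bounded_linear_imp_has_derivative by (auto intro!: derivative_eq_intros)
  then have "dir_deriv v (\<lambda>x. L x + c) = (\<lambda>_. L v)" for v
    using dir_deriv_eq[OF der] by (intro ext) simp
  then show ?thesis
    using Suc der by (simp only: Ck_on.simps) (auto simp: Ck_on_const differentiable_def)
qed

lemmas Ck_on_linear = Ck_on_affine[where c=0, simplified]

lemma smooth_onI: "(\<And>n. Ck_on n S f) \<Longrightarrow> smooth_on S f"
  by (simp add: smooth_on_def)

lemma smooth_onD: "smooth_on S f \<Longrightarrow> Ck_on n S f"
  by (simp add: smooth_on_def)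

lemma smooth_on_differentiable: "smooth_on S f \<Longrightarrow> x \<in> S \<Longrightarrow> f differentiable (at x)"
  using smooth_onD[of S f "Suc 0"] by simp

lemma smooth_on_continuous: "smooth_on S f \<Longrightarrow> continuous_on S f"
  using smooth_onD[of S f 0] by simp

lemma smooth_on_dir_deriv: "smooth_on S f \<Longrightarrow> smooth_on S (dir_deriv v f)"
  using smooth_onD[of S f "Suc _"] by (intro smooth_onI) simp

lemma smooth_on_cong:
  "open S \<Longrightarrow> smooth_on S f \<Longrightarrow> (\<And>x. x \<in> S \<Longrightarrow> f x = g x) \<Longrightarrow> smooth_on S g"
  using Ck_on_cong unfolding smooth_on_def by blast

lemma smooth_on_subset: "smooth_on S f \<Longrightarrow> T \<subseteq> S \<Longrightarrow> smooth_on T f"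
  using Ck_on_subset unfolding smooth_on_def by blast

lemma smooth_on_const: "smooth_on S (\<lambda>_. c)"
  by (intro smooth_onI Ck_on_const)

lemma smooth_on_linear: "bounded_linear L \<Longrightarrow> smooth_on S L"
  by (intro smooth_onI Ck_on_linear)

lemma smooth_on_bounded_linear:
  "bounded_linear L \<Longrightarrow> open S \<Longrightarrow> smooth_on S f \<Longrightarrow> smooth_on S (\<lambda>x. L (f x))"
  using Ck_on_bounded_linear unfolding smooth_on_def by blast

lemma smooth_on_add:
  "open S \<Longrightarrow> smooth_on S f \<Longrightarrow> smooth_on S g \<Longrightarrow> smooth_on S (\<lambda>x. f x + g x)"
  using Ck_on_add unfolding smooth_on_def by blast

lemma smooth_on_mult:
  fixes f g :: "'a::euclidean_space \<Rightarrow> 'b::real_normed_algebra"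
  shows "open S \<Longrightarrow> smooth_on S f \<Longrightarrow> smooth_on S g \<Longrightarrow> smooth_on S (\<lambda>x. f x * g x)"
  using Ck_on_mult unfolding smooth_on_def by blast

lemma smooth_on_power:
  fixes f :: "'a::euclidean_space \<Rightarrow> 'b::real_normed_algebra_1"
  assumes "open S" "smooth_on S f"
  shows "smooth_on S (\<lambda>x. f x ^ n)"
  by (induction n) (simp_all add: smooth_on_const smooth_on_mult assms)

lemma smooth_on_prod:
  fixes f :: "'i \<Rightarrow> 'a::euclidean_space \<Rightarrow> real"
  assumes "open S" "finite I" "\<And>i. i \<in> I \<Longrightarrow> smooth_on S (f i)"
  shows "smooth_on S (\<lambda>x. \<Prod>i\<in>I. f i x)"
  using assms(2,3)
  by (induction I rule: finite_induct) (simp_all add: smooth_on_const smooth_on_mult assms(1))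

section \<open>Powers of the norm\<close>

lemma has_derivative_norm_powr:
  fixes x :: "'a::euclidean_space"
  assumes "x \<noteq> 0"
  shows "((\<lambda>x. norm x powr s) has_derivative (\<lambda>v. s * (x \<bullet> v) * norm x powr (s - 2))) (at x)"
proof -
  have "((\<lambda>x. norm x powr s) has_derivative
      (\<lambda>v. (v \<bullet> sgn x) *  s * norm x powr (s - 1))) (at x)"
    using assms by (auto intro!: derivative_eq_intros has_derivative_norm
        simp: field_simps inner_commute powr_diff)
  also have "(\<lambda>v. (v \<bullet> sgn x) *  s * norm x powr (s - 1))
      = (\<lambda>v. s * (x \<bullet> v) * norm x powr (s - 2))"
    using assms by (auto simp: sgn_div_norm powr_diff field_simps inner_commute power2_eq_square
        intro!: ext)
  finally show ?thesis .
qed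

text \<open>Differentiation lowers the exponent by 2 and multiplies by a linear function, so the
  induction on the order must range over all exponents.\<close>

lemma smooth_on_norm_powr: "smooth_on (- {0}) (\<lambda>x::'a::euclidean_space. norm x powr s)"
proof (rule smooth_onI)
  fix n
  show "Ck_on n (- {0::'a}) (\<lambda>x. norm x powr s)"
  proof (induction n arbitrary: s)
    case 0
    then show ?case by (auto intro!: continuous_intros)
  next
    case (Suc n)
    have op: "open (- {0::'a})" by auto
    have "Ck_on n (- {0}) (dir_deriv v (\<lambda>x::'a. norm x powr s))" for v
    proof (rule Ck_on_cong[OF op])
      show "Ck_on n (- {0}) (\<lambda>x::'a. s * (x \<bullet> v) * norm x powr (s - 2))"
        by (intro Ck_on_mult op Suc.IH Ck_on_const Ck_on_linear bounded_linear_inner_left)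
      show "s * (x \<bullet> v) * norm x powr (s - 2) = dir_deriv v (\<lambda>x. norm x powr s) x"
        if "x \<in> - {0}" for x :: 'a
        using that by (intro dir_deriv_eq[OF has_derivative_norm_powr, symmetric]) simp
    qed
    then show ?case using has_derivative_norm_powr by (auto simp: differentiable_def)
  qed
qed

text \<open>The standard flat function exp (- 1 / t) and its quotients by powers of t. Derivatives
  are linear combinations of members of the family, so smoothness is an induction with m
  arbitrary.\<close>

definition cutoff :: "nat \<Rightarrow> real \<Rightarrow> real" where
  "cutoff m t = (if t > 0 then exp (- 1 / t) / t ^ m else 0)"

text \<open>A single term of the exponential series at 1 / t outweighs t^m; taking the term of index
  m + 1 leaves a factor t to spare, which gives the decay at 0.\<close>

lemma cutoff_bound: "\<bar>cutoff m t\<bar> \<le> fact (Suc m) * \<bar>t\<bar>"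
proof (cases "t > 0")
  case True
  have "(1 / t) ^ Suc m / fact (Suc m) \<le> (\<Sum>k<Suc (Suc m). (1 / t) ^ k / fact k)"
    using True by (intro member_le_sum[where f="\<lambda>k. (1 / t) ^ k / fact k"]) auto
  also have "\<dots> \<le> exp (1 / t)"
    using True sum_le_suminf[OF summable_exp_generic, of "{..<Suc (Suc m)}" "1 / t"]
    by (simp add: exp_def divide_inverse mult.commute)
  finally have "1 / (t ^ Suc m * fact (Suc m)) \<le> exp (1 / t)"
    by (simp add: power_one_over)
  then have "1 \<le> exp (1 / t) * (t ^ Suc m * fact (Suc m))"
    using True by (subst (asm) pos_divide_le_eq) auto
  also have "\<dots> = fact (Suc m) * t * (exp (1 / t) * t ^ m)" by simp
  finally have "1 / (exp (1 / t) * t ^ m) \<le> fact (Suc m) * t"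
    using True by (subst pos_divide_le_eq) (auto simp del: fact_Suc)
  moreover have "cutoff m t = 1 / (exp (1 / t) * t ^ m)"
    using True by (simp add: cutoff_def exp_minus field_simps)
  ultimately show ?thesis using True by (simp del: fact_Suc)
qed (simp add: cutoff_def mult_nonneg_nonpos del: fact_Suc)

lemma cutoff_has_real_derivative:
  "(cutoff m has_real_derivative (cutoff (m + 2) t - m * cutoff (m + 1) t)) (at t)"
proof -
  consider "t > 0" | "t < 0" | "t = 0" by linarith
  then show ?thesis
  proof cases
    case 1
    have e: "((\<lambda>t. exp (- 1 / t)) has_real_derivative exp (- 1 / t) / t\<^sup>2) (at t)"
      using 1 by (auto intro!: derivative_eq_intros simp: power2_eq_square)
    have p: "((\<lambda>t. t ^ m) has_real_derivative m * t ^ m / t) (at t)"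
      using DERIV_pow[of m t] 1 by (cases m) auto
    have "((\<lambda>t. exp (- 1 / t) / t ^ m) has_real_derivative
        (cutoff (m + 2) t - m * cutoff (m + 1) t)) (at t)"
      using DERIV_divide[OF e p] 1
      by (auto simp: cutoff_def field_simps power2_eq_square elim!: DERIV_cong)
    then show ?thesis
      by (rule has_field_derivative_transform_within_open[where S="{0<..}"])
        (use 1 in \<open>auto simp: cutoff_def\<close>)
  next
    case 2
    have "((\<lambda>t. 0) has_real_derivative 0) (at t)" by simp
    then show ?thesis
      by (rule_tac has_field_derivative_transform_within_open[where S="{..<0}" and f="\<lambda>_. 0"])
        (use 2 in \<open>auto simp: cutoff_def\<close>)
  next
    case 3
    have "((\<lambda>h. cutoff m h / h) \<longlongrightarrow> 0) (at 0)"
    proof (rule Lim_null_comparison)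
      \<comment> \<open>The difference quotient at 0 is the next member of the family, to which the
        bound applies.\<close>
      have "cutoff m h / h = cutoff (Suc m) h" for h by (simp add: cutoff_def)
      then show "eventually (\<lambda>h. norm (cutoff m h / h) \<le> fact (Suc (Suc m)) * \<bar>h\<bar>) (at 0)"
        using cutoff_bound[of "Suc m"] by simp
      have "((\<lambda>h::real. fact (Suc (Suc m)) * \<bar>h\<bar>) \<longlongrightarrow> fact (Suc (Suc m)) * \<bar>0\<bar>) (at 0)"
        by (intro tendsto_intros)
      then show "((\<lambda>h::real. fact (Suc (Suc m)) * \<bar>h\<bar>) \<longlongrightarrow> 0) (at 0)" by simp
    qed
    then show ?thesis using 3 by (simp add: DERIV_def cutoff_def)
  qed
qed

lemma smooth_on_cutoff:
  fixes w :: "'a::euclidean_space"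
  shows "smooth_on UNIV (\<lambda>x. cutoff m (x \<bullet> w + c))"
proof (rule smooth_onI)
  fix n
  show "Ck_on n UNIV (\<lambda>x. cutoff m (x \<bullet> w + c))"
  proof (induction n arbitrary: m)
    case 0
    have "isCont (cutoff m) t" for t
      using cutoff_has_real_derivative by (rule DERIV_isCont)
    then have "continuous_on UNIV (cutoff m)" by (simp add: continuous_at_imp_continuous_on)
    then show ?case
      by (auto intro!: continuous_on_compose2[of UNIV "cutoff m"] continuous_intros)
  next
    case (Suc n)
    have der: "((\<lambda>x. cutoff m (x \<bullet> w + c)) has_derivative
      (\<lambda>v. (v \<bullet> w) * (cutoff (m + 2) (x \<bullet> w + c) + - m * cutoff (m + 1) (x \<bullet> w + c)))) (at x)" for x
    proof -
      have "((\<lambda>x. x \<bullet> w + c) has_derivative (\<lambda>v. v \<bullet> w)) (at x)"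
        by (auto intro!: derivative_eq_intros)
      from DERIV_compose_FDERIV[OF cutoff_has_real_derivative this, of m]
      show ?thesis by simp
    qed
    have "Ck_on n UNIV (dir_deriv v (\<lambda>x. cutoff m (x \<bullet> w + c)))" for v
    proof (rule Ck_on_cong[OF open_UNIV])
      show "Ck_on n UNIV (\<lambda>x. (v \<bullet> w) * (cutoff (m + 2) (x \<bullet> w + c) + - m * cutoff (m + 1) (x \<bullet> w + c)))"
        by (intro Ck_on_mult Ck_on_add open_UNIV Suc.IH Ck_on_const)
      show "(v \<bullet> w) * (cutoff (m + 2) (x \<bullet> w + c) + - m * cutoff (m + 1) (x \<bullet> w + c))
        = dir_deriv v (\<lambda>x. cutoff m (x \<bullet> w + c)) x" for x
        using dir_deriv_eq[OF der] by simp
    qed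
    then show ?case using der by (auto simp: differentiable_def)
  qed
qed

section \<open>Restriction to lines and symmetry of second derivatives\<close>

lemma has_vector_derivative_line:
  assumes "f differentiable (at (x + t *\<^sub>R v))"
  shows "((\<lambda>s. f (x + s *\<^sub>R v)) has_vector_derivative dir_deriv v f (x + t *\<^sub>R v)) (at t)"
proof -
  let ?f' = "frechet_derivative f (at (x + t *\<^sub>R v))"
  have "((\<lambda>s. x + s *\<^sub>R v) has_derivative (\<lambda>s. s *\<^sub>R v)) (at t)"
    by (auto intro!: derivative_eq_intros)
  from has_derivative_compose[OF this dir_deriv_works[OF assms]]
  have "((\<lambda>s. f (x + s *\<^sub>R v)) has_derivative (\<lambda>s. ?f' (s *\<^sub>R v))) (at t)" .
  moreover have "?f' (s *\<^sub>R v) = s *\<^sub>R ?f' v" for s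
    using linear_frechet_derivative[OF assms] by (rule linear_cmul)
  ultimately show ?thesis by (simp add: has_vector_derivative_def)
qed

lemma has_real_derivative_line:
  fixes f :: "'a::euclidean_space \<Rightarrow> real"
  assumes "f differentiable (at (x + t *\<^sub>R v))"
  shows "((\<lambda>s. f (x + s *\<^sub>R v)) has_real_derivative dir_deriv v f (x + t *\<^sub>R v)) (at t)"
  using has_vector_derivative_line[OF assms] by (simp add: has_real_derivative_iff_has_vector_derivative)

text \<open>The left-hand side is symmetric in \<open>v\<close> and \<open>w\<close>, which is why mixed derivatives commute.\<close>

lemma second_difference:
  fixes f :: "'a::euclidean_space \<Rightarrow> real"
  assumes f: "Ck_on 2 S f" and h: "h > 0"
    and S: "\<And>s t. s \<in> {0..h} \<Longrightarrow> t \<in> {0..h} \<Longrightarrow> x + s *\<^sub>R v + t *\<^sub>R w \<in> S"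
  obtains s t where "s \<in> {0..h}" "t \<in> {0..h}"
    "f (x + h *\<^sub>R v + h *\<^sub>R w) - f (x + h *\<^sub>R v) - f (x + h *\<^sub>R w) + f x
      = h\<^sup>2 * dir_deriv w (dir_deriv v f) (x + s *\<^sub>R v + t *\<^sub>R w)"
proof -
  have diff: "f differentiable (at y)" "dir_deriv v f differentiable (at y)" if "y \<in> S" for y
    using f that by (auto simp: numeral_2_eq_2)
  have "\<exists>s. 0 < s \<and> s < h \<and> (f (x + h *\<^sub>R w + h *\<^sub>R v) - f (x + h *\<^sub>R v)) -
      (f (x + h *\<^sub>R w + 0 *\<^sub>R v) - f (x + 0 *\<^sub>R v))
    = (h - 0) * (dir_deriv v f (x + h *\<^sub>R w + s *\<^sub>R v) - dir_deriv v f (x + s *\<^sub>R v))"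
  \<comment> \<open>The mean value theorem is applied first to the increment in direction w as a
    function of the position along v; the second application acts on the derivative along v that it
    produces.\<close>
  proof (rule MVT2[OF h])
    fix s assume s: "0 \<le> s" "s \<le> h"
    have "x + h *\<^sub>R w + s *\<^sub>R v \<in> S" "x + s *\<^sub>R v \<in> S"
      using S[of s h] S[of s 0] s h by (auto simp: algebra_simps)
    then show "((\<lambda>s. f (x + h *\<^sub>R w + s *\<^sub>R v) - f (x + s *\<^sub>R v)) has_real_derivative
      dir_deriv v f (x + h *\<^sub>R w + s *\<^sub>R v) - dir_deriv v f (x + s *\<^sub>R v)) (at s)"
      by (intro DERIV_diff has_real_derivative_line diff)
  qed
  then obtain s where s: "0 < s" "s < h" and 1: "f (x + h *\<^sub>R v + h *\<^sub>R w) - f (x + h *\<^sub>R v) - f (x + h *\<^sub>R w) + f x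
    = h * (dir_deriv v f (x + s *\<^sub>R v + h *\<^sub>R w) - dir_deriv v f (x + s *\<^sub>R v))"
    by (auto simp: algebra_simps)
  have "\<exists>t. 0 < t \<and> t < h \<and> dir_deriv v f (x + s *\<^sub>R v + h *\<^sub>R w) - dir_deriv v f (x + s *\<^sub>R v + 0 *\<^sub>R w)
    = (h - 0) * dir_deriv w (dir_deriv v f) (x + s *\<^sub>R v + t *\<^sub>R w)"
  proof (rule MVT2[OF h])
    fix t assume "0 \<le> t" "t \<le> h"
    then have "x + s *\<^sub>R v + t *\<^sub>R w \<in> S" using S[of s t] s by auto
    then show "((\<lambda>t. dir_deriv v f (x + s *\<^sub>R v + t *\<^sub>R w)) has_real_derivative
      dir_deriv w (dir_deriv v f) (x + s *\<^sub>R v + t *\<^sub>R w)) (at t)"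
      by (intro has_real_derivative_line diff)
  qed
  then obtain t where t: "0 < t" "t < h" and 2: "dir_deriv v f (x + s *\<^sub>R v + h *\<^sub>R w) - dir_deriv v f (x + s *\<^sub>R v)
    = h * dir_deriv w (dir_deriv v f) (x + s *\<^sub>R v + t *\<^sub>R w)"
    by auto
  show thesis
    by (rule that[of s t]) (use s t 1 2 in \<open>auto simp: power2_eq_square\<close>)
qed

text \<open>At suitable points of a small parallelogram both mixed derivatives equal the same second
  difference divided by h^2; continuity carries the equality to x up to any e > 0.\<close>

lemma dir_deriv_commute:
  fixes f :: "'a::euclidean_space \<Rightarrow> real"
  assumes f: "Ck_on 2 S f" and S: "open S" "x \<in> S"
  shows "dir_deriv v (dir_deriv w f) x = dir_deriv w (dir_deriv v f) x"
proof -
  have close: "\<exists>d>0. \<forall>s t. 0 \<le> s \<longrightarrow> s < d \<longrightarrow> 0 \<le> t \<longrightarrow> t < d \<longrightarrow> x + s *\<^sub>R v + t *\<^sub>R w \<in> S \<and>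
     \<bar>dir_deriv w (dir_deriv v f) (x + s *\<^sub>R v + t *\<^sub>R w) - dir_deriv w (dir_deriv v f) x\<bar> < e"
    if e: "e > 0" for e v w
  proof -
    have "continuous_on S (dir_deriv w (dir_deriv v f))"
      using f by (simp add: numeral_2_eq_2)
    then have "isCont (dir_deriv w (dir_deriv v f)) x"
      using S by (simp add: continuous_on_eq_continuous_at)
    then obtain d where d: "d > 0"
      "\<And>y. dist y x < d \<Longrightarrow> \<bar>dir_deriv w (dir_deriv v f) y - dir_deriv w (dir_deriv v f) x\<bar> < e"
      using e unfolding continuous_at_eps_delta dist_real_def by blast
    obtain r where r: "r > 0" "ball x r \<subseteq> S" using S openE by blast
    define d' where "d' = min d r / (norm v + norm w + 1)"
    have pos: "norm v + norm w + 1 > 0" by (simp add: add_nonneg_pos)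
    then have d': "d' > 0" using d r by (simp add: d'_def)
    have "dist (x + s *\<^sub>R v + t *\<^sub>R w) x < min d r" if "0 \<le> s" "s < d'" "0 \<le> t" "t < d'" for s t
    proof -
      have "dist (x + s *\<^sub>R v + t *\<^sub>R w) x = norm (s *\<^sub>R v + t *\<^sub>R w)" by (simp add: dist_norm)
      also have "\<dots> \<le> s * norm v + t * norm w"
        using norm_triangle_ineq[of "s *\<^sub>R v" "t *\<^sub>R w"] that by simp
      also have "\<dots> \<le> d' * norm v + d' * norm w"
        using that by (intro add_mono mult_right_mono) auto
      also have "\<dots> < d' * (norm v + norm w + 1)" using d' by (simp add: algebra_simps)
      also have "\<dots> = min d r" using pos by (simp add: d'_def)
      finally show ?thesis .
    qed
    then show ?thesis using d' d(2) r(2)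
      by (intro exI[of _ d']) (auto simp: subset_iff dist_commute)
  qed
  have "\<bar>dir_deriv v (dir_deriv w f) x - dir_deriv w (dir_deriv v f) x\<bar> \<le> e" if e: "e > 0" for e
  proof -
    have e2: "e / 2 > 0" using e by simp
    obtain d where d: "d > 0" "\<And>s t. 0 \<le> s \<Longrightarrow> s < d \<Longrightarrow> 0 \<le> t \<Longrightarrow> t < d \<Longrightarrow> x + s *\<^sub>R v + t *\<^sub>R w \<in> S \<and>
     \<bar>dir_deriv w (dir_deriv v f) (x + s *\<^sub>R v + t *\<^sub>R w) - dir_deriv w (dir_deriv v f) x\<bar> < e / 2"
      using close[OF e2, of v w] by auto
    obtain d' where d': "d' > 0" "\<And>s t. 0 \<le> s \<Longrightarrow> s < d' \<Longrightarrow> 0 \<le> t \<Longrightarrow> t < d' \<Longrightarrow> x + s *\<^sub>R w + t *\<^sub>R v \<in> S \<and>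
     \<bar>dir_deriv v (dir_deriv w f) (x + s *\<^sub>R w + t *\<^sub>R v) - dir_deriv v (dir_deriv w f) x\<bar> < e / 2"
      using close[OF e2, of w v] by auto
    define h where "h = min d d' / 2"
    have h: "h > 0" "h < d" "h < d'" using d(1) d'(1) by (auto simp: h_def)
    let ?D = "f (x + h *\<^sub>R v + h *\<^sub>R w) - f (x + h *\<^sub>R v) - f (x + h *\<^sub>R w) + f x"
    obtain s t where 1: "s \<in> {0..h}" "t \<in> {0..h}"
      "?D = h\<^sup>2 * dir_deriv w (dir_deriv v f) (x + s *\<^sub>R v + t *\<^sub>R w)"
      by (rule second_difference[OF f h(1), of x v w]) (use d(2) h in auto)
    obtain s' t' where 2: "s' \<in> {0..h}" "t' \<in> {0..h}"
      "f (x + h *\<^sub>R w + h *\<^sub>R v) - f (x + h *\<^sub>R w) - f (x + h *\<^sub>R v) + f x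
        = h\<^sup>2 * dir_deriv v (dir_deriv w f) (x + s' *\<^sub>R w + t' *\<^sub>R v)"
      by (rule second_difference[OF f h(1), of x w v]) (use d'(2) h in auto)
    have "h\<^sup>2 * dir_deriv w (dir_deriv v f) (x + s *\<^sub>R v + t *\<^sub>R w)
        = h\<^sup>2 * dir_deriv v (dir_deriv w f) (x + s' *\<^sub>R w + t' *\<^sub>R v)"
      using 1(3) 2(3) by (simp add: algebra_simps)
    then have "dir_deriv w (dir_deriv v f) (x + s *\<^sub>R v + t *\<^sub>R w)
        = dir_deriv v (dir_deriv w f) (x + s' *\<^sub>R w + t' *\<^sub>R v)" using h by simp
    moreover have "\<bar>dir_deriv w (dir_deriv v f) (x + s *\<^sub>R v + t *\<^sub>R w) - dir_deriv w (dir_deriv v f) x\<bar> < e / 2"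
      using d(2)[of s t] 1 h by auto
    moreover have "\<bar>dir_deriv v (dir_deriv w f) (x + s' *\<^sub>R w + t' *\<^sub>R v) - dir_deriv v (dir_deriv w f) x\<bar> < e / 2"
      using d'(2)[of s' t'] 2 h by auto
    ultimately show ?thesis by linarith
  qed
  then show ?thesis using field_le_epsilon[of "\<bar>dir_deriv v (dir_deriv w f) x - dir_deriv w (dir_deriv v f) x\<bar>" 0]
    by simp
qed

section \<open>Behaviour under dilations, and product rules\<close>

lemma dir_deriv_scale:
  assumes "f differentiable (at (t *\<^sub>R x))"
  shows "((\<lambda>x. f (t *\<^sub>R x)) has_derivative (\<lambda>v. t *\<^sub>R dir_deriv v f (t *\<^sub>R x))) (at x)"
proof -
  have "((\<lambda>x. t *\<^sub>R x) has_derivative (\<lambda>v. t *\<^sub>R v)) (at x)"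
    by (auto intro!: derivative_eq_intros)
  from has_derivative_compose[OF this dir_deriv_works[OF assms]]
  show ?thesis using linear_frechet_derivative[OF assms] by (simp add: linear_cmul)
qed

lemma Ck_on_scale:
  assumes S: "open S" and f: "Ck_on n S f"
  shows "Ck_on n {x. t *\<^sub>R x \<in> S} (\<lambda>x. f (t *\<^sub>R x))"
  using f
proof (induction n arbitrary: f)
  case 0
  then show ?case
    by (auto intro!: continuous_on_compose2[of S f] continuous_intros)
next
  case (Suc n)
  have op: "open {x. t *\<^sub>R x \<in> S}"
    using open_vimage[OF S, of "\<lambda>x. t *\<^sub>R x"] by (simp add: vimage_def continuous_intros)
  have der: "((\<lambda>x. f (t *\<^sub>R x)) has_derivative (\<lambda>v. t *\<^sub>R dir_deriv v f (t *\<^sub>R x))) (at x)"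
    if "t *\<^sub>R x \<in> S" for x
    using that Suc.prems by (intro dir_deriv_scale) simp
  have "Ck_on n {x. t *\<^sub>R x \<in> S} (dir_deriv v (\<lambda>x. f (t *\<^sub>R x)))" for v
  proof (rule Ck_on_cong[OF op])
    show "Ck_on n {x. t *\<^sub>R x \<in> S} (\<lambda>x. t *\<^sub>R dir_deriv v f (t *\<^sub>R x))"
      using Suc.prems by (intro Ck_on_bounded_linear[OF bounded_linear_scaleR_right op] Suc.IH) simp
  qed (use dir_deriv_eq[OF der] in simp)
  then show ?case using der by (auto simp: differentiable_def)
qed

lemma laplacian_scale:
  assumes S: "open S" "t *\<^sub>R x \<in> S" and f: "Ck_on 2 S f"
  shows "laplacian (\<lambda>x. f (t *\<^sub>R x)) x = t\<^sup>2 *\<^sub>R laplacian f (t *\<^sub>R x)"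
proof -
  have op: "open {x. t *\<^sub>R x \<in> S}"
    using open_vimage[OF S(1), of "\<lambda>x. t *\<^sub>R x"] by (simp add: vimage_def continuous_intros)
  have diff: "f differentiable (at y)" "dir_deriv v f differentiable (at y)" if "y \<in> S" for y v
    using f that by (auto simp: numeral_2_eq_2)
  have "dir_deriv b (dir_deriv b (\<lambda>x. f (t *\<^sub>R x))) x = t\<^sup>2 *\<^sub>R dir_deriv b (dir_deriv b f) (t *\<^sub>R x)" for b
  proof -
    have "dir_deriv b (dir_deriv b (\<lambda>x. f (t *\<^sub>R x))) x
        = dir_deriv b (\<lambda>x. t *\<^sub>R dir_deriv b f (t *\<^sub>R x)) x"
      by (rule dir_deriv_cong[OF op]) (use S in \<open>auto intro!: dir_deriv_eq dir_deriv_scale diff\<close>)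
    also have "\<dots> = t *\<^sub>R (t *\<^sub>R dir_deriv b (dir_deriv b f) (t *\<^sub>R x))"
      by (intro dir_deriv_eq has_derivative_scaleR_right dir_deriv_scale diff S)
    finally show ?thesis by (simp add: power2_eq_square)
  qed
  then show ?thesis by (simp add: laplacian_def scaleR_right.sum)
qed

lemma dir_deriv_add:
  assumes "f differentiable (at x)" "g differentiable (at x)"
  shows "dir_deriv v (\<lambda>x. f x + g x) x = dir_deriv v f x + dir_deriv v g x"
  using dir_deriv_eq[OF has_derivative_add[OF dir_deriv_works dir_deriv_works]] assms by blast

lemma dir_deriv_mult:
  fixes f g :: "'a::euclidean_space \<Rightarrow> 'b::real_normed_algebra"
  assumes "f differentiable (at x)" "g differentiable (at x)"
  shows "dir_deriv v (\<lambda>x. f x * g x) x = f x * dir_deriv v g x + dir_deriv v f x * g x"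
  using dir_deriv_eq[OF has_derivative_mult[OF dir_deriv_works dir_deriv_works]] assms by blast

section \<open>Integration by parts and density of test functions\<close>

lemma integrable_compact_support:
  fixes g :: "'a::euclidean_space \<Rightarrow> 'b::{banach, second_countable_topology}"
  assumes "continuous_on UNIV g" "compact K" "\<And>x. x \<notin> K \<Longrightarrow> g x = 0"
  shows "integrable lborel g"
proof -
  have "integrable lborel (\<lambda>x. indicator K x *\<^sub>R g x)"
    using assms by (intro borel_integrable_compact) (auto intro: continuous_on_subset)
  also have "(\<lambda>x. indicator K x *\<^sub>R g x) = g"
    using assms(3) by (auto simp: indicator_def)
  finally show ?thesis .
qed

lemma bounded_compact_support:
  fixes g :: "'a::euclidean_space \<Rightarrow> 'b::real_normed_vector"
  assumes "continuous_on UNIV g" "compact K" "\<And>x. x \<notin> K \<Longrightarrow> g x = 0"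
  obtains M where "M \<ge> 0" "\<And>x. norm (g x) \<le> M"
proof -
  have "bounded (g ` K)"
    using assms by (intro compact_imp_bounded compact_continuous_image) (auto intro: continuous_on_subset)
  then obtain M where M: "\<And>x. x \<in> K \<Longrightarrow> norm (g x) \<le> M" by (auto simp: bounded_iff)
  have "norm (g x) \<le> max M 0" for x
    using M[of x] assms(3)[of x] by (cases "x \<in> K") auto
  then show thesis by (intro that[of "max M 0"]) auto
qed

lemma dir_deriv_eq_0_outside:
  assumes "closed K" "\<And>x. x \<notin> K \<Longrightarrow> g x = 0" "x \<notin> K"
  shows "dir_deriv v g x = 0"
proof -
  have "dir_deriv v g x = dir_deriv v (\<lambda>_. 0) x"
    by (rule dir_deriv_cong[of "- K"]) (use assms in auto)
  then show ?thesis by simp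
qed

lemma lborel_integral_translate:
  fixes f :: "'a::euclidean_space \<Rightarrow> 'b::{banach, second_countable_topology}"
  assumes [measurable]: "f \<in> borel_measurable borel"
  shows "(\<integral>x. f (x + c) \<partial>lborel) = (\<integral>x. f x \<partial>lborel)"
proof -
  have "(\<integral>x. f x \<partial>lborel) = (\<integral>x. f x \<partial>(distr lborel borel ((+) c)))"
    by (simp add: lborel_distr_plus)
  also have "\<dots> = (\<integral>x. f (c + x) \<partial>lborel)" by (rule integral_distr) auto
  finally show ?thesis by (simp add: add.commute)
qed

lemma lborel_integral_scale:
  fixes f :: "'a::euclidean_space \<Rightarrow> real"
  assumes [measurable]: "f \<in> borel_measurable borel" and t: "t > 0"
  shows "(\<integral>x. f x \<partial>lborel) = t ^ DIM('a) * (\<integral>x. f (t *\<^sub>R x) \<partial>lborel)"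
proof -
  have "(\<integral>x. f x \<partial>lborel)
      = (\<integral>x. f x \<partial>(density (distr lborel borel (\<lambda>x. 0 + t *\<^sub>R x)) (\<lambda>_. \<bar>t\<bar> ^ DIM('a))))"
    using lborel_affine[of t "0::'a"] t by simp
  also have "\<dots> = (\<integral>x. t ^ DIM('a) *\<^sub>R f x \<partial>(distr lborel borel (\<lambda>x. 0 + t *\<^sub>R x)))"
    using t by (subst integral_density) auto
  also have "\<dots> = (\<integral>x. t ^ DIM('a) *\<^sub>R f (t *\<^sub>R x) \<partial>lborel)"
    by (subst integral_distr) auto
  finally show ?thesis by simp
qed

lemma integrable_scale:
  fixes f :: "'a::euclidean_space \<Rightarrow> real"
  assumes f: "integrable lborel f" and t: "t > 0"
  shows "integrable lborel (\<lambda>x. f (t *\<^sub>R x))"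
proof -
  have [measurable]: "f \<in> borel_measurable borel" using f by auto
  have "integrable (density (distr lborel borel (\<lambda>x. 0 + t *\<^sub>R x)) (\<lambda>_. \<bar>t\<bar> ^ DIM('a))) f"
    using lborel_affine[of t "0::'a"] t f by simp
  then have "integrable (distr lborel borel (\<lambda>x. 0 + t *\<^sub>R x)) (\<lambda>x. t ^ DIM('a) *\<^sub>R f x)"
    using t by (subst (asm) integrable_density) auto
  then show ?thesis using t by (subst (asm) integrable_distr_eq) auto
qed

text \<open>Difference quotients of g have integral 0 by translation invariance of Lebesgue measure,
  and dominated convergence passes to the derivative. No iterated integrals are involved, so the
  direction v is arbitrary.\<close>

lemma integral_dir_deriv_eq_0:
  fixes g :: "'a::euclidean_space \<Rightarrow> 'b::{banach, second_countable_topology}"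
  assumes g: "Ck_on 1 UNIV g" and K: "compact K" "\<And>x. x \<notin> K \<Longrightarrow> g x = 0"
  shows "(\<integral>x. dir_deriv v g x \<partial>lborel) = 0"
proof -
  have diff: "g differentiable (at x)" for x using g by simp
  have cg: "continuous_on UNIV g" using Ck_on_SucD[of 0 UNIV g] g by simp
  have cd: "continuous_on UNIV (dir_deriv v g)" using g by simp
  have [measurable]: "g \<in> borel_measurable borel" "dir_deriv v g \<in> borel_measurable borel"
    using cg cd by (auto intro: borel_measurable_continuous_onI)
  obtain M where M: "M \<ge> 0" "\<And>x. norm (dir_deriv v g x) \<le> M"
    using bounded_compact_support[OF cd K(1) dir_deriv_eq_0_outside[OF compact_imp_closed[OF K(1)] K(2)]]
    by blast
  define t where "t n = 1 / real (Suc n)" for n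
  have t: "t n > 0" "t n \<le> 1" for n by (auto simp: t_def)
  define h where "h n x = (1 / t n) *\<^sub>R (g (x + t n *\<^sub>R v) - g x)" for n x
  \<comment> \<open>The support swept back along v for times in [0, 1]; as every \<open>t n\<close>
    is at most 1, it contains the supports of all difference quotients.\<close>
  define K' where "K' = (\<lambda>(k, s). k - s *\<^sub>R v) ` (K \<times> {0..1})"
  have K': "compact K'"
    unfolding K'_def
    by (intro compact_continuous_image compact_Times K compact_Icc)
      (auto intro!: continuous_intros simp: split_beta)
  have int_g: "integrable lborel g" using integrable_compact_support[OF cg K] .
  have "(\<integral>x. h n x \<partial>lborel) = 0" for n
  proof -
    have "integrable lborel (\<lambda>x. g (x + t n *\<^sub>R v))"
    proof (rule integrable_compact_support[where K="(\<lambda>k. k - t n *\<^sub>R v) ` K"])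
      show "continuous_on UNIV (\<lambda>x. g (x + t n *\<^sub>R v))"
        by (intro continuous_on_compose2[OF cg] continuous_intros) auto
      show "compact ((\<lambda>k. k - t n *\<^sub>R v) ` K)"
        by (intro compact_continuous_image K continuous_intros)
      show "g (x + t n *\<^sub>R v) = 0" if "x \<notin> (\<lambda>k. k - t n *\<^sub>R v) ` K" for x
        using that by (intro K(2)) (auto simp: image_iff algebra_simps)
    qed
    then show ?thesis
      using int_g lborel_integral_translate[of g "t n *\<^sub>R v"] by (simp add: h_def)
  qed
  moreover have "(\<lambda>n. \<integral>x. h n x \<partial>lborel) \<longlonglongrightarrow> (\<integral>x. dir_deriv v g x \<partial>lborel)"
  proof (rule integral_dominated_convergence)
    show "integrable lborel (\<lambda>x. M * indicator K' x)"
      using K' emeasure_bounded_finite[OF compact_imp_bounded[OF K']]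
      by (intro integrable_mult_right integrable_real_indicator) (auto simp: compact_imp_closed borel_closed)
    show "dir_deriv v g \<in> borel_measurable lborel" by simp
    show "h n \<in> borel_measurable lborel" for n unfolding h_def by measurable
    show "AE x in lborel. (\<lambda>n. h n x) \<longlonglongrightarrow> dir_deriv v g x"
    proof (rule AE_I2)
      fix x
      have "((\<lambda>s. g (x + s *\<^sub>R v)) has_vector_derivative dir_deriv v g x) (at 0)"
        using has_vector_derivative_line[of g x 0 v] diff by simp
      then have "((\<lambda>s. (1 / s) *\<^sub>R (g (x + s *\<^sub>R v) - g x)) \<longlongrightarrow> dir_deriv v g x) (at 0)"
      proof -
        assume D: "((\<lambda>s. g (x + s *\<^sub>R v)) has_vector_derivative dir_deriv v g x) (at 0)"
        have lim0: "((\<lambda>y. norm (g (x + y *\<^sub>R v) - g x - y *\<^sub>R dir_deriv v g x) / \<bar>y\<bar>) \<longlongrightarrow> 0) (at 0)"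
          using D by (simp add: has_vector_derivative_def has_derivative_iff_norm)
        have eq: "norm (g (x + y *\<^sub>R v) - g x - y *\<^sub>R dir_deriv v g x) / \<bar>y\<bar>
            = norm ((1 / y) *\<^sub>R (g (x + y *\<^sub>R v) - g x) - dir_deriv v g x)" if "y \<noteq> 0" for y
        proof -
          have "(1 / y) *\<^sub>R (g (x + y *\<^sub>R v) - g x) - dir_deriv v g x
              = (1 / y) *\<^sub>R (g (x + y *\<^sub>R v) - g x - y *\<^sub>R dir_deriv v g x)"
            using that by (simp add: scaleR_diff_right)
          then show ?thesis by simp
        qed
        have "((\<lambda>y. norm ((1 / y) *\<^sub>R (g (x + y *\<^sub>R v) - g x) - dir_deriv v g x)) \<longlongrightarrow> 0) (at 0)"
          by (rule Lim_transform_eventually[OF lim0]) (simp add: eventually_at_filter eq)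
        then show ?thesis using tendsto_norm_zero_iff LIM_zero_iff by blast
      qed
      moreover have "filterlim t (at 0) sequentially"
        unfolding filterlim_at using t(1) LIMSEQ_inverse_real_of_nat
        by (auto simp: t_def[abs_def] inverse_eq_divide)
      ultimately show "(\<lambda>n. h n x) \<longlonglongrightarrow> dir_deriv v g x"
        unfolding h_def by (rule filterlim_compose)
    qed
    show "AE x in lborel. norm (h n x) \<le> M * indicator K' x" for n
    proof (rule AE_I2)
      fix x
      have "norm (g (x + t n *\<^sub>R v) - g (x + 0 *\<^sub>R v)) \<le> M * t n - M * 0"
      \<comment> \<open>The mean value inequality bounds the quotients by the supremum of the
        derivative, uniformly in n and x.\<close>
      proof (rule differentiable_bound_general)
        show "0 < t n" by (rule t)
        show "continuous_on {0..t n} (\<lambda>s. g (x + s *\<^sub>R v))"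
          by (intro continuous_on_compose2[OF cg] continuous_intros) auto
        show "((\<lambda>s. g (x + s *\<^sub>R v)) has_vector_derivative dir_deriv v g (x + s *\<^sub>R v)) (at s)" for s
          by (intro has_vector_derivative_line diff)
        show "((\<lambda>s. M * s) has_vector_derivative M) (at s)" for s
          by (auto intro!: derivative_eq_intros
              simp flip: has_real_derivative_iff_has_vector_derivative)
      qed (auto intro!: continuous_intros M)
      then have le: "norm (h n x) \<le> M" using t(1)[of n] by (simp add: h_def pos_divide_le_eq)
      show "norm (h n x) \<le> M * indicator K' x"
      proof (cases "x \<in> K'")
        case False
        have "x \<notin> K" using False unfolding K'_def by (force simp: image_iff)
        moreover have "x + t n *\<^sub>R v \<notin> K"
        proof
          assume "x + t n *\<^sub>R v \<in> K"
          then have "x \<in> K'" unfolding K'_def using t[of n]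
            by (intro image_eqI[of _ _ "(x + t n *\<^sub>R v, t n)"]) auto
          with False show False by simp
        qed
        ultimately show ?thesis using K(2) M by (simp add: h_def)
      qed (use le in simp)
    qed
  qed
  ultimately show ?thesis by (simp add: LIMSEQ_const_iff)
qed

lemma integral_by_parts:
  fixes f g :: "'a::euclidean_space \<Rightarrow> complex"
  assumes f: "Ck_on 1 UNIV f" and g: "Ck_on 1 UNIV g"
    and K: "compact K" "\<And>x. x \<notin> K \<Longrightarrow> f x = 0"
  shows "(\<integral>x. dir_deriv v f x * g x \<partial>lborel) = - (\<integral>x. f x * dir_deriv v g x \<partial>lborel)"
proof -
  have c: "continuous_on UNIV f" "continuous_on UNIV g"
    "continuous_on UNIV (dir_deriv v f)" "continuous_on UNIV (dir_deriv v g)"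
    using f g Ck_on_SucD[of 0 UNIV f] Ck_on_SucD[of 0 UNIV g] by auto
  have i1: "integrable lborel (\<lambda>x. dir_deriv v f x * g x)"
    by (rule integrable_compact_support[OF _ K(1)])
      (use c dir_deriv_eq_0_outside[OF compact_imp_closed[OF K(1)] K(2)] in \<open>auto intro!: continuous_intros\<close>)
  have i2: "integrable lborel (\<lambda>x. f x * dir_deriv v g x)"
    by (rule integrable_compact_support[OF _ K(1)]) (use c K(2) in \<open>auto intro!: continuous_intros\<close>)
  have "(\<integral>x. dir_deriv v (\<lambda>x. f x * g x) x \<partial>lborel) = 0"
    by (rule integral_dir_deriv_eq_0[OF Ck_on_mult[OF open_UNIV f g] K(1)]) (use K in auto)
  moreover have "dir_deriv v (\<lambda>x. f x * g x) x = f x * dir_deriv v g x + dir_deriv v f x * g x" for x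
    using f g by (intro dir_deriv_mult) auto
  ultimately show ?thesis using i1 i2 by (simp add: add_eq_0_iff)
qed

section \<open>Test functions\<close>

lemma test_functionsI:
  assumes "smooth_on UNIV u" "compact K" "K \<subseteq> \<Omega>" "\<And>x. x \<notin> K \<Longrightarrow> u x = 0"
  shows "u \<in> test_functions \<Omega>"
proof -
  have "closure {x. u x \<noteq> 0} \<subseteq> K"
    using assms(2,4) by (intro closure_minimal compact_imp_closed) auto
  then show ?thesis
    using assms unfolding test_functions_def
    by (auto simp: compact_eq_bounded_closed intro: bounded_subset)
qed

lemma test_functionsE:
  assumes "u \<in> test_functions \<Omega>"
  obtains K where "compact K" "K \<subseteq> \<Omega>" "\<And>x. x \<notin> K \<Longrightarrow> u x = 0"
proof (rule that)
  show "u x = 0" if "x \<notin> closure {x. u x \<noteq> 0}" for x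
    using that closure_subset[of "{x. u x \<noteq> 0}"] by auto
qed (use assms in \<open>auto simp: test_functions_def\<close>)

lemma test_functions_smooth: "u \<in> test_functions \<Omega> \<Longrightarrow> smooth_on UNIV u"
  by (simp add: test_functions_def)

lemma sq_integrable_compact_support:
  assumes u: "continuous_on UNIV u" and K: "compact K" "\<And>x. x \<notin> K \<Longrightarrow> u x = 0"
  shows "sq_integrable u"
  unfolding sq_integrable_def
proof
  show "u \<in> borel_measurable lborel" using u by (simp add: borel_measurable_continuous_onI)
  show "integrable lborel (\<lambda>x. (cmod (u x))\<^sup>2)"
    by (rule integrable_compact_support[OF _ K(1)]) (use u K in \<open>auto intro!: continuous_intros\<close>)
qed

lemma sq_integrable_test_function: "u \<in> test_functions \<Omega> \<Longrightarrow> sq_integrable u"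
  by (metis test_functionsE sq_integrable_compact_support smooth_on_continuous test_functions_smooth)

lemma test_functions_zero: "(\<lambda>_. 0) \<in> test_functions \<Omega>"
  by (rule test_functionsI[where K="{}"]) (auto simp: smooth_on_const)

lemma test_functions_add:
  assumes "u \<in> test_functions \<Omega>" "v \<in> test_functions \<Omega>"
  shows "(\<lambda>x. u x + v x) \<in> test_functions \<Omega>"
proof -
  obtain K where K: "compact K" "K \<subseteq> \<Omega>" "\<And>x. x \<notin> K \<Longrightarrow> u x = 0"
    using test_functionsE[OF assms(1)] by blast
  obtain K' where K': "compact K'" "K' \<subseteq> \<Omega>" "\<And>x. x \<notin> K' \<Longrightarrow> v x = 0"
    using test_functionsE[OF assms(2)] by blast
  have "smooth_on UNIV (\<lambda>x. u x + v x)"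
    using assms by (intro smooth_on_add test_functions_smooth[of _ \<Omega>]) auto
  then show ?thesis
    by (rule test_functionsI[where K="K \<union> K'"]) (use K K' in auto)
qed

lemma test_functions_mult_left:
  assumes "u \<in> test_functions \<Omega>"
  shows "(\<lambda>x. c * u x) \<in> test_functions \<Omega>"
proof -
  obtain K where K: "compact K" "K \<subseteq> \<Omega>" "\<And>x. x \<notin> K \<Longrightarrow> u x = 0"
    using test_functionsE[OF assms] by blast
  have "smooth_on UNIV (\<lambda>x. c * u x)"
    using assms by (intro smooth_on_mult smooth_on_const test_functions_smooth[of _ \<Omega>]) auto
  then show ?thesis
    by (rule test_functionsI[OF _ K(1,2)]) (use K in auto)
qed

text \<open>Almost everywhere |f n - g| is at most 2 w, so 4 w^2 dominates the squares. Every
  approximation in the density argument passes through this.\<close>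

lemma tendsto_abs_L2_dominated:
  fixes f :: "nat \<Rightarrow> 'a::euclidean_space \<Rightarrow> complex"
  assumes f: "\<And>n. f n \<in> borel_measurable borel" and g: "g \<in> borel_measurable borel"
    and w: "integrable lborel (\<lambda>x. (w x)\<^sup>2)"
    and le: "\<And>n. AE x in lborel. cmod (f n x) \<le> w x"
    and lim: "AE x in lborel. (\<lambda>n. f n x) \<longlonglongrightarrow> g x"
  shows "sq_integrable (f n)" "sq_integrable g" "(\<lambda>n. abs_L2 (f n)) \<longlonglongrightarrow> abs_L2 g"
proof -
  note [measurable] = f g
  show sf: "sq_integrable (f n)" for n
    unfolding sq_integrable_def
  proof (intro conjI Bochner_Integration.integrable_bound[OF w])
    show "AE x in lborel. norm ((cmod (f n x))\<^sup>2) \<le> norm ((w x)\<^sup>2)"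
      using le[of n] by eventually_elim (auto intro: power_mono)
  qed auto
  have "AE x in lborel. \<forall>n. cmod (f n x) \<le> w x" using le by (simp add: AE_all_countable)
  with lim have leg: "AE x in lborel. cmod (g x) \<le> w x"
  proof eventually_elim
    case (elim x)
    from tendsto_norm[OF elim(1)] show ?case
      by (rule tendsto_upperbound) (use elim in auto)
  qed
  show sg: "sq_integrable g"
    unfolding sq_integrable_def
  proof (intro conjI Bochner_Integration.integrable_bound[OF w])
    show "AE x in lborel. norm ((cmod (g x))\<^sup>2) \<le> norm ((w x)\<^sup>2)"
      using leg by eventually_elim (auto intro: power_mono)
  qed auto
  have "(\<lambda>n. \<integral>x. (cmod (f n x - g x))\<^sup>2 \<partial>lborel) \<longlonglongrightarrow> (\<integral>x. 0 \<partial>(lborel :: 'a measure))"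
  proof (rule integral_dominated_convergence[where w="\<lambda>x. 4 * (w x)\<^sup>2"])
    show "AE x in lborel. (\<lambda>n. (cmod (f n x - g x))\<^sup>2) \<longlonglongrightarrow> 0"
      using lim
    proof eventually_elim
      case (elim x)
      then have "(\<lambda>n. (cmod (f n x - g x))\<^sup>2) \<longlonglongrightarrow> (cmod (g x - g x))\<^sup>2"
        by (intro tendsto_intros)
      then show ?case by simp
    qed
    show "AE x in lborel. norm ((cmod (f n x - g x))\<^sup>2) \<le> 4 * (w x)\<^sup>2" for n
      using le[of n] leg
    proof eventually_elim
      case (elim x)
      have "cmod (f n x - g x) \<le> 2 * w x"
        using norm_triangle_ineq4[of "f n x" "g x"] elim by simp
      then have "(cmod (f n x - g x))\<^sup>2 \<le> (2 * w x)\<^sup>2" by (intro power_mono) auto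
      then show ?case by simp
    qed
  qed (use w in auto)
  then have "(\<lambda>n. (norm (abs_L2 (f n) - abs_L2 g))\<^sup>2) \<longlonglongrightarrow> 0"
    by (simp add: minus_abs_L2 sf sg norm_abs_L2 sq_integrable_diff)
  then have "(\<lambda>n. sqrt ((norm (abs_L2 (f n) - abs_L2 g))\<^sup>2)) \<longlonglongrightarrow> sqrt 0"
    by (rule tendsto_real_sqrt)
  then have "(\<lambda>n. norm (abs_L2 (f n) - abs_L2 g)) \<longlonglongrightarrow> 0" by simp
  then show "(\<lambda>n. abs_L2 (f n)) \<longlonglongrightarrow> abs_L2 g"
    by (simp add: tendsto_norm_zero_iff LIM_zero_iff)
qed

lemma cutoff_0_le_1: "0 \<le> cutoff 0 t \<and> cutoff 0 t \<le> 1"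
  by (simp add: cutoff_def)

text \<open>Steepening the flat function approximates the Heaviside function from below without
  moving its support.\<close>

lemma cutoff_0_tendsto: "(\<lambda>n. cutoff 0 (real (Suc n) * t)) \<longlonglongrightarrow> (if t > 0 then 1 else 0)"
proof (cases "t > 0")
  case True
  have "(\<lambda>n. exp (- (inverse (real (Suc n)) / t))) \<longlonglongrightarrow> exp (- (0 / t))"
    using LIMSEQ_inverse_real_of_nat True by (intro tendsto_intros) auto
  moreover have "cutoff 0 (real (Suc n) * t) = exp (- (inverse (real (Suc n)) / t))" for n
  proof -
    have "real (Suc n) * t > 0" using True by simp
    moreover have "1 / (real (Suc n) * t) = inverse (real (Suc n)) / t" by (simp add: inverse_eq_divide)
    ultimately show ?thesis by (simp add: cutoff_def del: of_nat_Suc)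
  qed
  ultimately show ?thesis using True by simp
next
  case False
  then have "cutoff 0 (real (Suc n) * t) = 0" for n
    by (simp add: cutoff_def mult_pos_pos zero_less_mult_iff not_less)
  then show ?thesis using False by simp
qed

section \<open>Density of test functions\<close>

definition test_space :: "'a::euclidean_space set \<Rightarrow> 'a L2 set" where
  "test_space \<Omega> = closure (abs_L2 ` test_functions \<Omega>)"

lemma test_space_closed: "(\<And>n. s n \<in> test_space \<Omega>) \<Longrightarrow> s \<longlonglongrightarrow> u \<Longrightarrow> u \<in> test_space \<Omega>"
  unfolding test_space_def by (rule closed_sequentially[OF closed_closure])

lemma test_space_seq:
  assumes "u \<in> test_space \<Omega>"
  obtains f where "\<And>n. f n \<in> test_functions \<Omega>" "(\<lambda>n. abs_L2 (f n)) \<longlonglongrightarrow> u"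
proof -
  obtain s where s: "\<And>n. s n \<in> abs_L2 ` test_functions \<Omega>" "s \<longlonglongrightarrow> u"
    using assms unfolding test_space_def closure_sequential by auto
  then have "\<forall>n. \<exists>f. f \<in> test_functions \<Omega> \<and> s n = abs_L2 f" by blast
  then obtain f where "\<And>n. f n \<in> test_functions \<Omega>" "\<And>n. s n = abs_L2 (f n)" by metis
  moreover from this have "s = (\<lambda>n. abs_L2 (f n))" by blast
  ultimately show thesis using s(2) by (intro that[of f]) simp_all
qed

lemma test_space_incl: "f \<in> test_functions \<Omega> \<Longrightarrow> abs_L2 f \<in> test_space \<Omega>"
  unfolding test_space_def by (intro subsetD[OF closure_subset] imageI)

lemma test_space_zero: "0 \<in> test_space \<Omega>"
  using test_space_incl[OF test_functions_zero] by (simp add: zero_L2_def)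

lemma test_space_add:
  assumes "u \<in> test_space \<Omega>" "v \<in> test_space \<Omega>"
  shows "u + v \<in> test_space \<Omega>"
proof -
  obtain f g where f: "\<And>n. f n \<in> test_functions \<Omega>" "(\<lambda>n. abs_L2 (f n)) \<longlonglongrightarrow> u"
    and g: "\<And>n. g n \<in> test_functions \<Omega>" "(\<lambda>n. abs_L2 (g n)) \<longlonglongrightarrow> v"
    using test_space_seq assms by metis
  show ?thesis
  proof (rule test_space_closed[where s="\<lambda>n. abs_L2 (f n) + abs_L2 (g n)"])
    show "abs_L2 (f n) + abs_L2 (g n) \<in> test_space \<Omega>" for n
      using test_functions_add[OF f(1) g(1)]
      by (simp add: plus_abs_L2 sq_integrable_test_function[OF f(1)]
          sq_integrable_test_function[OF g(1)] test_space_incl)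
  qed (intro tendsto_add f(2) g(2))
qed

lemma test_space_scaleC:
  assumes "u \<in> test_space \<Omega>"
  shows "c *\<^sub>C u \<in> test_space \<Omega>"
proof -
  obtain f where f: "\<And>n. f n \<in> test_functions \<Omega>" "(\<lambda>n. abs_L2 (f n)) \<longlonglongrightarrow> u"
    using test_space_seq assms by metis
  show ?thesis
  proof (rule test_space_closed[where s="\<lambda>n. c *\<^sub>C abs_L2 (f n)"])
    show "c *\<^sub>C abs_L2 (f n) \<in> test_space \<Omega>" for n
      using test_functions_mult_left[OF f(1)]
      by (simp add: scaleC_abs_L2 sq_integrable_test_function[OF f(1)] test_space_incl)
  qed (intro tendsto_scaleC f(2))
qed

lemma test_space_sum:
  "finite I \<Longrightarrow> (\<And>i. i \<in> I \<Longrightarrow> u i \<in> test_space \<Omega>) \<Longrightarrow> (\<Sum>i\<in>I. u i) \<in> test_space \<Omega>"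
  by (induction I rule: finite_induct) (auto intro: test_space_zero test_space_add)

lemma sq_integrable_indicator:
  assumes "A \<in> sets borel" "emeasure lborel A < \<infinity>"
  shows "sq_integrable (\<lambda>x. indicator A x)"
proof -
  have "(\<lambda>x. (cmod (indicator A x))\<^sup>2) = (indicator A :: 'a \<Rightarrow> real)"
    by (auto simp: indicator_def)
  then show ?thesis
    using assms by (auto simp: sq_integrable_def intro!: integrable_real_indicator)
qed

lemma indicator_real_square: "(indicator A x :: real)\<^sup>2 = indicator A x"
  by (simp add: indicator_def)

text \<open>The indicator is a limit of products of steepened flat functions, one for each of the
  two faces in every coordinate. They vanish off the open box, so their supports stay in the closed
  one.\<close>

lemma test_space_box:
  assumes "cbox a b \<subseteq> \<Omega>"
  shows "abs_L2 (\<lambda>x. indicator (box a b) x) \<in> test_space \<Omega>"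
proof -
  \<comment> \<open>The arguments have the shape x \<bullet> w + c required by
    \<open>smooth_on_cutoff\<close>; \<open>h_eq\<close> is the readable form.\<close>
  define h :: "nat \<Rightarrow> 'a \<Rightarrow> real" where "h n x =
    (\<Prod>i\<in>Basis. cutoff 0 (x \<bullet> (real (Suc n) *\<^sub>R i) + real (Suc n) * - (a \<bullet> i))
      * cutoff 0 (x \<bullet> (- real (Suc n) *\<^sub>R i) + real (Suc n) * (b \<bullet> i)))" for n x
  have h_eq: "h n x = (\<Prod>i\<in>Basis. cutoff 0 (real (Suc n) * (x \<bullet> i - a \<bullet> i))
      * cutoff 0 (real (Suc n) * (b \<bullet> i - x \<bullet> i)))" for n x
    unfolding h_def by (intro prod.cong refl) (simp add: algebra_simps)
  have smooth: "smooth_on UNIV (h n)" for n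
    unfolding h_def[abs_def] by (intro smooth_on_prod smooth_on_mult smooth_on_cutoff) auto
  have h_nonneg: "0 \<le> h n x" and h_le_1: "h n x \<le> 1" for n x
    unfolding h_eq using cutoff_0_le_1 by (auto intro!: prod_nonneg prod_le_1 mult_le_one)
  have h0: "h n x = 0" if x: "x \<notin> box a b" for n x
  proof -
    obtain i where i: "i \<in> Basis" "x \<bullet> i - a \<bullet> i \<le> 0 \<or> b \<bullet> i - x \<bullet> i \<le> 0"
      using x by (auto simp: mem_box not_less)
    then have "cutoff 0 (real (Suc n) * (x \<bullet> i - a \<bullet> i)) * cutoff 0 (real (Suc n) * (b \<bullet> i - x \<bullet> i)) = 0"
      by (auto simp: cutoff_def zero_less_mult_iff)
    then show ?thesis unfolding h_eq using i(1) by (intro prod_zero) auto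
  qed
  have lim: "(\<lambda>n. h n x) \<longlonglongrightarrow> indicator (box a b) x" for x
  proof (cases "x \<in> box a b")
    case True
    have "(\<lambda>n. h n x) \<longlonglongrightarrow> (\<Prod>i\<in>Basis. (if x \<bullet> i - a \<bullet> i > 0 then 1 else 0)
        * (if b \<bullet> i - x \<bullet> i > 0 then 1 else 0))"
      unfolding h_eq by (intro tendsto_prod tendsto_mult cutoff_0_tendsto)
    also have "(\<Prod>i\<in>Basis. (if x \<bullet> i - a \<bullet> i > 0 then 1 else 0)
        * (if b \<bullet> i - x \<bullet> i > 0 then 1 else 0)) = (1::real)"
      using True by (intro prod.neutral) (auto simp: mem_box)
    finally show ?thesis using True by simp
  qed (simp add: h0)
  have "(\<lambda>n. abs_L2 (\<lambda>x. complex_of_real (h n x))) \<longlonglongrightarrow> abs_L2 (\<lambda>x. indicator (box a b) x)"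
  proof (rule tendsto_abs_L2_dominated(3)[where w="indicator (box a b)"])
    show "(\<lambda>x. complex_of_real (h n x)) \<in> borel_measurable borel" for n
      using smooth_on_continuous[OF smooth] by (intro borel_measurable_continuous_onI continuous_intros)
    show "integrable lborel (\<lambda>x. (indicator (box a b) x :: real)\<^sup>2)"
      using emeasure_lborel_box_finite[of a b] by (simp add: indicator_real_square integrable_real_indicator)
    show "AE x in lborel. cmod (complex_of_real (h n x)) \<le> indicator (box a b) x" for n
      using h_nonneg h_le_1 h0 by (auto simp: indicator_def)
    show "AE x in lborel. (\<lambda>n. complex_of_real (h n x)) \<longlonglongrightarrow> indicator (box a b) x"
    proof (rule AE_I2)
      fix x
      have "(\<lambda>n. complex_of_real (h n x)) \<longlonglongrightarrow> of_real (indicator (box a b) x)"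
        by (intro tendsto_of_real lim)
      then show "(\<lambda>n. complex_of_real (h n x)) \<longlonglongrightarrow> indicator (box a b) x"
        by (cases "x \<in> box a b") simp_all
    qed
  qed auto
  moreover have "(\<lambda>x. complex_of_real (h n x)) \<in> test_functions \<Omega>" for n
    by (rule test_functionsI[OF _ compact_cbox assms])
      (use h0[OF contra_subsetD[OF box_subset_cbox]] in \<open>auto intro!: smooth_on_bounded_linear[OF bounded_linear_of_real] smooth\<close>)
  ultimately show ?thesis by (intro test_space_closed[OF test_space_incl])
qed

text \<open>Dynkin's argument: open boxes are stable under intersection and generate the Borel sets.
  Working inside one bounded box keeps all indicators square-integrable, so complements can be taken
  relative to it.\<close>

lemma test_space_Int_box:
  assumes A: "A \<in> sets borel" and cd: "cbox c d \<subseteq> \<Omega>"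
  shows "abs_L2 (\<lambda>x. indicator (A \<inter> box c d) x) \<in> test_space \<Omega>"
proof -
  define G where "G = range (\<lambda>(a, b). box a b :: 'a set)"
  have fin: "emeasure lborel (E \<inter> box c d) < \<infinity>" for E
    using emeasure_mono[of "E \<inter> box c d" "box c d" lborel] emeasure_lborel_box_finite[of c d]
    by (simp add: less_top[symmetric] top_unique) (metis infinity_ennreal_def top_unique less_top)
  have sq: "E \<in> sets borel \<Longrightarrow> sq_integrable (\<lambda>x. indicator (E \<inter> box c d) x)" for E
    using fin by (intro sq_integrable_indicator) auto
  have borel: "sets borel = sigma_sets UNIV G"
    unfolding borel_eq_box G_def by (simp add: sets_measure_of)
  have "Int_stable G"
  proof (rule Int_stableI)
    have G_iff: "X \<in> G \<longleftrightarrow> (\<exists>a b. X = box a b)" for X by (auto simp: G_def)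
    show "X \<inter> Y \<in> G" if "X \<in> G" "Y \<in> G" for X Y
    proof -
      obtain a b a' b' where "X = box a b" "Y = box a' b'" using \<open>X \<in> G\<close> \<open>Y \<in> G\<close> unfolding G_iff by blast
      then show ?thesis unfolding G_iff using box_Int_box by blast
    qed
  qed
  moreover have "G \<subseteq> Pow UNIV" by simp
  moreover have "A \<in> sigma_sets UNIV G" using A borel by simp
  ultimately show ?thesis
  proof (induction rule: sigma_sets_induct_disjoint)
    case (basic E)
    then obtain a b where E: "E = box a b" by (auto simp: G_def)
    have "cbox a b \<inter> cbox c d \<subseteq> \<Omega>" using cd by auto
    then show ?case unfolding E box_Int_box Int_interval by (rule test_space_box)
  next
    case empty
    then show ?case using test_space_zero by (simp add: zero_L2_def)
  next
    case (compl E)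
    have E: "E \<in> sets borel" using compl borel by simp
    have "abs_L2 (\<lambda>x. indicator (UNIV \<inter> box c d) x) + (-1) *\<^sub>C abs_L2 (\<lambda>x. indicator (E \<inter> box c d) x)
        = abs_L2 (\<lambda>x. indicator ((UNIV - E) \<inter> box c d) x)"
    proof -
      have "(\<lambda>x. indicator (UNIV \<inter> box c d) x - indicator (E \<inter> box c d) x)
          = (\<lambda>x. indicator ((UNIV - E) \<inter> box c d) x :: complex)"
        by (auto simp: indicator_def)
      then show ?thesis
        using sq[of UNIV] sq[OF E] by (simp add: minus_abs_L2 flip: diff_conv_scaleC)
    qed
    moreover have "abs_L2 (\<lambda>x. indicator (UNIV \<inter> box c d) x) \<in> test_space \<Omega>"
      using test_space_box[OF cd] by simp
    ultimately show ?case using compl test_space_add test_space_scaleC by metis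
  next
    case (union E)
    have E: "E i \<in> sets borel" for i using union borel by auto
    have part: "abs_L2 (\<lambda>x. indicator ((\<Union>i<n. E i) \<inter> box c d) x) \<in> test_space \<Omega>" for n
    proof (induction n)
      case 0
      then show ?case using test_space_zero by (simp add: zero_L2_def)
    next
      case (Suc n)
      have "abs_L2 (\<lambda>x. indicator ((\<Union>i<Suc n. E i) \<inter> box c d) x)
        = abs_L2 (\<lambda>x. indicator ((\<Union>i<n. E i) \<inter> box c d) x) + abs_L2 (\<lambda>x. indicator (E n \<inter> box c d) x)"
      proof -
        have "x \<notin> E n" if "x \<in> E i" "i < n" for x i
          using union(1) that unfolding disjoint_family_on_def
            by (metis IntI UNIV_I empty_iff less_irrefl)
        then have "(\<lambda>x. indicator ((\<Union>i<Suc n. E i) \<inter> box c d) x :: complex)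
          = (\<lambda>x. indicator ((\<Union>i<n. E i) \<inter> box c d) x + indicator (E n \<inter> box c d) x)"
          by (auto simp: indicator_def lessThan_Suc fun_eq_iff)
        then show ?thesis using sq[of "\<Union>i<n. E i"] sq[OF E[of n]] E by (simp add: plus_abs_L2)
      qed
      then show ?case using Suc union by (auto intro: test_space_add)
    qed
    show ?case
    proof (rule test_space_closed[OF part])
      show "(\<lambda>n. abs_L2 (\<lambda>x. indicator ((\<Union>i<n. E i) \<inter> box c d) x))
        \<longlonglongrightarrow> abs_L2 (\<lambda>x. indicator (\<Union> (range E) \<inter> box c d) x)"
      proof (rule tendsto_abs_L2_dominated(3)[where w="indicator (box c d)"])
        show "integrable lborel (\<lambda>x. (indicator (box c d) x :: real)\<^sup>2)"
          using emeasure_lborel_box_finite[of c d] by (simp add: indicator_real_square integrable_real_indicator)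
        show "AE x in lborel. (\<lambda>n. indicator ((\<Union>i<n. E i) \<inter> box c d) x :: complex)
            \<longlonglongrightarrow> indicator (\<Union> (range E) \<inter> box c d) x"
        proof (rule AE_I2)
          fix x
          show "(\<lambda>n. indicator ((\<Union>i<n. E i) \<inter> box c d) x :: complex)
            \<longlonglongrightarrow> indicator (\<Union> (range E) \<inter> box c d) x"
          proof (cases "\<exists>i. x \<in> E i")
            case True
            then obtain i where i: "x \<in> E i" by blast
            have "eventually (\<lambda>n. indicator ((\<Union>i<n. E i) \<inter> box c d) x
                = (indicator (\<Union> (range E) \<inter> box c d) x :: complex)) sequentially"
              using eventually_gt_at_top[of i]
              by eventually_elim (use i in \<open>auto simp: indicator_def\<close>)
            then show ?thesis by (rule tendsto_eventually)
          qed (simp add: indicator_def)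
        qed
      qed (use E in \<open>auto simp: indicator_def\<close>)
    qed
  qed
qed

lemma abs_L2_sum:
  assumes "finite Y" "\<And>y. y \<in> Y \<Longrightarrow> sq_integrable (g y)"
  shows "abs_L2 (\<lambda>x. \<Sum>y\<in>Y. g y x) = (\<Sum>y\<in>Y. abs_L2 (g y))"
    and "sq_integrable (\<lambda>x. \<Sum>y\<in>Y. g y x)"
proof -
  have "abs_L2 (\<lambda>x. \<Sum>y\<in>Y. g y x) = (\<Sum>y\<in>Y. abs_L2 (g y)) \<and> sq_integrable (\<lambda>x. \<Sum>y\<in>Y. g y x)"
    using assms
    by (induction Y rule: finite_induct)
      (auto simp: zero_L2_def sq_integrable_zero sq_integrable_add simp flip: plus_abs_L2)
  then show "abs_L2 (\<lambda>x. \<Sum>y\<in>Y. g y x) = (\<Sum>y\<in>Y. abs_L2 (g y))"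
    "sq_integrable (\<lambda>x. \<Sum>y\<in>Y. g y x)" by blast+
qed

text \<open>Cover \<Omega> by countably many closed boxes, approximate by simple functions on the
  finite unions \<open>E n\<close>, then let these exhaust \<Omega>, which by \<open>null\<close>
  loses nothing.\<close>

theorem test_space_eq_UNIV:
  fixes \<Omega> :: "'a::euclidean_space set"
  assumes op: "open \<Omega>" and null: "AE x in lborel. x \<in> \<Omega>"
  shows "test_space \<Omega> = UNIV"
proof -
  \<comment> \<open>Quantifying over all Borel sets A makes the class closed under unions that need
    not be disjoint: A \<inter> (E \<union> E') splits into A \<inter> E and (A - E) \<inter>
    E'.\<close>
  define good where "good E \<longleftrightarrow> E \<in> sets borel \<and> emeasure lborel E < \<infinity> \<and>
    (\<forall>A\<in>sets borel. abs_L2 (\<lambda>x. indicator (A \<inter> E) x) \<in> test_space \<Omega>)" for E :: "'a set"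
  have sq: "good E \<Longrightarrow> A \<in> sets borel \<Longrightarrow> sq_integrable (\<lambda>x. indicator (A \<inter> E) x)" for E A
  proof (rule sq_integrable_indicator)
    assume "good E" "A \<in> sets borel"
    then show "A \<inter> E \<in> sets borel" "emeasure lborel (A \<inter> E) < \<infinity>"
      using emeasure_mono[of "A \<inter> E" E lborel] by (auto simp: good_def intro: le_less_trans)
  qed
  have good_cbox: "good (cbox c d)" if "cbox c d \<subseteq> \<Omega>" for c d
    unfolding good_def
  proof (intro conjI ballI)
    fix A :: "'a set" assume A: "A \<in> sets borel"
    have s1: "sq_integrable (\<lambda>x. indicator (A \<inter> box c d) x)"
      using A emeasure_mono[of "A \<inter> box c d" "box c d" lborel] emeasure_lborel_box_finite[of c d]
      by (intro sq_integrable_indicator) (auto intro: le_less_trans)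
    have s2: "sq_integrable (\<lambda>x. indicator (A \<inter> cbox c d) x)"
      using A emeasure_mono[of "A \<inter> cbox c d" "cbox c d" lborel] emeasure_lborel_cbox_finite[of c d]
      by (intro sq_integrable_indicator) (auto intro: le_less_trans)
    \<comment> \<open>The Dynkin argument covers open boxes; the faces are null, so the closed box
      gives the same class in L2.\<close>
    have "cbox c d - box c d \<in> null_sets lborel"
    proof (rule null_setsI)
      show "emeasure lborel (cbox c d - box c d) = 0"
        by (subst emeasure_Diff) (auto simp: emeasure_lborel_cbox_eq emeasure_lborel_box_eq box_subset_cbox)
    qed simp
    then have "AE x in lborel. x \<notin> cbox c d - box c d" by (rule AE_not_in)
    then have "AE x in lborel. indicator (A \<inter> box c d) x = (indicator (A \<inter> cbox c d) x :: complex)"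
      by eventually_elim (use box_subset_cbox[of c d] in \<open>auto simp: indicator_def\<close>)
    then show "abs_L2 (\<lambda>x. indicator (A \<inter> cbox c d) x) \<in> test_space \<Omega>"
      using test_space_Int_box[OF A that] abs_L2_eq_iff[OF s1 s2] by simp
  qed (simp_all add: emeasure_lborel_cbox_finite[simplified])
  have good_Un: "good (E \<union> E')" if E: "good E" and E': "good E'" for E E'
    unfolding good_def
  proof (intro conjI ballI)
    fix A :: "'a set" assume A: "A \<in> sets borel"
    then have A': "A - E \<in> sets borel" using E by (auto simp: good_def)
    have "(\<lambda>x. indicator (A \<inter> (E \<union> E')) x :: complex)
      = (\<lambda>x. indicator (A \<inter> E) x + indicator ((A - E) \<inter> E') x)"
      by (auto simp: indicator_def fun_eq_iff)
    then have "abs_L2 (\<lambda>x. indicator (A \<inter> (E \<union> E')) x)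
      = abs_L2 (\<lambda>x. indicator (A \<inter> E) x) + abs_L2 (\<lambda>x. indicator ((A - E) \<inter> E') x)"
      using sq[OF E A] sq[OF E' A'] by (simp add: plus_abs_L2)
    then show "abs_L2 (\<lambda>x. indicator (A \<inter> (E \<union> E')) x) \<in> test_space \<Omega>"
      using E E' A A' by (auto simp: good_def intro: test_space_add)
  next
    show "emeasure lborel (E \<union> E') < \<infinity>"
      using E E' emeasure_subadditive[of E lborel E'] by (auto simp: good_def intro: le_less_trans)
  qed (use E E' in \<open>auto simp: good_def\<close>)
  obtain \<D> where \<D>: "countable \<D>" "\<And>X. X \<in> \<D> \<Longrightarrow> \<exists>a b. X = cbox a b" "\<Union>\<D> = \<Omega>"
    using open_countable_Union_open_cbox[OF op] by metis
  \<comment> \<open>The enumeration by \<open>from_nat_into\<close> requires a nonempty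
    cover.\<close>
  have "\<Omega> \<noteq> {}"
  proof
    assume "\<Omega> = {}"
    then have "AE x in (lborel::'a measure). False" using null by simp
    then show False by (simp add: ae_filter_eq_bot_iff)
  qed
  then have "\<D> \<noteq> {}" using \<D>(3) by auto
  define C where "C = from_nat_into \<D>"
  have C: "range C = \<D>"
    unfolding C_def using \<open>\<D> \<noteq> {}\<close> \<D>(1) by (rule range_from_nat_into)
  define E where "E n = (\<Union>i<n. C i)" for n :: nat
  have goodC: "good (C i)" for i
  proof -
    have "C i \<in> \<D>" using C by auto
    then obtain a b where "C i = cbox a b" "C i \<subseteq> \<Omega>" using \<D>(2,3) by blast
    then show ?thesis using good_cbox by simp
  qed
  have goodE: "good (E n)" for n
  proof (induction n)
    case 0
    then show ?case using test_space_zero[of \<Omega>] by (simp add: E_def good_def zero_L2_def)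
  next
    case (Suc n)
    have "E (Suc n) = E n \<union> C n" by (auto simp: E_def lessThan_Suc)
    then show ?case using good_Un[OF Suc goodC] by simp
  qed
  have "f \<in> test_space \<Omega>" for f :: "'a L2"
  proof -
    obtain u where u: "sq_integrable u" "f = abs_L2 u" by (rule L2_cases)
    have um [measurable]: "u \<in> borel_measurable borel" using u(1) by (simp add: sq_integrable_def)
    have u2: "integrable lborel (\<lambda>x. (cmod (u x))\<^sup>2)" using u(1) by (simp add: sq_integrable_def)
    have Em [measurable]: "E n \<in> sets borel" for n using goodE by (simp add: good_def)
    have "abs_L2 (\<lambda>x. u x * indicator (E n) x) \<in> test_space \<Omega>" for n
    proof -
      obtain F where F: "\<And>i. simple_function lborel (F i)" "\<And>x. (\<lambda>i. F i x) \<longlonglongrightarrow> u x"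
        "\<And>i x. cmod (F i x) \<le> 2 * cmod (u x)"
        using borel_measurable_implies_sequence_metric[of u lborel 0] by auto
      have Fm [measurable]: "F i \<in> borel_measurable borel" for i
        using borel_measurable_simple_function[OF F(1)] by simp
      have "abs_L2 (\<lambda>x. F i x * indicator (E n) x) \<in> test_space \<Omega>" for i
      proof -
        have fin: "finite (range (F i))" using F(1)[of i] by (simp add: simple_function_def)
        have Am: "F i -` {y} \<in> sets borel" for y
          using measurable_sets[OF Fm[of i], of "{y}"] by simp
        have s: "sq_integrable (\<lambda>x. indicator (F i -` {y} \<inter> E n) x)" for y
          by (intro sq goodE Am)
        have "abs_L2 (\<lambda>x. \<Sum>y\<in>range (F i). y * indicator (F i -` {y} \<inter> E n) x)
            = (\<Sum>y\<in>range (F i). y *\<^sub>C abs_L2 (\<lambda>x. indicator (F i -` {y} \<inter> E n) x))"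
          using abs_L2_sum(1)[OF fin, of "\<lambda>y x. y * indicator (F i -` {y} \<inter> E n) x"]
          by (simp only: sq_integrable_mult_left[OF s] scaleC_abs_L2[OF s])
        moreover have "F i x * indicator (E n) x
            = (\<Sum>y\<in>range (F i). y * indicator (F i -` {y} \<inter> E n) x)" for x
        proof -
          have "(\<Sum>y\<in>range (F i). y * indicator (F i -` {y} \<inter> E n) x)
              = (\<Sum>y\<in>range (F i). if y = F i x then F i x * indicator (E n) x else 0)"
            by (intro sum.cong) (auto simp: indicator_def)
          then show ?thesis using fin by simp
        qed
        ultimately have "abs_L2 (\<lambda>x. F i x * indicator (E n) x)
            = (\<Sum>y\<in>range (F i). y *\<^sub>C abs_L2 (\<lambda>x. indicator (F i -` {y} \<inter> E n) x))"
          by (simp only:)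
        also have "\<dots> \<in> test_space \<Omega>"
          using goodE Am by (intro test_space_sum fin test_space_scaleC) (auto simp: good_def)
        finally show ?thesis .
      qed
      moreover have "(\<lambda>i. abs_L2 (\<lambda>x. F i x * indicator (E n) x)) \<longlonglongrightarrow> abs_L2 (\<lambda>x. u x * indicator (E n) x)"
      proof (rule tendsto_abs_L2_dominated(3)[where w="\<lambda>x. 2 * cmod (u x)"])
        show "integrable lborel (\<lambda>x. (2 * cmod (u x))\<^sup>2)" using u2 by (simp add: power_mult_distrib)
        show "AE x in lborel. cmod (F i x * indicator (E n) x) \<le> 2 * cmod (u x)" for i
          using F(3) by (auto simp: indicator_def)
        show "AE x in lborel. (\<lambda>i. F i x * indicator (E n) x) \<longlonglongrightarrow> u x * indicator (E n) x"
          using F(2) by (intro AE_I2 tendsto_intros)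
      qed auto
      ultimately show ?thesis by (rule test_space_closed)
    qed
    moreover have "(\<lambda>n. abs_L2 (\<lambda>x. u x * indicator (E n) x)) \<longlonglongrightarrow> abs_L2 u"
    proof (rule tendsto_abs_L2_dominated(3)[where w="\<lambda>x. cmod (u x)"])
      show "AE x in lborel. cmod (u x * indicator (E i) x) \<le> cmod (u x)" for i
        by (auto simp: indicator_def)
      show "AE x in lborel. (\<lambda>n. u x * indicator (E n) x) \<longlonglongrightarrow> u x"
        using null
      proof eventually_elim
        case (elim x)
        then obtain i where i: "x \<in> C i" using C \<D>(3) by auto
        have "eventually (\<lambda>n. u x * indicator (E n) x = u x) sequentially"
          using eventually_gt_at_top[of i] by eventually_elim (use i in \<open>auto simp: E_def indicator_def\<close>)
        then show ?case by (rule tendsto_eventually)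
      qed
    qed (use u2 in auto)
    ultimately show ?thesis unfolding u(2) by (rule test_space_closed)
  qed
  then show ?thesis by auto
qed

section \<open>Zeros of harmonic functions\<close>

lemma countable_isolated_real:
  fixes A :: "real set"
  assumes "\<And>t. t \<in> A \<Longrightarrow> \<exists>d>0. \<forall>s\<in>A. \<bar>s - t\<bar> < d \<longrightarrow> s = t"
  shows "countable A"
proof -
  \<comment> \<open>Recovers a point of A from a rational interval that contains no other one; its
    values on all other intervals are irrelevant.\<close>
  define g where "g = (\<lambda>(p::real, q). THE t. t \<in> A \<inter> {p<..<q})"
  have "A \<subseteq> g ` (\<rat> \<times> \<rat>)"
  proof
    fix t assume t: "t \<in> A"
    then obtain d where d: "d > 0" "\<And>s. s \<in> A \<Longrightarrow> \<bar>s - t\<bar> < d \<Longrightarrow> s = t" using assms by blast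
    obtain p where p: "p \<in> \<rat>" "t - d < p" "p < t"
      using Rats_dense_in_real[of "t - d" t] d(1) by auto
    obtain q where q: "q \<in> \<rat>" "t < q" "q < t + d"
      using Rats_dense_in_real[of t "t + d"] d(1) by auto
    have "g (p, q) = t"
      unfolding g_def prod.case
    proof (rule the_equality)
      show "t \<in> A \<inter> {p<..<q}" using t p q by simp
      show "s = t" if "s \<in> A \<inter> {p<..<q}" for s
        using that p q by (intro d(2)) auto
    qed
    then show "t \<in> g ` (\<rat> \<times> \<rat>)" using p(1) q(1) by (metis SigmaI image_eqI)
  qed
  moreover have "countable (g ` (\<rat> \<times> \<rat>))"
    using countable_rat by (intro countable_image countable_SIGMA) auto
  ultimately show ?thesis by (rule countable_subset)
qed

text \<open>All translates of Z along v have the measure of Z. Averaging them over t in [0, 1] and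
  exchanging the integrals leaves, for each x, the measure of a countable set of times. This avoids
  coordinates adapted to v.\<close>

lemma null_set_of_countable_lines:
  fixes Z :: "'a::euclidean_space set"
  assumes Z [measurable]: "Z \<in> sets borel" and c: "\<And>x. countable {t. x + t *\<^sub>R v \<in> Z}"
  shows "Z \<in> null_sets lborel"
proof (rule null_setsI)
  define I where "I = {0..1::real}"
  have "emeasure lborel Z = (\<integral>\<^sup>+t. indicator I t * emeasure lborel Z \<partial>lborel)"
    by (simp add: nn_integral_multc I_def)
  also have "\<dots> = (\<integral>\<^sup>+t. \<integral>\<^sup>+x. indicator I t * indicator Z (x + t *\<^sub>R v) \<partial>lborel \<partial>lborel)"
  proof (intro nn_integral_cong)
    fix t :: real
    have "emeasure lborel Z = (\<integral>\<^sup>+x. indicator Z x \<partial>(distr lborel borel ((+) (t *\<^sub>R v))))"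
      by (simp add: lborel_distr_plus)
    also have "\<dots> = (\<integral>\<^sup>+x. indicator Z (t *\<^sub>R v + x) \<partial>lborel)" by (rule nn_integral_distr) auto
    finally show "indicator I t * emeasure lborel Z
        = (\<integral>\<^sup>+x. indicator I t * indicator Z (x + t *\<^sub>R v) \<partial>lborel)"
      by (subst nn_integral_cmult) (simp_all add: add.commute)
  qed
  also have "\<dots> = (\<integral>\<^sup>+x. \<integral>\<^sup>+t. indicator I t * indicator Z (x + t *\<^sub>R v) \<partial>lborel \<partial>lborel)"
    by (rule lborel_pair.Fubini') (simp add: I_def split_beta')
  also have "\<dots> = (\<integral>\<^sup>+x. 0 \<partial>(lborel :: 'a measure))"
  proof (intro nn_integral_cong)
    fix x :: 'a
    have "{t. x + t *\<^sub>R v \<in> Z} \<in> null_sets lborel" using c by (rule countable_imp_null_set_lborel)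
    then have "AE t in lborel. t \<notin> {t. x + t *\<^sub>R v \<in> Z}" by (rule AE_not_in)
    then have "(\<integral>\<^sup>+t. indicator I t * indicator Z (x + t *\<^sub>R v) \<partial>lborel) = (\<integral>\<^sup>+t. 0 \<partial>(lborel :: real measure))"
      by (intro nn_integral_cong_AE) (auto elim!: eventually_mono)
    then show "(\<integral>\<^sup>+t. indicator I t * indicator Z (x + t *\<^sub>R v) \<partial>lborel) = 0" by simp
  qed
  finally show "emeasure lborel Z = 0" by simp
qed (use Z in simp)

text \<open>On a line in direction v a zero with nonzero derivative is isolated among the zeros, so
  each such line meets the set in countably many points.\<close>

lemma simple_zeros_null:
  fixes h :: "'a::euclidean_space \<Rightarrow> real"
  assumes S: "open S" and h: "Ck_on 1 S h"
  shows "{x \<in> S. h x = 0 \<and> dir_deriv v h x \<noteq> 0} \<in> null_sets lborel"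
proof (rule null_set_of_countable_lines)
  have c: "continuous_on S h" "continuous_on S (dir_deriv v h)"
    using h Ck_on_SucD[of 0 S h] by auto
  have op: "open {x \<in> S. g x \<noteq> (0::real)}" if "continuous_on S g" for g
  proof -
    have "open (S \<inter> g -` (- {0}))" using that S by (intro continuous_open_preimage) auto
    then show ?thesis by (simp add: Int_def vimage_def)
  qed
  have "{x \<in> S. h x = 0 \<and> dir_deriv v h x \<noteq> 0} = {x \<in> S. dir_deriv v h x \<noteq> 0} - {x \<in> S. h x \<noteq> 0}"
    by auto
  then show "{x \<in> S. h x = 0 \<and> dir_deriv v h x \<noteq> 0} \<in> sets borel"
    using op[OF c(1)] op[OF c(2)] by simp
  show "countable {t. x + t *\<^sub>R v \<in> {x \<in> S. h x = 0 \<and> dir_deriv v h x \<noteq> 0}}" for x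
  proof (rule countable_isolated_real)
    fix t assume "t \<in> {t. x + t *\<^sub>R v \<in> {x \<in> S. h x = 0 \<and> dir_deriv v h x \<noteq> 0}}"
    then have t: "x + t *\<^sub>R v \<in> S" "h (x + t *\<^sub>R v) = 0" "dir_deriv v h (x + t *\<^sub>R v) \<noteq> 0" by auto
    have "((\<lambda>s. h (x + s *\<^sub>R v)) has_real_derivative dir_deriv v h (x + t *\<^sub>R v)) (at t)"
      using h t(1) by (intro has_real_derivative_line) simp
    then have "((\<lambda>s. (h (x + s *\<^sub>R v) - h (x + t *\<^sub>R v)) / (s - t)) \<longlongrightarrow> dir_deriv v h (x + t *\<^sub>R v)) (at t)"
      by (simp add: has_field_derivative_iff)
    then have "eventually (\<lambda>s. (h (x + s *\<^sub>R v) - h (x + t *\<^sub>R v)) / (s - t) \<noteq> 0) (at t)"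
      using t(3) by (rule tendsto_imp_eventually_ne)
    then have "\<exists>d>0. \<forall>s. s \<noteq> t \<and> dist s t < d \<longrightarrow> h (x + s *\<^sub>R v) \<noteq> 0"
      unfolding eventually_at using t(2) by auto
    then show "\<exists>d>0. \<forall>s\<in>{t. x + t *\<^sub>R v \<in> {x \<in> S. h x = 0 \<and> dir_deriv v h x \<noteq> 0}}. \<bar>s - t\<bar> < d \<longrightarrow> s = t"
      by (auto simp: dist_real_def)
  qed
qed

section \<open>Gradient bounds from the maximum principle\<close>

lemma second_derivative_at_max:
  fixes f :: "real \<Rightarrow> real"
  assumes d: "d > 0" and f: "\<And>t. \<bar>t\<bar> < d \<Longrightarrow> (f has_real_derivative f' t) (at t)"
    and f': "(f' has_real_derivative m) (at 0)"
    and max: "\<And>t. \<bar>t\<bar> < d \<Longrightarrow> f t \<le> f 0"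
  shows "m \<le> 0"
proof (rule ccontr)
  assume "\<not> m \<le> 0"
  then obtain e where e: "e > 0" "\<And>h. h > 0 \<Longrightarrow> h < e \<Longrightarrow> f' 0 < f' (0 + h)"
    using DERIV_pos_inc_right[OF f'] by auto
  have f0: "f' 0 = 0"
    using DERIV_local_max[OF f[of 0] d] max d by (simp add: abs_minus_commute)
  define h where "h = min d e / 2"
  have h: "h > 0" "h < d" "h < e" using d e by (auto simp: h_def)
  have "\<exists>z. 0 < z \<and> z < h \<and> f h - f 0 = (h - 0) * f' z"
    by (rule MVT2[OF h(1)]) (use h f in auto)
  then obtain z where z: "0 < z" "z < h" "f h - f 0 = h * f' z" by auto
  have "f' z > 0" using e(2)[of z] z h f0 by simp
  then have "f h > f 0" using z(3) h(1) by (metis diff_gt_0_iff_gt mult_pos_pos)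
  then show False using max[of h] h by simp
qed

lemma dir_deriv_Basis:
  fixes f :: "'a::euclidean_space \<Rightarrow> real"
  assumes "f differentiable (at x)"
  shows "dir_deriv v f x = (\<Sum>b\<in>Basis. (v \<bullet> b) * dir_deriv b f x)"
proof -
  have lin: "linear (frechet_derivative f (at x))"
    using assms by (rule linear_frechet_derivative)
  have "dir_deriv v f x = dir_deriv (\<Sum>b\<in>Basis. (v \<bullet> b) *\<^sub>R b) f x"
    by (simp add: euclidean_representation)
  also have "\<dots> = (\<Sum>b\<in>Basis. (v \<bullet> b) * dir_deriv b f x)"
    by (simp add: linear_sum[OF lin] linear_cmul[OF lin])
  finally show ?thesis .
qed

lemma norm_sq_Basis: "(norm (v::'a::euclidean_space))\<^sup>2 = (\<Sum>b\<in>Basis. (v \<bullet> b)\<^sup>2)"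
  using euclidean_inner[of v v] by (simp only: power2_norm_eq_inner power2_eq_square[of "v \<bullet> _"])

lemma dir_deriv_sq_le:
  fixes f :: "'a::euclidean_space \<Rightarrow> real"
  assumes "f differentiable (at x)" "norm v \<le> 1"
  shows "(dir_deriv v f x)\<^sup>2 \<le> (\<Sum>b\<in>Basis. (dir_deriv b f x)\<^sup>2)"
proof -
  have "(dir_deriv v f x)\<^sup>2 = (\<Sum>b\<in>Basis. (v \<bullet> b) * dir_deriv b f x)\<^sup>2"
    using dir_deriv_Basis[OF assms(1), of v] by (simp only:)
  also have "\<dots> \<le> (\<Sum>b\<in>Basis. (v \<bullet> b)\<^sup>2) * (\<Sum>b\<in>Basis. (dir_deriv b f x)\<^sup>2)"
    by (rule Cauchy_Schwarz_ineq_sum)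
  also have "(\<Sum>b\<in>Basis. (v \<bullet> b)\<^sup>2) = (norm v)\<^sup>2"
    by (rule norm_sq_Basis[symmetric])
  also have "(norm v)\<^sup>2 * (\<Sum>b\<in>Basis. (dir_deriv b f x)\<^sup>2) \<le> 1 * (\<Sum>b\<in>Basis. (dir_deriv b f x)\<^sup>2)"
    using assms(2) by (intro mult_right_mono sum_nonneg) (auto simp: power_le_one)
  finally show ?thesis by simp
qed

definition harmonic_on :: "'a::euclidean_space set \<Rightarrow> ('a \<Rightarrow> real) \<Rightarrow> bool" where
  "harmonic_on S Q \<longleftrightarrow> smooth_on S Q \<and> (\<forall>x\<in>S. laplacian Q x = 0)"

lemma harmonic_on_smooth: "harmonic_on S Q \<Longrightarrow> smooth_on S Q"
  by (simp add: harmonic_on_def)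

text \<open>The Laplacian commutes with directional derivatives because mixed derivatives commute;
  this is what allows the gradient bound to be iterated.\<close>

lemma harmonic_on_dir_deriv:
  assumes S: "open S" and Q: "harmonic_on S Q"
  shows "harmonic_on S (dir_deriv v Q)"
  unfolding harmonic_on_def
proof (intro conjI ballI)
  have sm: "smooth_on S Q" using Q by (simp add: harmonic_on_def)
  then show "smooth_on S (dir_deriv v Q)" by (rule smooth_on_dir_deriv)
  fix x assume x: "x \<in> S"
  have "dir_deriv b (dir_deriv b (dir_deriv v Q)) x = dir_deriv v (dir_deriv b (dir_deriv b Q)) x" for b
  proof -
    have "dir_deriv b (dir_deriv b (dir_deriv v Q)) x = dir_deriv b (dir_deriv v (dir_deriv b Q)) x"
      by (rule dir_deriv_cong[OF S x]) (rule dir_deriv_commute[OF smooth_onD[OF sm] S])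
    also have "\<dots> = dir_deriv v (dir_deriv b (dir_deriv b Q)) x"
      by (rule dir_deriv_commute[OF smooth_onD[OF smooth_on_dir_deriv[OF sm]] S x])
    finally show ?thesis .
  qed
  then have "laplacian (dir_deriv v Q) x = (\<Sum>b\<in>Basis. dir_deriv v (dir_deriv b (dir_deriv b Q)) x)"
    by (simp add: laplacian_def)
  also have "\<dots> = dir_deriv v (laplacian Q) x"
  proof -
    have "(laplacian Q has_derivative (\<lambda>v. \<Sum>b\<in>Basis. dir_deriv v (dir_deriv b (dir_deriv b Q)) x)) (at x)"
      unfolding laplacian_def[abs_def]
      by (intro has_derivative_sum dir_deriv_works smooth_on_differentiable[OF _ x] smooth_on_dir_deriv sm)
    from dir_deriv_eq[OF this] show ?thesis by simp
  qed
  also have "\<dots> = dir_deriv v (\<lambda>_. 0) x"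
    by (rule dir_deriv_cong[OF S x]) (use Q in \<open>simp add: harmonic_on_def\<close>)
  finally show "laplacian (dir_deriv v Q) x = 0" by simp
qed

text \<open>Bernstein's method: with \<open>E = r\<^sup>2 - \<bar>x - x0\<bar>\<^sup>2\<close>, \<open>w = \<partial>\<^sub>v Q\<close> and \<open>K = (12 + 2 N) r\<^sup>2\<close> the function
  \<open>(E w)\<^sup>2 + K Q\<^sup>2\<close> is subharmonic on the ball and equals \<open>K Q\<^sup>2\<close> on its boundary.\<close>

lemma gradient_estimate:
  fixes Q :: "'a::euclidean_space \<Rightarrow> real"
  assumes S: "open S" "cball x0 r \<subseteq> S" and r: "r > 0" and Q: "harmonic_on S Q"
    and M: "\<And>x. x \<in> cball x0 r \<Longrightarrow> \<bar>Q x\<bar> \<le> M" and v: "norm v \<le> 1"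
  shows "\<bar>dir_deriv v Q x0\<bar> \<le> sqrt (12 + 2 * real DIM('a)) / r * M"
proof -
  define K where "K = (12 + 2 * real DIM('a)) * r\<^sup>2"
  define w where "w = dir_deriv v Q"
  define E where "E x = r\<^sup>2 - (norm (x - x0))\<^sup>2" for x
  have smQ: "smooth_on S Q" and smw: "smooth_on S w"
    using Q smooth_on_dir_deriv by (auto simp: harmonic_on_def w_def)
  have hw: "harmonic_on S w" unfolding w_def using S(1) Q by (rule harmonic_on_dir_deriv)
  have M0: "M \<ge> 0" using M[of x0] r by (smt (verit) centre_in_cball)
  have K0: "K > 0" using r by (simp add: K_def)
  \<comment> \<open>The e-term in F is e |x - x0|^2. It makes F strictly subharmonic, so that an
    interior maximum is contradictory; e tends to 0 afterwards.\<close>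
  have main: "r ^ 4 * (w x0)\<^sup>2 \<le> K * M\<^sup>2 + e * r\<^sup>2" if e: "e > 0" for e
  proof -
    define F where "F x = (E x * w x)\<^sup>2 + K * (Q x)\<^sup>2 + e * (r\<^sup>2 - E x)" for x
    have "continuous_on (cball x0 r) F"
      unfolding F_def E_def
      using S(2) smooth_on_continuous[OF smQ] smooth_on_continuous[OF smw]
      by (auto intro!: continuous_intros intro: continuous_on_subset)
    then obtain y where y: "y \<in> cball x0 r" "\<And>x. x \<in> cball x0 r \<Longrightarrow> F x \<le> F y"
      using continuous_attains_sup[OF compact_cball, of x0 r F] r by auto
    have "dist x0 y = r"
    proof (rule ccontr)
      assume "dist x0 y \<noteq> r"
      then have yr: "dist x0 y < r" using y(1) by simp
      define d where "d = r - dist x0 y"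
      have d: "d > 0" using yr by (simp add: d_def)
      have yS: "y \<in> S" using y(1) S(2) by blast
      \<comment> \<open>The second derivative of F at y in direction b, hence nonpositive at an
        interior maximum.\<close>
      define m where "m b = 2 * ((- 2 * ((y - x0) \<bullet> b)) * w y + E y * dir_deriv b w y)\<^sup>2
        + 2 * E y * w y * (- 2 * w y + 2 * (- 2 * ((y - x0) \<bullet> b)) * dir_deriv b w y + E y * dir_deriv b (dir_deriv b w) y)
        + 2 * K * ((dir_deriv b Q y)\<^sup>2 + Q y * dir_deriv b (dir_deriv b Q) y) + 2 * e" for b
      have m: "m b \<le> 0" if b: "b \<in> Basis" for b
      proof -
        define e1 where "e1 = - 2 * ((y - x0) \<bullet> b)"
        have inB: "y + t *\<^sub>R b \<in> cball x0 r" if "\<bar>t\<bar> < d" for t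
        proof -
          have "dist x0 (y + t *\<^sub>R b) \<le> dist x0 y + dist y (y + t *\<^sub>R b)" by (rule dist_triangle)
          also have "dist y (y + t *\<^sub>R b) = \<bar>t\<bar>" using b by (simp add: dist_norm)
          finally show ?thesis using that by (simp add: d_def)
        qed
        have inS: "y + t *\<^sub>R b \<in> S" if "\<bar>t\<bar> < d" for t using inB[OF that] S(2) by blast
        have Et: "E (y + t *\<^sub>R b) = E y + e1 * t - t\<^sup>2" for t
        proof -
          have "(norm (y + t *\<^sub>R b - x0))\<^sup>2 = (norm ((y - x0) + t *\<^sub>R b))\<^sup>2" by (simp add: algebra_simps)
          also have "\<dots> = (norm (y - x0))\<^sup>2 + 2 * t * ((y - x0) \<bullet> b) + t\<^sup>2"
            using b unfolding power2_norm_eq_inner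
            by (simp add: inner_add_left inner_add_right inner_commute power2_eq_square)
          finally show ?thesis by (simp add: E_def e1_def)
        qed
        have dE: "((\<lambda>t. E (y + t *\<^sub>R b)) has_real_derivative e1 - 2 * t) (at t)" for t
          unfolding Et by (auto intro!: derivative_eq_intros)
        define g where "g t = 2 * (E (y + t *\<^sub>R b) * w (y + t *\<^sub>R b))
            * ((e1 - 2 * t) * w (y + t *\<^sub>R b) + E (y + t *\<^sub>R b) * dir_deriv b w (y + t *\<^sub>R b))
          + 2 * K * (Q (y + t *\<^sub>R b) * dir_deriv b Q (y + t *\<^sub>R b)) - e * (e1 - 2 * t)" for t
        have dQ: "((\<lambda>t. Q (y + t *\<^sub>R b)) has_real_derivative dir_deriv b Q (y + t *\<^sub>R b)) (at t)"
          "((\<lambda>t. w (y + t *\<^sub>R b)) has_real_derivative dir_deriv b w (y + t *\<^sub>R b)) (at t)"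
          "((\<lambda>t. dir_deriv b Q (y + t *\<^sub>R b)) has_real_derivative dir_deriv b (dir_deriv b Q) (y + t *\<^sub>R b)) (at t)"
          "((\<lambda>t. dir_deriv b w (y + t *\<^sub>R b)) has_real_derivative dir_deriv b (dir_deriv b w) (y + t *\<^sub>R b)) (at t)"
          if "\<bar>t\<bar> < d" for t
          using that smQ smw
          by (auto intro!: has_real_derivative_line smooth_on_differentiable[OF _ inS] smooth_on_dir_deriv)
        have F1: "((\<lambda>t. F (y + t *\<^sub>R b)) has_real_derivative g t) (at t)" if "\<bar>t\<bar> < d" for t
          unfolding F_def g_def
          by (rule derivative_eq_intros dQ[OF that] dE refl)+ (simp add: algebra_simps)
        have F2: "(g has_real_derivative m b) (at 0)"
        proof -
          have "\<bar>0\<bar> < d" using d by simp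
          note D0 = dQ[OF this, simplified]
          have "(g has_real_derivative
            2 * ((E y * w y) * ((- 2) * w y + e1 * dir_deriv b w y
                 + (e1 * dir_deriv b w y + E y * dir_deriv b (dir_deriv b w) y))
               + (e1 * w y + E y * dir_deriv b w y) * (e1 * w y + E y * dir_deriv b w y))
            + 2 * K * (Q y * dir_deriv b (dir_deriv b Q) y + dir_deriv b Q y * dir_deriv b Q y) + 2 * e) (at 0)"
            unfolding g_def
            by (rule derivative_eq_intros D0 dE refl)+ (simp add: algebra_simps)
          moreover have "2 * ((E y * w y) * ((- 2) * w y + e1 * dir_deriv b w y
                 + (e1 * dir_deriv b w y + E y * dir_deriv b (dir_deriv b w) y))
               + (e1 * w y + E y * dir_deriv b w y) * (e1 * w y + E y * dir_deriv b w y))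
            + 2 * K * (Q y * dir_deriv b (dir_deriv b Q) y + dir_deriv b Q y * dir_deriv b Q y) + 2 * e = m b"
            unfolding m_def e1_def[symmetric] by (simp add: algebra_simps power2_eq_square)
          ultimately show ?thesis by simp
        qed
        show ?thesis
          by (rule second_derivative_at_max[OF d F1 F2]) (use y(2)[OF inB] in auto)
      qed
      \<comment> \<open>Completing the square in \<open>dir_deriv b w y\<close> removes the cross
        terms and leaves - 24 ((y - x0) \<bullet> b)^2 (w y)^2, the origin of the 12 in K.\<close>
      have mb: "m b \<ge> - 24 * ((y - x0) \<bullet> b)\<^sup>2 * (w y)\<^sup>2 - 4 * E y * (w y)\<^sup>2
          + 2 * (E y)\<^sup>2 * w y * dir_deriv b (dir_deriv b w) y
          + 2 * K * (dir_deriv b Q y)\<^sup>2 + 2 * K * Q y * dir_deriv b (dir_deriv b Q) y + 2 * e" for b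
      proof -
        have "m b - (- 24 * ((y - x0) \<bullet> b)\<^sup>2 * (w y)\<^sup>2 - 4 * E y * (w y)\<^sup>2
          + 2 * (E y)\<^sup>2 * w y * dir_deriv b (dir_deriv b w) y
          + 2 * K * (dir_deriv b Q y)\<^sup>2 + 2 * K * Q y * dir_deriv b (dir_deriv b Q) y + 2 * e)
          = 2 * (E y * dir_deriv b w y - 4 * ((y - x0) \<bullet> b) * w y)\<^sup>2"
          unfolding m_def by (simp add: algebra_simps power2_eq_square)
        then show ?thesis using zero_le_power2 by (smt (verit))
      qed
      have lap: "(\<Sum>b\<in>Basis. dir_deriv b (dir_deriv b w) y) = 0" "(\<Sum>b\<in>Basis. dir_deriv b (dir_deriv b Q) y) = 0"
        using Q hw yS by (auto simp: harmonic_on_def laplacian_def)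
      have "0 \<ge> (\<Sum>b\<in>Basis. m b)" by (intro sum_nonpos m)
      also have "(\<Sum>b\<in>Basis. m b) \<ge> (\<Sum>b\<in>Basis. - 24 * ((y - x0) \<bullet> b)\<^sup>2 * (w y)\<^sup>2 - 4 * E y * (w y)\<^sup>2
          + 2 * (E y)\<^sup>2 * w y * dir_deriv b (dir_deriv b w) y
          + 2 * K * (dir_deriv b Q y)\<^sup>2 + 2 * K * Q y * dir_deriv b (dir_deriv b Q) y + 2 * e)"
        by (intro sum_mono mb)
      also have "(\<Sum>b\<in>Basis. - 24 * ((y - x0) \<bullet> b)\<^sup>2 * (w y)\<^sup>2 - 4 * E y * (w y)\<^sup>2
          + 2 * (E y)\<^sup>2 * w y * dir_deriv b (dir_deriv b w) y
          + 2 * K * (dir_deriv b Q y)\<^sup>2 + 2 * K * Q y * dir_deriv b (dir_deriv b Q) y + 2 * e)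
        = - 24 * (norm (y - x0))\<^sup>2 * (w y)\<^sup>2 - 4 * DIM('a) * E y * (w y)\<^sup>2
          + 2 * K * (\<Sum>b\<in>Basis. (dir_deriv b Q y)\<^sup>2) + 2 * DIM('a) * e"
      proof -
        have n: "(norm (y - x0))\<^sup>2 = (\<Sum>b\<in>Basis. ((y - x0) \<bullet> b)\<^sup>2)"
          by (rule norm_sq_Basis)
        show ?thesis
          unfolding n sum.distrib sum_subtractf sum_distrib_left[symmetric] sum_distrib_right[symmetric]
            lap by simp
      qed
      finally have "24 * (norm (y - x0))\<^sup>2 * (w y)\<^sup>2 + 4 * DIM('a) * E y * (w y)\<^sup>2
          \<ge> 2 * K * (\<Sum>b\<in>Basis. (dir_deriv b Q y)\<^sup>2) + 2 * DIM('a) * e" by linarith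
      \<comment> \<open>The gradient term produced by K Q^2 absorbs the negative terms: w is a
        derivative in a direction of length at most 1, hence bounded by the gradient.\<close>
      moreover have "2 * K * (\<Sum>b\<in>Basis. (dir_deriv b Q y)\<^sup>2) \<ge> 2 * K * (w y)\<^sup>2"
        unfolding w_def using K0 by (intro mult_left_mono dir_deriv_sq_le smooth_on_differentiable[OF smQ yS] v) auto
      moreover have "24 * (norm (y - x0))\<^sup>2 * (w y)\<^sup>2 \<le> 24 * r\<^sup>2 * (w y)\<^sup>2"
        using yr by (intro mult_right_mono mult_left_mono power_mono) (auto simp: dist_norm norm_minus_commute)
      moreover have "4 * DIM('a) * E y * (w y)\<^sup>2 \<le> 4 * DIM('a) * r\<^sup>2 * (w y)\<^sup>2"
        by (intro mult_right_mono mult_left_mono) (auto simp: E_def)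
      moreover have "24 * r\<^sup>2 * (w y)\<^sup>2 + 4 * DIM('a) * r\<^sup>2 * (w y)\<^sup>2 = 2 * K * (w y)\<^sup>2"
        by (simp add: K_def algebra_simps)
      moreover have "2 * DIM('a) * e > 0" using e by simp
      ultimately show False by linarith
    qed
    then have "E y = 0" by (simp add: E_def dist_norm norm_minus_commute)
    then have "F y = K * (Q y)\<^sup>2 + e * r\<^sup>2" by (simp add: F_def)
    also have "(Q y)\<^sup>2 \<le> M\<^sup>2" using M[OF y(1)] by (metis abs_ge_zero power2_abs power_mono)
    finally have "F y \<le> K * M\<^sup>2 + e * r\<^sup>2" using K0 by simp
    moreover have "r ^ 4 * (w x0)\<^sup>2 \<le> F x0"
      using K0 by (simp add: F_def E_def power_mult_distrib flip: power_mult)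
    ultimately show ?thesis using y(2)[of x0] r by force
  qed
  have "r ^ 4 * (w x0)\<^sup>2 \<le> K * M\<^sup>2"
  proof (rule field_le_epsilon)
    fix e :: real assume "e > 0"
    then show "r ^ 4 * (w x0)\<^sup>2 \<le> K * M\<^sup>2 + e" using main[of "e / r\<^sup>2"] r by simp
  qed
  then have "(r * w x0)\<^sup>2 * r\<^sup>2 \<le> (sqrt (12 + 2 * real DIM('a)) * M)\<^sup>2 * r\<^sup>2"
    by (simp add: K_def power_mult_distrib algebra_simps flip: power_add)
  then have "(r * w x0)\<^sup>2 \<le> (sqrt (12 + 2 * real DIM('a)) * M)\<^sup>2" using r by simp
  then have "\<bar>r * w x0\<bar> \<le> \<bar>sqrt (12 + 2 * real DIM('a)) * M\<bar>" by (simp only: abs_le_square_iff)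
  then show ?thesis using r M0 by (simp add: w_def abs_mult field_simps)
qed

section \<open>Analyticity and unique continuation\<close>

abbreviation iter_deriv :: "'a::euclidean_space \<Rightarrow> nat \<Rightarrow> ('a \<Rightarrow> real) \<Rightarrow> 'a \<Rightarrow> real" where
  "iter_deriv v n Q \<equiv> ((\<lambda>f. dir_deriv v f) ^^ n) Q"

lemma harmonic_on_iter_deriv:
  "open S \<Longrightarrow> harmonic_on S Q \<Longrightarrow> harmonic_on S (iter_deriv v n Q)"
  by (induction n) (auto intro: harmonic_on_dir_deriv)

text \<open>Each derivative costs one gradient bound on a ball of radius \<rho>, so n of them use up
  the distance n \<rho>. For \<rho> proportional to 1 / n this is the n^n growth typical of analytic
  functions.\<close>

lemma iter_deriv_estimate:
  fixes Q :: "'a::euclidean_space \<Rightarrow> real"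
  assumes S: "open S" "cball x0 r \<subseteq> S" and \<rho>: "\<rho> > 0" and Q: "harmonic_on S Q"
    and M: "\<And>x. x \<in> cball x0 r \<Longrightarrow> \<bar>Q x\<bar> \<le> M" and v: "norm v \<le> 1"
    and x: "dist x0 x + real n * \<rho> \<le> r"
  shows "\<bar>iter_deriv v n Q x\<bar> \<le> (sqrt (12 + 2 * real DIM('a)) / \<rho>) ^ n * M"
  using x
proof (induction n arbitrary: x)
  case 0
  then show ?case using M[of x] by simp
next
  case (Suc n)
  have near: "dist x0 y + real n * \<rho> \<le> r" if "y \<in> cball x \<rho>" for y
    using that Suc.prems dist_triangle[of x0 y x] by (simp add: algebra_simps)
  have sub: "cball x \<rho> \<subseteq> S"
  proof
    fix y assume "y \<in> cball x \<rho>"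
    moreover have "0 \<le> real n * \<rho>" using \<rho> by simp
    ultimately have "y \<in> cball x0 r" using near[of y] unfolding mem_cball by linarith
    then show "y \<in> S" using S(2) by blast
  qed
  have "\<bar>dir_deriv v (iter_deriv v n Q) x\<bar>
      \<le> sqrt (12 + 2 * real DIM('a)) / \<rho> * ((sqrt (12 + 2 * real DIM('a)) / \<rho>) ^ n * M)"
    by (rule gradient_estimate[OF S(1) sub \<rho> harmonic_on_iter_deriv[OF S(1) Q] _ v])
      (rule Suc.IH[OF near])
  then show ?case by simp
qed

text \<open>A crude Stirling bound: n^n / n! is one term of the series of exp n.\<close>

lemma power_self_le_fact: "real n ^ n \<le> 3 ^ n * fact n"
proof -
  have "real n ^ n / fact n \<le> (\<Sum>k<Suc n. real n ^ k / fact k)"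
    by (intro member_le_sum[where f="\<lambda>k. real n ^ k / fact k"]) auto
  also have "\<dots> \<le> exp (real n)"
    using sum_le_suminf[OF summable_exp_generic, of "{..<Suc n}" "real n"]
    by (simp add: exp_def divide_inverse mult.commute)
  also have "\<dots> = exp 1 ^ n" by (simp flip: exp_of_nat_mult)
  also have "\<dots> \<le> 3 ^ n" using exp_le by (intro power_mono) auto
  finally show ?thesis by (simp add: field_simps)
qed

text \<open>All Taylor coefficients along the line vanish, so Q equals each remainder, which for
  \<rho> = r / n is at most (3 t C / r)^n M. The 3 comes from n^n \<le> 3^n n!, and the 6 in the
  hypothesis makes the ratio at most 1 / 2. The radius 2 r leaves r for the segment and r for the n
  steps.\<close>

lemma harmonic_vanish_line:
  fixes Q :: "'a::euclidean_space \<Rightarrow> real"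
  assumes S: "open S" "cball x0 (2 * r) \<subseteq> S" and r: "r > 0" and Q: "harmonic_on S Q"
    and v: "norm v \<le> 1" and zero: "\<And>n. iter_deriv v n Q x0 = 0"
    and t: "0 \<le> t" "t \<le> r / (6 * sqrt (12 + 2 * real DIM('a)))"
  shows "Q (x0 + t *\<^sub>R v) = 0"
proof (cases "t = 0")
  case True
  then show ?thesis using zero[of 0] by simp
next
  case False
  with t have t0: "t > 0" by simp
  define C where "C = sqrt (12 + 2 * real DIM('a))"
  have C: "C \<ge> 1" by (simp add: C_def)
  have "t \<le> r / (6 * C)" using t(2) by (simp add: C_def)
  then have tC: "3 * t * C / r \<le> 1 / 2" using C r by (simp add: field_simps)
  have tr: "t \<le> r"
  proof -
    have "r / (6 * C) \<le> r / 1" using C r by (intro divide_left_mono) auto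
    then show ?thesis using t(2) by (simp add: C_def)
  qed
  have smQ: "smooth_on S Q" using Q by (simp add: harmonic_on_def)
  have "bounded (Q ` cball x0 (2 * r))"
    using smooth_on_continuous[OF smQ] S(2)
    by (intro compact_imp_bounded compact_continuous_image compact_cball) (rule continuous_on_subset)
  then obtain M where M: "\<And>x. x \<in> cball x0 (2 * r) \<Longrightarrow> \<bar>Q x\<bar> \<le> M"
    unfolding bounded_iff by (metis image_eqI real_norm_def)
  have M0: "M \<ge> 0" using M[of x0] r by (smt (verit) centre_in_cball)
  have in_ball: "dist x0 (x0 + s *\<^sub>R v) \<le> r" if "0 \<le> s" "s \<le> t" for s
  proof -
    have "dist x0 (x0 + s *\<^sub>R v) = s * norm v" using that by (simp add: dist_norm)
    also have "\<dots> \<le> s * 1" using that v by (intro mult_left_mono) auto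
    finally show ?thesis using that tr by simp
  qed
  have bound: "\<bar>Q (x0 + t *\<^sub>R v)\<bar> \<le> (1 / 2) ^ n * M" if n: "n > 0" for n
  proof -
    have "\<exists>s. 0 < s \<and> s < t \<and> Q (x0 + t *\<^sub>R v)
      = (\<Sum>m<n. iter_deriv v m Q (x0 + 0 *\<^sub>R v) / fact m * t ^ m) + iter_deriv v n Q (x0 + s *\<^sub>R v) / fact n * t ^ n"
    proof (rule Maclaurin[OF t0 n])
      show "\<forall>m s. m < n \<and> 0 \<le> s \<and> s \<le> t \<longrightarrow>
        ((\<lambda>s. iter_deriv v m Q (x0 + s *\<^sub>R v)) has_real_derivative iter_deriv v (Suc m) Q (x0 + s *\<^sub>R v)) (at s)"
      proof safe
        fix m s assume s: "0 \<le> s" "s \<le> t"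
        have "x0 + s *\<^sub>R v \<in> S" using in_ball[OF s] r S(2) by (auto simp: subset_iff)
        then have "iter_deriv v m Q differentiable (at (x0 + s *\<^sub>R v))"
          by (rule smooth_on_differentiable[OF harmonic_on_smooth[OF harmonic_on_iter_deriv[OF S(1) Q]]])
        then show "((\<lambda>s. iter_deriv v m Q (x0 + s *\<^sub>R v)) has_real_derivative iter_deriv v (Suc m) Q (x0 + s *\<^sub>R v)) (at s)"
          using has_real_derivative_line by simp
      qed
    qed simp
    then obtain s where s: "0 < s" "s < t"
      "Q (x0 + t *\<^sub>R v) = iter_deriv v n Q (x0 + s *\<^sub>R v) / fact n * t ^ n"
      using zero by auto
    have "\<bar>iter_deriv v n Q (x0 + s *\<^sub>R v)\<bar> \<le> (C / (r / n)) ^ n * M"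
      unfolding C_def using in_ball[of s] s n r
      by (intro iter_deriv_estimate[OF S(1,2) _ Q M v]) auto
    then have "\<bar>Q (x0 + t *\<^sub>R v)\<bar> \<le> (C / (r / n)) ^ n * M / fact n * t ^ n"
      unfolding s(3) using t0 by (auto simp: abs_mult intro!: mult_right_mono divide_right_mono)
    also have "\<dots> = (t * C / r) ^ n * M * (real n ^ n / fact n)"
      by (simp add: power_mult_distrib power_divide)
    also have "\<dots> \<le> (t * C / r) ^ n * M * 3 ^ n"
      using power_self_le_fact[of n] M0 t0 C r
      by (intro mult_left_mono mult_nonneg_nonneg zero_le_power divide_nonneg_nonneg) (auto simp: field_simps)
    also have "\<dots> = (3 * t * C / r) ^ n * M" by (simp add: power_mult_distrib power_divide)
    also have "\<dots> \<le> (1 / 2) ^ n * M"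
      using tC t0 C r M0 by (intro mult_right_mono power_mono) auto
    finally show ?thesis .
  qed
  have "\<bar>Q (x0 + t *\<^sub>R v)\<bar> \<le> 0"
  proof (rule tendsto_lowerbound)
    have "(\<lambda>n. (1 / 2) ^ n * M) \<longlonglongrightarrow> 0 * M"
      by (intro tendsto_mult_right LIMSEQ_power_zero) simp
    then show "(\<lambda>n. (1 / 2) ^ n * M) \<longlonglongrightarrow> 0" by simp
    show "eventually (\<lambda>n. \<bar>Q (x0 + t *\<^sub>R v)\<bar> \<le> (1 / 2) ^ n * M) sequentially"
      using eventually_gt_at_top[of 0] by eventually_elim (rule bound)
  qed simp
  then show ?thesis by simp
qed

text \<open>A dense set of directions suffices: if Q were nonzero somewhere on the ball, the open
  set of v with Q (x0 + e v) \<noteq> 0 would contain one of them. A countable D later keeps the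
  exceptional set null.\<close>

lemma harmonic_vanish_ball:
  fixes Q :: "'a::euclidean_space \<Rightarrow> real"
  assumes S: "open S" "x0 \<in> S" and Q: "harmonic_on S Q"
    and D: "\<And>X. open X \<Longrightarrow> X \<noteq> {} \<Longrightarrow> \<exists>v\<in>D. v \<in> X"
    and zero: "\<And>n v. v \<in> D \<Longrightarrow> iter_deriv v n Q x0 = 0"
  shows "\<exists>e>0. \<forall>x\<in>ball x0 e. x \<in> S \<and> Q x = 0"
proof -
  obtain r' where r': "r' > 0" "cball x0 r' \<subseteq> S" using S open_contains_cball by blast
  define r where "r = r' / 2"
  have r: "r > 0" "cball x0 (2 * r) \<subseteq> S" using r' by (auto simp: r_def)
  define e where "e = r / (6 * sqrt (12 + 2 * real DIM('a)))"
  have e: "e > 0" using r by (simp add: e_def)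
  have er: "e \<le> r"
  proof -
    have "sqrt (12 + 2 * real DIM('a)) \<ge> 1" by simp
    then have "6 * sqrt (12 + 2 * real DIM('a)) \<ge> 1" by linarith
    then have "r / (6 * sqrt (12 + 2 * real DIM('a))) \<le> r / 1" using r by (intro divide_left_mono) auto
    then show ?thesis by (simp add: e_def)
  qed
  have sub: "ball x0 e \<subseteq> S" using er r by (force simp: subset_iff)
  have "open {x \<in> ball x0 e. Q x \<noteq> 0}"
  proof -
    have "continuous_on (ball x0 e) Q"
      using sub Q smooth_on_continuous by (auto simp: harmonic_on_def intro: continuous_on_subset)
    then have "open (ball x0 e \<inter> Q -` (- {0}))"
      by (intro continuous_open_preimage) auto
    then show ?thesis by (simp add: Int_def vimage_def)
  qed
  moreover have "{x \<in> ball x0 e. Q x \<noteq> 0} = {}"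
  proof (rule ccontr)
    let ?X = "{x \<in> ball x0 e. Q x \<noteq> 0}"
    assume ne: "?X \<noteq> {}"
    have "open ((\<lambda>v. x0 + e *\<^sub>R v) -` ?X)"
      using \<open>open ?X\<close> by (intro open_vimage continuous_intros)
    moreover obtain x where x: "x \<in> ?X" using ne by blast
    moreover have "(1 / e) *\<^sub>R (x - x0) \<in> (\<lambda>v. x0 + e *\<^sub>R v) -` ?X"
      using x e by simp
    ultimately obtain v where v: "v \<in> D" "x0 + e *\<^sub>R v \<in> ?X" using D by blast
    have "e * norm v < e" using v(2) e by (simp add: dist_norm)
    then have "norm v \<le> 1" using e by simp
    then have "Q (x0 + e *\<^sub>R v) = 0"
      using e zero[OF v(1)] by (intro harmonic_vanish_line[OF S(1) r(2,1) Q]) (auto simp: e_def)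
    then show False using v(2) by simp
  qed
  ultimately show ?thesis using e sub by blast
qed

lemma iter_deriv_zero_open:
  assumes "open W" "x \<in> W" "\<And>y. y \<in> W \<Longrightarrow> Q y = 0"
  shows "iter_deriv v n Q x = 0"
  using assms(2)
proof (induction n arbitrary: x)
  case (Suc n)
  have "dir_deriv v (iter_deriv v n Q) x = dir_deriv v (\<lambda>_. 0) x"
    by (rule dir_deriv_cong[OF assms(1) Suc.prems Suc.IH])
  then show ?case by simp
qed (use assms in simp)

text \<open>The interior of the zero set is also closed in S: at a limit point all iterated
  derivatives vanish by continuity, so Q vanishes on a ball around it.\<close>

lemma harmonic_unique_continuation:
  fixes Q :: "'a::euclidean_space \<Rightarrow> real"
  assumes S: "open S" "connected S" and Q: "harmonic_on S Q"
    and W: "open W" "W \<noteq> {}" "W \<subseteq> S" "\<And>x. x \<in> W \<Longrightarrow> Q x = 0"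
    and x: "x \<in> S"
  shows "Q x = 0"
proof -
  define V where "V = interior {x \<in> S. Q x = 0}"
  have VS: "V \<subseteq> S" and V0: "\<And>y. y \<in> V \<Longrightarrow> Q y = 0"
    using interior_subset[of "{x \<in> S. Q x = 0}"] by (auto simp: V_def)
  have "W \<subseteq> V" unfolding V_def using W by (intro interior_maximal) auto
  then have "V \<noteq> {}" using W(2) by blast
  have "openin (top_of_set S) V" using VS by (simp add: open_openin_trans V_def S(1) openin_open_eq)
  moreover have "closedin (top_of_set S) V"
  proof -
    have "y \<in> V" if y: "y \<in> S" "y \<in> closure V" for y
    proof -
      have "iter_deriv v n Q y = 0" for v n
      proof -
        have c: "continuous_on S (iter_deriv v n Q)"
          using harmonic_on_smooth[OF harmonic_on_iter_deriv[OF S(1) Q]] by (rule smooth_on_continuous)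
        obtain s where s: "\<And>k. s k \<in> V" "s \<longlonglongrightarrow> y"
          using y(2) unfolding closure_sequential by auto
        have "(\<lambda>k. iter_deriv v n Q (s k)) \<longlonglongrightarrow> iter_deriv v n Q y"
          using s(1) VS by (intro continuous_on_tendsto_compose[OF c s(2) y(1)]) (auto intro: always_eventually)
        moreover have "iter_deriv v n Q (s k) = 0" for k
          using V0 s(1) by (intro iter_deriv_zero_open[of V]) (auto simp: V_def)
        ultimately show ?thesis by (simp add: LIMSEQ_const_iff)
      qed
      then obtain e where "e > 0" "\<forall>x\<in>ball y e. x \<in> S \<and> Q x = 0"
        using harmonic_vanish_ball[OF S(1) y(1) Q, of UNIV] by blast
      then show ?thesis unfolding V_def by (intro interiorI[of "ball y e"]) auto
    qed
    then have "V = S \<inter> closure V" using VS closure_subset[of V] by auto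
    then show ?thesis using closedin_closed_Int[OF closed_closure] by metis
  qed
  ultimately have "V = S" using S(2) \<open>V \<noteq> {}\<close> unfolding connected_clopen by blast
  then show ?thesis using V0 x by blast
qed

text \<open>Almost every zero is a zero of infinite order in countably many directions, because at any
  other zero some iterated derivative has a simple zero. A zero of infinite order is excluded by
  analyticity, i.e. by the factorial growth of the derivatives.\<close>

theorem harmonic_zeros_null:
  fixes Q :: "'a::euclidean_space \<Rightarrow> real"
  assumes S: "open S" "connected S" and Q: "harmonic_on S Q" and ne: "\<exists>x\<in>S. Q x \<noteq> 0"
  shows "AE x in lborel. x \<in> S \<longrightarrow> Q x \<noteq> 0"
proof -
  obtain D :: "'a set" where D: "countable D" "\<And>X. open X \<Longrightarrow> X \<noteq> {} \<Longrightarrow> \<exists>d\<in>D. d \<in> X"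
    by (rule countable_dense_setE) blast
  \<comment> \<open>Zeros of the nth derivative along v that are simple along v. Off all these sets
    the vanishing of one iterated derivative passes to the next.\<close>
  define Z where "Z v n = {x \<in> S. iter_deriv v n Q x = 0 \<and> dir_deriv v (iter_deriv v n Q) x \<noteq> 0}" for v n
  have "Z v n \<in> null_sets lborel" for v n
    unfolding Z_def
    by (intro simple_zeros_null S smooth_onD[OF harmonic_on_smooth[OF harmonic_on_iter_deriv[OF S(1) Q]]])
  then have "(\<Union>v\<in>D. \<Union>n. Z v n) \<in> null_sets lborel"
    using D(1) by (intro null_sets_UN') auto
  then have "AE x in lborel. x \<notin> (\<Union>v\<in>D. \<Union>n. Z v n)" by (rule AE_not_in)
  then show ?thesis
  proof eventually_elim
    case (elim x)
    show ?case
    proof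
      assume x: "x \<in> S"
      show "Q x \<noteq> 0"
      proof
        assume Qx: "Q x = 0"
        have "iter_deriv v n Q x = 0" if "v \<in> D" for v n
        proof (induction n)
          case (Suc n)
          then show ?case using elim that x by (auto simp: Z_def)
        qed (use Qx in simp)
        then obtain e where e: "e > 0" "\<And>y. y \<in> ball x e \<Longrightarrow> y \<in> S \<and> Q y = 0"
          using harmonic_vanish_ball[OF S(1) x Q D(2)] by blast
        have "Q y = 0" if "y \<in> S" for y
        proof (rule harmonic_unique_continuation[OF S Q _ _ _ _ that])
          show "ball x e \<noteq> {}" using e(1) by simp
          show "ball x e \<subseteq> S" using e(2) by blast
        qed (use e(2) in auto)
        then show False using ne by blast
      qed
    qed
  qed
qed

section \<open>Spherical eigenfunctions\<close>

lemma open_punctured: "open (- {0::'a::euclidean_space})"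
  by auto

section \<open>Homogeneous functions and the spherical Laplacian\<close>

lemma euler_homogeneous:
  fixes g :: "'a::euclidean_space \<Rightarrow> real"
  assumes diff: "g differentiable (at x)" and hom: "\<And>t. t > 0 \<Longrightarrow> g (t *\<^sub>R x) = t powr d * g x"
  shows "dir_deriv x g x = d * g x"
proof -
  have "((\<lambda>t. g (0 + t *\<^sub>R x)) has_real_derivative dir_deriv x g (0 + 1 *\<^sub>R x)) (at 1)"
    by (rule has_real_derivative_line) (use diff in simp)
  moreover have "((\<lambda>t. g (0 + t *\<^sub>R x)) has_real_derivative d * g x) (at 1)"
  proof (rule has_field_derivative_transform_within_open)
    show "((\<lambda>t. t powr d * g x) has_real_derivative d * g x) (at 1)"
      by (auto intro!: derivative_eq_intros)
    show "t powr d * g x = g (0 + t *\<^sub>R x)" if "t \<in> {0<..}" for t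
      using hom that by simp
  qed auto
  ultimately show ?thesis using DERIV_unique by fastforce
qed

lemma laplacian_cong:
  assumes "open S" "x \<in> S" "\<And>y. y \<in> S \<Longrightarrow> f y = g y"
  shows "laplacian f x = laplacian g x"
  unfolding laplacian_def
  by (intro sum.cong refl dir_deriv_cong[OF assms(1,2)]) (rule dir_deriv_cong[OF assms(1) _ assms(3)])

text \<open>The cross term of the product rule is 2 s |x|^(s - 2) times the radial derivative of g,
  which \<open>euler\<close> turns into a multiple of g. The case d = 0 serves
  \<open>P \<circ> sgn\<close>, the case d = l a homogeneous polynomial.\<close>

lemma laplacian_norm_powr_mult:
  fixes g :: "'a::euclidean_space \<Rightarrow> real"
  assumes g: "smooth_on (- {0}) g" and x: "x \<noteq> 0" and euler: "dir_deriv x g x = d * g x"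
  shows "laplacian (\<lambda>x. norm x powr s * g x) x
    = norm x powr s * laplacian g x + s * (s + DIM('a) - 2 + 2 * d) * norm x powr (s - 2) * g x"
proof -
  note op = open_punctured
  have dp: "(\<lambda>x. norm x powr s) differentiable (at y)"
    "dir_deriv b (\<lambda>x. norm x powr s) y = s * (y \<bullet> b) * norm y powr (s - 2)"
    if "y \<noteq> 0" for y b :: 'a and s
    using has_derivative_norm_powr[OF that] dir_deriv_eq[OF has_derivative_norm_powr[OF that]]
    by (auto simp: differentiable_def)
  have dg: "g differentiable (at y)" "dir_deriv b g differentiable (at y)" if "y \<noteq> 0" for y b
    using that g smooth_on_dir_deriv by (auto intro: smooth_on_differentiable)
  have di: "(\<lambda>x. x \<bullet> b) differentiable (at y)" "dir_deriv b (\<lambda>x. x \<bullet> b) y = b \<bullet> b" for y b :: 'a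
  proof -
    have "((\<lambda>x. x \<bullet> b) has_derivative (\<lambda>v. v \<bullet> b)) (at y)" by (auto intro!: derivative_eq_intros)
    then show "(\<lambda>x. x \<bullet> b) differentiable (at y)" "dir_deriv b (\<lambda>x. x \<bullet> b) y = b \<bullet> b"
      using dir_deriv_eq by (auto simp: differentiable_def)
  qed
  have second: "dir_deriv b (dir_deriv b (\<lambda>x. norm x powr s * g x)) x
    = norm x powr s * dir_deriv b (dir_deriv b g) x
      + 2 * s * norm x powr (s - 2) * ((x \<bullet> b) * dir_deriv b g x)
      + s * norm x powr (s - 2) * g x
      + s * (s - 2) * norm x powr (s - 4) * g x * (x \<bullet> b)\<^sup>2" if b: "b \<in> Basis" for b
  proof -
    have "dir_deriv b (dir_deriv b (\<lambda>x. norm x powr s * g x)) x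
        = dir_deriv b (\<lambda>x. norm x powr s * dir_deriv b g x
            + (s * ((x \<bullet> b) * norm x powr (s - 2))) * g x) x"
      by (rule dir_deriv_cong[OF op]) (use x dp dg in \<open>auto simp: dir_deriv_mult\<close>)
    also have "\<dots> = dir_deriv b (\<lambda>x. norm x powr s * dir_deriv b g x) x
      + dir_deriv b (\<lambda>x. (s * ((x \<bullet> b) * norm x powr (s - 2))) * g x) x"
      using x dp dg di by (intro dir_deriv_add differentiable_mult differentiable_const) auto
    also have "dir_deriv b (\<lambda>x. norm x powr s * dir_deriv b g x) x
      = norm x powr s * dir_deriv b (dir_deriv b g) x + s * (x \<bullet> b) * norm x powr (s - 2) * dir_deriv b g x"
      using x dp dg by (subst dir_deriv_mult) auto
    also have "dir_deriv b (\<lambda>x. (s * ((x \<bullet> b) * norm x powr (s - 2))) * g x) x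
      = (s * ((x \<bullet> b) * norm x powr (s - 2))) * dir_deriv b g x
        + dir_deriv b (\<lambda>x. s * ((x \<bullet> b) * norm x powr (s - 2))) x * g x"
      using x dp dg di by (intro dir_deriv_mult differentiable_mult differentiable_const) auto
    also have "dir_deriv b (\<lambda>x. s * ((x \<bullet> b) * norm x powr (s - 2))) x
      = s * dir_deriv b (\<lambda>x. (x \<bullet> b) * norm x powr (s - 2)) x"
      using x dp di by (subst dir_deriv_mult) (auto intro!: differentiable_mult)
    also have "dir_deriv b (\<lambda>x. (x \<bullet> b) * norm x powr (s - 2)) x
      = (x \<bullet> b) * ((s - 2) * (x \<bullet> b) * norm x powr (s - 4)) + norm x powr (s - 2)"
      using x dp di b by (subst dir_deriv_mult) auto
    finally show ?thesis by (simp add: algebra_simps power2_eq_square)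
  qed
  have n: "norm x powr (s - 4) * (norm x)\<^sup>2 = norm x powr (s - 2)"
    using x powr_add[of "norm x" "s - 4" 2] by simp
  have "laplacian (\<lambda>x. norm x powr s * g x) x
    = norm x powr s * laplacian g x + 2 * s * norm x powr (s - 2) * (\<Sum>b\<in>Basis. (x \<bullet> b) * dir_deriv b g x)
      + DIM('a) * (s * norm x powr (s - 2) * g x)
      + s * (s - 2) * norm x powr (s - 4) * g x * (\<Sum>b\<in>Basis. (x \<bullet> b)\<^sup>2)"
    unfolding laplacian_def by (simp add: second sum.distrib sum_distrib_left)
  also have "(\<Sum>b\<in>Basis. (x \<bullet> b) * dir_deriv b g x) = d * g x"
    using dir_deriv_Basis[OF dg(1)[OF x], of x] euler by simp
  also have "s * (s - 2) * norm x powr (s - 4) * g x * (\<Sum>b\<in>Basis. (x \<bullet> b)\<^sup>2)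
    = s * (s - 2) * g x * (norm x powr (s - 4) * (norm x)\<^sup>2)"
    by (simp add: norm_sq_Basis)
  finally show ?thesis unfolding n by (simp add: algebra_simps)
qed

text \<open>Off the origin \<open>sphere_grad P \<circ> sgn\<close> is |y| \<nabla>f(y) with f =
  \<open>P \<circ> sgn\<close>, because \<nabla>f is homogeneous of degree -1. At \<omega> its
  divergence is \<Delta>f plus the radial derivative of f, and the latter is 0.\<close>

lemma laplace_beltrami_eq:
  fixes P :: "'a::euclidean_space \<Rightarrow> real"
  assumes f: "smooth_on (- {0}) (P \<circ> sgn)" and w: "\<omega> \<in> sphere 0 1"
  shows "laplace_beltrami P \<omega> = laplacian (P \<circ> sgn) \<omega>"
proof -
  note op = open_punctured
  define f where "f = P \<circ> sgn"
  have smf: "smooth_on (- {0}) f" using f by (simp add: f_def)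
  have hom: "f (t *\<^sub>R x) = f x" if "t > 0" for t x
    using that by (simp add: f_def sgn_scaleR)
  have diff: "f differentiable (at y)" "dir_deriv b f differentiable (at y)" if "y \<noteq> 0" for y b
    using that smf smooth_on_dir_deriv by (auto intro: smooth_on_differentiable)
  have w0: "\<omega> \<noteq> 0" "norm \<omega> = 1" using w by auto
  have grad: "dir_deriv b f (sgn y) = norm y * dir_deriv b f y" if y: "y \<noteq> 0" for b y
  proof -
    define t where "t = 1 / norm y"
    have t: "t > 0" "sgn y = t *\<^sub>R y" using y by (auto simp: t_def sgn_div_norm inverse_eq_divide)
    have "dir_deriv b f y = dir_deriv b (\<lambda>x. f (t *\<^sub>R x)) y" using hom[OF t(1)] by simp
    also have "\<dots> = t * dir_deriv b f (t *\<^sub>R y)"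
      using dir_deriv_eq[OF dir_deriv_scale[OF diff(1)]] t y by simp
    finally show ?thesis using t y by (simp add: t_def)
  qed
  have norm_diff: "(\<lambda>y. norm y) differentiable (at \<omega>)" "dir_deriv b norm \<omega> = \<omega> \<bullet> b" for b
    using has_derivative_norm[OF w0(1)] dir_deriv_eq[OF has_derivative_norm[OF w0(1)]] w0
    by (auto simp: differentiable_def sgn_div_norm inner_commute)
  have "dir_deriv b (sphere_grad P \<circ> sgn) \<omega> \<bullet> b = (\<omega> \<bullet> b) * dir_deriv b f \<omega> + dir_deriv b (dir_deriv b f) \<omega>"
    if b: "b \<in> Basis" for b
  proof -
    have "dir_deriv b (sphere_grad P \<circ> sgn) \<omega> = dir_deriv b (\<lambda>y. \<Sum>c\<in>Basis. (norm y * dir_deriv c f y) *\<^sub>R c) \<omega>"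
    proof (rule dir_deriv_cong[OF op])
      fix y :: 'a assume "y \<in> - {0}"
      then show "(sphere_grad P \<circ> sgn) y = (\<Sum>c\<in>Basis. (norm y * dir_deriv c f y) *\<^sub>R c)"
        using grad by (simp add: sphere_grad_def f_def[symmetric])
    qed (use w0 in simp)
    also have "\<dots> = (\<Sum>c\<in>Basis. (norm \<omega> * dir_deriv b (dir_deriv c f) \<omega> + (\<omega> \<bullet> b) * dir_deriv c f \<omega>) *\<^sub>R c)"
    proof -
      have "((\<lambda>y. norm y * dir_deriv c f y) has_derivative
        (\<lambda>v. dir_deriv v (\<lambda>y. norm y * dir_deriv c f y) \<omega>)) (at \<omega>)" for c
        using norm_diff diff w0 by (intro dir_deriv_works differentiable_mult) auto
      then have "((\<lambda>y. \<Sum>c\<in>Basis. (norm y * dir_deriv c f y) *\<^sub>R c) has_derivative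
        (\<lambda>v. \<Sum>c\<in>Basis. dir_deriv v (\<lambda>y. norm y * dir_deriv c f y) \<omega> *\<^sub>R c)) (at \<omega>)"
        by (intro has_derivative_sum has_derivative_scaleR_left)
      moreover have "dir_deriv b (\<lambda>y. norm y * dir_deriv c f y) \<omega>
          = norm \<omega> * dir_deriv b (dir_deriv c f) \<omega> + (\<omega> \<bullet> b) * dir_deriv c f \<omega>" for c
        using norm_diff diff w0 by (subst dir_deriv_mult) auto
      ultimately show ?thesis using dir_deriv_eq by fastforce
    qed
    finally show ?thesis using b w0(2)
      by (simp add: inner_sum_left inner_Basis if_distrib cong: if_cong)
  qed
  then have "laplace_beltrami P \<omega> = (\<Sum>b\<in>Basis. (\<omega> \<bullet> b) * dir_deriv b f \<omega>) + laplacian f \<omega>"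
    by (simp add: laplace_beltrami_def sphere_div_def laplacian_def sum.distrib)
  also have "(\<Sum>b\<in>Basis. (\<omega> \<bullet> b) * dir_deriv b f \<omega>) = 0"
    using dir_deriv_Basis[OF diff(1)[OF w0(1)], of \<omega>] euler_homogeneous[of f \<omega> 0] diff w0 hom by simp
  finally show ?thesis by (simp only: f_def add_0)
qed

text \<open>Both sides are homogeneous of degree -2, so the equation on the sphere suffices.\<close>

lemma sphere_eigenfunction_laplacian:
  fixes P :: "'a::euclidean_space \<Rightarrow> real"
  assumes P: "sphere_eigenfunction P \<mu>" and x: "x \<noteq> 0"
  shows "laplacian (P \<circ> sgn) x = - \<mu> / (norm x)\<^sup>2 * (P \<circ> sgn) x"
proof -
  define f where "f = P \<circ> sgn"
  have smf: "smooth_on (- {0}) f" using P by (simp add: f_def sphere_eigenfunction_def)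
  define t where "t = 1 / norm x"
  have t: "t > 0" "sgn x = t *\<^sub>R x" using x by (auto simp: t_def sgn_div_norm inverse_eq_divide)
  have s: "sgn x \<in> sphere 0 1" using x by (simp add: norm_sgn)
  have "laplacian f x = laplacian (\<lambda>x. f (t *\<^sub>R x)) x"
    using t(1) by (simp add: f_def o_def sgn_scaleR)
  also have "\<dots> = t\<^sup>2 * laplacian f (sgn x)"
    using laplacian_scale[OF open_punctured, of t x f] smooth_onD[OF smf] t x by simp
  also have "laplacian f (sgn x) = laplace_beltrami P (sgn x)"
    unfolding f_def using smf s by (intro laplace_beltrami_eq[symmetric]) (auto simp: f_def)
  also have "\<dots> = - \<mu> * f x"
    using P s unfolding sphere_eigenfunction_def f_def by force
  finally show ?thesis unfolding f_def[symmetric] t_def by (simp add: power_divide)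
qed

lemma laplacian_bounded_linear:
  assumes L: "bounded_linear L" and S: "open S" "x \<in> S" and f: "smooth_on S f"
  shows "laplacian (\<lambda>x. L (f x)) x = L (laplacian f x)"
proof -
  have d: "dir_deriv b (\<lambda>x. L (g x)) y = L (dir_deriv b g y)" if "smooth_on S g" "y \<in> S" for b g y
    using that by (intro dir_deriv_eq bounded_linear.has_derivative[OF L] dir_deriv_works
        smooth_on_differentiable)
  have "dir_deriv b (dir_deriv b (\<lambda>x. L (f x))) x = L (dir_deriv b (dir_deriv b f) x)" for b
  proof -
    have "dir_deriv b (dir_deriv b (\<lambda>x. L (f x))) x = dir_deriv b (\<lambda>x. L (dir_deriv b f x)) x"
      by (rule dir_deriv_cong[OF S]) (rule d[OF f])
    also have "\<dots> = L (dir_deriv b (dir_deriv b f) x)" by (intro d smooth_on_dir_deriv f S)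
    finally show ?thesis .
  qed
  then show ?thesis
    by (simp add: laplacian_def linear_sum[OF bounded_linear.linear[OF L]])
qed

lemma laplacian_add:
  assumes S: "open S" "x \<in> S" and f: "smooth_on S f" and g: "smooth_on S g"
  shows "laplacian (\<lambda>x. f x + g x) x = laplacian f x + laplacian g x"
proof -
  have "dir_deriv b (dir_deriv b (\<lambda>x. f x + g x)) x
      = dir_deriv b (dir_deriv b f) x + dir_deriv b (dir_deriv b g) x" for b
  proof -
    have "dir_deriv b (dir_deriv b (\<lambda>x. f x + g x)) x = dir_deriv b (\<lambda>x. dir_deriv b f x + dir_deriv b g x) x"
      by (rule dir_deriv_cong[OF S]) (intro dir_deriv_add smooth_on_differentiable[OF f] smooth_on_differentiable[OF g])
    also have "\<dots> = dir_deriv b (dir_deriv b f) x + dir_deriv b (dir_deriv b g) x"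
      by (intro dir_deriv_add smooth_on_differentiable[OF _ S(2)] smooth_on_dir_deriv f g)
    finally show ?thesis .
  qed
  then show ?thesis by (simp add: laplacian_def sum.distrib)
qed

section \<open>Existence of eigenfunctions of every degree\<close>

definition planar_power :: "'a::euclidean_space \<Rightarrow> 'a \<Rightarrow> nat \<Rightarrow> 'a \<Rightarrow> complex" where
  "planar_power a b l x = Complex (x \<bullet> a) (x \<bullet> b) ^ l"

lemma bounded_linear_planar: "bounded_linear (\<lambda>x. Complex (x \<bullet> a) (x \<bullet> b))"
proof -
  have "bounded_linear (\<lambda>x. of_real (x \<bullet> a) + \<i> * of_real (x \<bullet> b))"
    by (intro bounded_linear_add bounded_linear_const_mult bounded_linear_compose[OF bounded_linear_of_real]
        bounded_linear_inner_left)
  then show ?thesis by (simp add: Complex_eq)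
qed

lemma smooth_on_planar_power: "smooth_on UNIV (planar_power a b l)"
  unfolding planar_power_def[abs_def]
  by (intro smooth_on_power smooth_on_linear bounded_linear_planar) auto

text \<open>The second derivative of z^l in direction v carries the factor (z v)^2. Over the basis
  only v = a and v = b contribute, with 1 and \<i>^2.\<close>

lemma laplacian_planar_power:
  assumes ab: "a \<in> Basis" "b \<in> Basis" "a \<noteq> b"
  shows "laplacian (planar_power a b l) x = 0"
proof -
  define z where "z y = Complex (y \<bullet> a) (y \<bullet> b)" for y :: 'a
  have z: "bounded_linear z" unfolding z_def by (rule bounded_linear_planar)
  have d1: "dir_deriv v (\<lambda>y. c * z y ^ m) y = c * (of_nat m * z v * z y ^ (m - 1))" for v y m c
    by (rule dir_deriv_eq)
      (intro has_derivative_mult_right has_derivative_power bounded_linear_imp_has_derivative z)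
  have pp: "planar_power a b l = (\<lambda>y. 1 * z y ^ l)" by (auto simp: planar_power_def z_def)
  \<comment> \<open>The truncated exponent is harmless: for l < 2 the factor l (l - 1) is 0.\<close>
  have "dir_deriv v (dir_deriv v (planar_power a b l)) x
      = of_nat l * of_nat (l - 1) * z x ^ (l - 1 - 1) * (z v)\<^sup>2" for v
  proof -
    have "dir_deriv v (planar_power a b l) = (\<lambda>y. (of_nat l * z v) * z y ^ (l - 1))"
      unfolding pp by (rule ext) (subst d1, simp)
    then show ?thesis by (simp only: d1) (simp add: power2_eq_square)
  qed
  then have "laplacian (planar_power a b l) x
      = of_nat l * of_nat (l - 1) * z x ^ (l - 1 - 1) * (\<Sum>v\<in>Basis. (z v)\<^sup>2)"
    by (simp add: laplacian_def sum_distrib_left)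
  also have "(\<Sum>v\<in>Basis. (z v)\<^sup>2) = (\<Sum>v\<in>{a, b}. (z v)\<^sup>2)"
    using ab by (intro sum.mono_neutral_right) (auto simp: z_def inner_Basis complex_eq_iff)
  also have "\<dots> = 0"
    using ab by (simp add: z_def inner_Basis complex_eq_iff power2_eq_square)
  finally show ?thesis by simp
qed

lemma sphere_eigenfunction_exists:
  assumes dim: "DIM('a::euclidean_space) \<ge> 2"
  shows "\<exists>P :: 'a \<Rightarrow> real. sphere_eigenfunction P (sphere_eigenvalue DIM('a) l)"
proof -
  obtain a b :: 'a where ab: "a \<in> Basis" "b \<in> Basis" "a \<noteq> b"
  proof -
    obtain a :: 'a where a: "a \<in> Basis" using nonempty_Basis by blast
    have "\<not> Basis \<subseteq> {a}"
      using dim card_mono[of "{a}" Basis] by auto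
    then show thesis using that[OF a] by blast
  qed
  define P where "P x = Re (planar_power a b l x)" for x
  have smP: "smooth_on UNIV P"
    unfolding P_def[abs_def]
    by (rule smooth_on_bounded_linear[OF bounded_linear_Re open_UNIV smooth_on_planar_power])
  have lapP: "laplacian P x = 0" for x
    unfolding P_def[abs_def]
    by (subst laplacian_bounded_linear[OF bounded_linear_Re open_UNIV UNIV_I smooth_on_planar_power])
      (simp add: laplacian_planar_power[OF ab])
  have hom: "P (t *\<^sub>R x) = t ^ l * P x" for t x
  proof -
    have "planar_power a b l (t *\<^sub>R x) = of_real (t ^ l) * planar_power a b l x"
      by (simp add: planar_power_def Complex_eq algebra_simps flip: power_mult_distrib)
    then show ?thesis by (simp add: P_def del: of_real_power)
  qed
  have Psgn: "norm x powr (- real l) * P x = (P \<circ> sgn) x" if "x \<in> - {0}" for x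
    using that hom[of "inverse (norm x)" x]
    by (simp add: sgn_div_norm powr_minus powr_realpow power_inverse)
  have smf: "smooth_on (- {0}) (P \<circ> sgn)"
    by (rule smooth_on_cong[OF open_punctured _ Psgn])
      (intro smooth_on_mult smooth_on_norm_powr open_punctured smooth_on_subset[OF smP] subset_UNIV)
  have "- laplace_beltrami P \<omega> = sphere_eigenvalue DIM('a) l * P \<omega>" if w: "\<omega> \<in> sphere 0 1" for \<omega>
  proof -
    have w0: "\<omega> \<noteq> 0" "norm \<omega> = 1" using w by auto
    have "dir_deriv \<omega> P \<omega> = real l * P \<omega>"
      by (rule euler_homogeneous)
        (use hom smooth_on_differentiable[OF smP] in \<open>auto simp: powr_realpow\<close>)
    \<comment> \<open>Here s = - l and d = l, so s (s + N - 2 + 2 d) = - l (N - 2 + l), minus the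
      eigenvalue.\<close>
    then have "laplacian (\<lambda>x. norm x powr (- real l) * P x) \<omega>
      = norm \<omega> powr (- real l) * laplacian P \<omega>
        + (- real l) * (- real l + DIM('a) - 2 + 2 * real l) * norm \<omega> powr (- real l - 2) * P \<omega>"
      by (intro laplacian_norm_powr_mult smooth_on_subset[OF smP] subset_UNIV w0)
    moreover have "laplacian (P \<circ> sgn) \<omega> = laplacian (\<lambda>x. norm x powr (- real l) * P x) \<omega>"
      by (rule laplacian_cong[OF open_punctured]) (use w0 Psgn in auto)
    ultimately show ?thesis
      using laplace_beltrami_eq[OF smf w] w0 lapP by (simp add: sphere_eigenvalue_def algebra_simps)
  qed
  \<comment> \<open>At the basis vector a the planar coordinate is 1, hence P a = 1.\<close>
  moreover have "P a \<noteq> 0" "a \<in> sphere 0 1"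
    using ab by (auto simp: P_def planar_power_def inner_Basis Complex_eq_1)
  ultimately show ?thesis using smf unfolding sphere_eigenfunction_def by blast
qed

section \<open>The Schroedinger operator off the nodal cone\<close>

lemma Ck_on_Un:
  assumes "open S" "open T" "Ck_on n S f" "Ck_on n T f"
  shows "Ck_on n (S \<union> T) f"
  using assms(3,4)
  by (induction n arbitrary: f) (use assms(1,2) in \<open>auto intro: continuous_on_open_Un\<close>)

text \<open>A class in L2 has at most one continuous representative, which is why
  \<open>H_op\<close> is single-valued.\<close>

lemma AE_eq_continuous_imp_eq:
  fixes f g :: "'a::euclidean_space \<Rightarrow> complex"
  assumes "continuous_on UNIV f" "continuous_on UNIV g" "AE x in lborel. f x = g x"
  shows "f = g"
proof
  fix x
  have "closed {x. f x = g x}" using assms by (intro closed_Collect_eq)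
  moreover have "AE x in lebesgue. x \<in> {x. f x = g x}"
    using AE_completion[OF assms(3)] by simp
  ultimately have "x \<in> {x. f x = g x}" by (rule mem_closed_if_AE_lebesgue)
  then show "f x = g x" by simp
qed

lemma green_identity:
  fixes u g :: "'a::euclidean_space \<Rightarrow> complex"
  assumes u: "smooth_on UNIV u" and g: "smooth_on UNIV g"
    and K: "compact K" "\<And>x. x \<notin> K \<Longrightarrow> u x = 0"
  shows "(\<integral>x. laplacian u x * g x \<partial>lborel) = - (\<Sum>b\<in>Basis. \<integral>x. dir_deriv b u x * dir_deriv b g x \<partial>lborel)"
    and "(\<integral>x. u x * laplacian g x \<partial>lborel) = - (\<Sum>b\<in>Basis. \<integral>x. dir_deriv b u x * dir_deriv b g x \<partial>lborel)"
proof -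
  have sm: "smooth_on UNIV (dir_deriv b u)" "smooth_on UNIV (dir_deriv b g)"
    "smooth_on UNIV (dir_deriv b (dir_deriv b u))" "smooth_on UNIV (dir_deriv b (dir_deriv b g))" for b
    using u g by (intro smooth_on_dir_deriv; simp)+
  note c = u[THEN smooth_on_continuous] g[THEN smooth_on_continuous] sm[THEN smooth_on_continuous]
  note cl = compact_imp_closed[OF K(1)]
  have z1: "dir_deriv b u x = 0" if "x \<notin> K" for b x
    using dir_deriv_eq_0_outside[OF cl K(2) that] .
  have z2: "dir_deriv b (dir_deriv b u) x = 0" if "x \<notin> K" for b x
    using dir_deriv_eq_0_outside[OF cl z1 that] .
  have "integrable lborel (\<lambda>x. dir_deriv b (dir_deriv b u) x * g x)" for b
    by (rule integrable_compact_support[OF _ K(1)])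
      (use z2 in \<open>auto intro!: continuous_on_mult c\<close>)
  then have "(\<integral>x. laplacian u x * g x \<partial>lborel) = (\<Sum>b\<in>Basis. \<integral>x. dir_deriv b (dir_deriv b u) x * g x \<partial>lborel)"
    unfolding laplacian_def sum_distrib_right by (intro Bochner_Integration.integral_sum) auto
  also have "\<dots> = (\<Sum>b\<in>Basis. - (\<integral>x. dir_deriv b u x * dir_deriv b g x \<partial>lborel))"
    by (intro sum.cong refl integral_by_parts[OF smooth_onD[OF sm(1)] smooth_onD[OF g] K(1) z1])
  finally show "(\<integral>x. laplacian u x * g x \<partial>lborel) = - (\<Sum>b\<in>Basis. \<integral>x. dir_deriv b u x * dir_deriv b g x \<partial>lborel)"
    by (simp add: sum_negf)
  have "integrable lborel (\<lambda>x. u x * dir_deriv b (dir_deriv b g) x)" for b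
    by (rule integrable_compact_support[OF _ K(1)])
      (use K(2) in \<open>auto intro!: continuous_on_mult c\<close>)
  then have "(\<integral>x. u x * laplacian g x \<partial>lborel) = (\<Sum>b\<in>Basis. \<integral>x. u x * dir_deriv b (dir_deriv b g) x \<partial>lborel)"
    unfolding laplacian_def sum_distrib_left by (intro Bochner_Integration.integral_sum) auto
  also have "\<dots> = (\<Sum>b\<in>Basis. - (\<integral>x. dir_deriv b u x * dir_deriv b g x \<partial>lborel))"
    by (intro sum.cong refl)
      (simp add: integral_by_parts[OF smooth_onD[OF u] smooth_onD[OF sm(2)] K])
  finally show "(\<integral>x. u x * laplacian g x \<partial>lborel) = - (\<Sum>b\<in>Basis. \<integral>x. dir_deriv b u x * dir_deriv b g x \<partial>lborel)"
    by (simp add: sum_negf)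
qed

lemma Ck_on_1_inverse:
  fixes h :: "'a::euclidean_space \<Rightarrow> real"
  assumes S: "open S" and h: "Ck_on 1 S h" and nz: "\<And>x. x \<in> S \<Longrightarrow> h x \<noteq> 0"
  shows "Ck_on 1 S (\<lambda>x. inverse (h x))"
    and "x \<in> S \<Longrightarrow> dir_deriv v (\<lambda>x. inverse (h x)) x = - dir_deriv v h x / (h x)\<^sup>2"
proof -
  have der: "((\<lambda>x. inverse (h x)) has_derivative (\<lambda>v. - (inverse (h x) * dir_deriv v h x * inverse (h x)))) (at x)"
    if "x \<in> S" for x
    using that h nz by (intro Deriv.has_derivative_inverse dir_deriv_works) auto
  have "continuous_on S (dir_deriv v (\<lambda>x. inverse (h x)))" for v
  proof -
    have "continuous_on S (\<lambda>x. - (inverse (h x) * dir_deriv v h x * inverse (h x)))"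
      using h nz Ck_on_SucD[of 0 S h] by (auto intro!: continuous_intros)
    then show ?thesis
      by (rule continuous_on_eq) (use dir_deriv_eq[OF der] in simp)
  qed
  then show "Ck_on 1 S (\<lambda>x. inverse (h x))" using der by (auto simp: differentiable_def)
  show "x \<in> S \<Longrightarrow> dir_deriv v (\<lambda>x. inverse (h x)) x = - dir_deriv v h x / (h x)\<^sup>2"
    using dir_deriv_eq[OF der] by (simp add: divide_inverse power2_eq_square)
qed

definition schroedinger :: "real \<Rightarrow> ('a::euclidean_space \<Rightarrow> complex) \<Rightarrow> 'a \<Rightarrow> complex" where
  "schroedinger k u x = - laplacian u x + complex_of_real (k / (norm x)\<^sup>2) * u x"

lemma H_op_iff:
  "(a, b) \<in> H_op k P \<longleftrightarrow>
    (\<exists>u \<in> test_functions (- nodal_cone P). a = abs_L2 u \<and> b = abs_L2 (schroedinger k u))"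
  by (auto simp: H_op_def schroedinger_def[abs_def] Compl_eq_Diff_UNIV)

locale nodal_schroedinger =
  fixes k :: real and l :: nat and P :: "'a::euclidean_space \<Rightarrow> real"
  assumes dim: "DIM('a) \<ge> 2"
    and l: "sphere_eigenvalue DIM('a) l \<ge> - ((real DIM('a) - 2)\<^sup>2) / 4 - k"
    and P: "sphere_eigenfunction P (sphere_eigenvalue DIM('a) l)"
begin

section \<open>The complement of the nodal cone\<close>

abbreviation f where "f \<equiv> P \<circ> sgn"
abbreviation \<Omega> where "\<Omega> \<equiv> - nodal_cone P"
abbreviation T where "T \<equiv> H_op k P"

lemma smooth_f: "smooth_on (- {0}) f"
  using P by (simp add: sphere_eigenfunction_def)

lemma Omega_iff: "x \<in> \<Omega> \<longleftrightarrow> x \<noteq> 0 \<and> f x \<noteq> 0"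
proof -
  have "x \<in> nodal_cone P" if "x \<noteq> 0" "P (sgn x) = 0"
    unfolding nodal_cone_def
    using that by (auto intro!: exI[of _ "norm x"] bexI[of _ "sgn x"] simp: norm_sgn sgn_div_norm)
  moreover have "sgn (\<rho> *\<^sub>R \<omega>) = \<omega>" if "\<rho> > 0" "\<omega> \<in> sphere 0 1" for \<rho> and \<omega> :: 'a
    using that by (simp add: sgn_scaleR sgn_div_norm)
  then have "P (sgn x) = 0" if x: "x \<in> nodal_cone P" "x \<noteq> 0"
  proof -
    obtain \<rho> \<omega> where "\<rho> > 0" "\<omega> \<in> sphere 0 1" "x = \<rho> *\<^sub>R \<omega>" "P \<omega> = 0"
      using x unfolding nodal_cone_def by blast
    then show ?thesis using \<open>\<And>\<rho> \<omega>. \<rho> > 0 \<Longrightarrow> \<omega> \<in> sphere 0 1 \<Longrightarrow> sgn (\<rho> *\<^sub>R \<omega>) = \<omega>\<close> by simp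
  qed
  ultimately show ?thesis by (auto simp: nodal_cone_def)
qed

lemma open_Omega: "open \<Omega>"
proof -
  have "open (- {0} \<inter> f -` (- {0}))"
    using smooth_on_continuous[OF smooth_f] by (intro continuous_open_preimage) auto
  also have "- {0} \<inter> f -` (- {0}) = \<Omega>" unfolding set_eq_iff Omega_iff by simp
  finally show ?thesis .
qed

lemma scale_Omega: "t > 0 \<Longrightarrow> t *\<^sub>R x \<in> \<Omega> \<longleftrightarrow> x \<in> \<Omega>"
  unfolding Omega_iff by (simp add: sgn_scaleR)

lemma dir_deriv_radial_f: "x \<noteq> 0 \<Longrightarrow> dir_deriv x f x = 0 * f x"
  by (rule euler_homogeneous)
    (use smooth_on_differentiable[OF smooth_f] in \<open>auto simp: sgn_scaleR\<close>)

text \<open>The coefficient vanishes at s = l, which gives the harmonic function behind the null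
  set, and is smallest at s = - (N - 2) / 2, which gives the ground state.\<close>

lemma laplacian_powr_f:
  assumes "x \<noteq> 0"
  shows "laplacian (\<lambda>x. norm x powr s * f x) x
    = (s * (s + real DIM('a) - 2) - sphere_eigenvalue DIM('a) l) * norm x powr (s - 2) * f x"
proof -
  have "norm x powr s = norm x powr (s - 2) * (norm x)\<^sup>2"
    using assms powr_add[of "norm x" "s - 2" 2] by simp
  then show ?thesis
    using assms
    by (subst laplacian_norm_powr_mult[OF smooth_f assms dir_deriv_radial_f[OF assms]],
        subst sphere_eigenfunction_laplacian[OF P assms])
      (simp add: algebra_simps)
qed

lemma AE_Omega: "AE x in lborel. x \<in> \<Omega>"
proof -
  define Q where "Q x = norm x powr real l * f x" for x
  have "harmonic_on (- {0}) Q"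
    unfolding harmonic_on_def
  proof (intro conjI ballI)
    show "smooth_on (- {0}) Q"
      unfolding Q_def[abs_def]
      by (intro smooth_on_mult open_punctured smooth_on_norm_powr smooth_f)
    show "laplacian Q x = 0" if "x \<in> - {0}" for x
      unfolding Q_def[abs_def] using that
      by (subst laplacian_powr_f) (auto simp: sphere_eigenvalue_def algebra_simps)
  qed
  \<comment> \<open>Here \<open>dim\<close> enters: in dimension one the punctured space is
    disconnected, and a harmonic function could vanish on one side only.\<close>
  moreover have "connected (- {0::'a})" using dim by (rule connected_punctured_universe)
  moreover have "\<exists>x\<in>- {0}. Q x \<noteq> 0"
  proof -
    obtain \<omega> where w: "\<omega> \<in> sphere 0 1" "P \<omega> \<noteq> 0" using P by (auto simp: sphere_eigenfunction_def)
    then have "sgn \<omega> = \<omega>" "\<omega> \<noteq> 0" by (auto simp: sgn_div_norm)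
    then show ?thesis using w by (intro bexI[of _ \<omega>]) (auto simp: Q_def)
  qed
  ultimately have "AE x in lborel. x \<in> - {0} \<longrightarrow> Q x \<noteq> 0"
    using harmonic_zeros_null[OF open_punctured] by blast
  moreover have "AE x in lborel. x \<noteq> (0::'a)" by (rule AE_lborel_singleton)
  ultimately show ?thesis
    by eventually_elim (auto simp: Q_def Omega_iff simp del: Compl_iff)
qed

text \<open>The potential is singular at 0, but u vanishes off a compact K that avoids 0. Continuity
  is glued from the punctured space and the complement of K.\<close>

lemma schroedinger_test:
  assumes u: "u \<in> test_functions \<Omega>"
  shows "continuous_on UNIV (schroedinger k u)" "sq_integrable (schroedinger k u)"
proof -
  have sm: "smooth_on UNIV u" using u by (rule test_functions_smooth)
  obtain K where K: "compact K" "K \<subseteq> \<Omega>" "\<And>x. x \<notin> K \<Longrightarrow> u x = 0"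
    using test_functionsE[OF u] by blast
  have K0: "0 \<notin> K" using K(2) Omega_iff by blast
  note cl = compact_imp_closed[OF K(1)]
  have z2: "dir_deriv b (dir_deriv b u) x = 0" if "x \<notin> K" for b x
    using dir_deriv_eq_0_outside[OF cl dir_deriv_eq_0_outside[OF cl K(3)] that] .
  have z: "schroedinger k u x = 0" if "x \<notin> K" for x
    using that z2 K(3) by (simp add: schroedinger_def laplacian_def)
  have "continuous_on UNIV (laplacian u)"
    unfolding laplacian_def[abs_def]
    by (intro continuous_on_sum smooth_on_continuous smooth_on_dir_deriv sm)
  then have "continuous_on (- {0}) (schroedinger k u)"
    unfolding schroedinger_def[abs_def] using smooth_on_continuous[OF sm]
    by (auto intro!: continuous_intros intro: continuous_on_subset)
  moreover have "continuous_on (- K) (schroedinger k u)"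
    by (rule continuous_on_eq[where f="\<lambda>_. 0"]) (use z in auto)
  ultimately have "continuous_on (- {0} \<union> - K) (schroedinger k u)"
    using cl by (intro continuous_on_open_Un) auto
  moreover have "- {0} \<union> - K = UNIV" using K0 by auto
  ultimately show c: "continuous_on UNIV (schroedinger k u)" by simp
  show "sq_integrable (schroedinger k u)"
    by (rule sq_integrable_compact_support[OF c K(1) z])
qed

lemma schroedinger_add:
  assumes "u \<in> test_functions \<Omega>" "v \<in> test_functions \<Omega>"
  shows "schroedinger k (\<lambda>x. u x + v x) = (\<lambda>x. schroedinger k u x + schroedinger k v x)"
  using laplacian_add[OF open_UNIV UNIV_I test_functions_smooth[OF assms(1)] test_functions_smooth[OF assms(2)]]
  by (simp add: schroedinger_def fun_eq_iff algebra_simps add_divide_distrib)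

lemma schroedinger_mult_left:
  assumes "u \<in> test_functions \<Omega>"
  shows "schroedinger k (\<lambda>x. c * u x) = (\<lambda>x. c * schroedinger k u x)"
  using laplacian_bounded_linear[OF bounded_linear_mult_right open_UNIV UNIV_I test_functions_smooth[OF assms], of c]
  by (simp add: schroedinger_def fun_eq_iff algebra_simps)

section \<open>Linearity, density, symmetry and nonnegativity\<close>

lemma linear_H_op: "linear_op T"
  unfolding linear_op_def
proof (intro conjI)
  show "single_valued T"
  proof (rule single_valuedI)
    fix a b b' assume "(a, b) \<in> T" "(a, b') \<in> T"
    then obtain u u' where u: "u \<in> test_functions \<Omega>" "a = abs_L2 u" "b = abs_L2 (schroedinger k u)"
      and u': "u' \<in> test_functions \<Omega>" "a = abs_L2 u'" "b' = abs_L2 (schroedinger k u')"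
      unfolding H_op_iff by blast
    have "AE x in lborel. u x = u' x"
      using u(2) u'(2) abs_L2_eq_iff[OF sq_integrable_test_function[OF u(1)] sq_integrable_test_function[OF u'(1)]]
      by simp
    then have "u = u'"
      by (intro AE_eq_continuous_imp_eq smooth_on_continuous test_functions_smooth[OF u(1)] test_functions_smooth[OF u'(1)])
    then show "b = b'" using u(3) u'(3) by simp
  qed
  have "schroedinger k (\<lambda>_::'a. 0) = (\<lambda>_. 0)"
    using schroedinger_mult_left[OF test_functions_zero, of 0] by simp
  then show "(0, 0) \<in> T"
    unfolding H_op_iff using test_functions_zero by (auto simp: zero_L2_def intro!: bexI[of _ "\<lambda>_. 0"])
  show "\<forall>(u, v)\<in>T. \<forall>(u', v')\<in>T. (u + u', v + v') \<in> T"
  proof safe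
    fix a b a' b' assume "(a, b) \<in> T" "(a', b') \<in> T"
    then obtain u v where u: "u \<in> test_functions \<Omega>" "a = abs_L2 u" "b = abs_L2 (schroedinger k u)"
      and v: "v \<in> test_functions \<Omega>" "a' = abs_L2 v" "b' = abs_L2 (schroedinger k v)"
      unfolding H_op_iff by blast
    show "(a + a', b + b') \<in> T"
      unfolding H_op_iff u(2,3) v(2,3)
      using test_functions_add[OF u(1) v(1)] schroedinger_test(2) u(1) v(1)
        sq_integrable_test_function[OF u(1)] sq_integrable_test_function[OF v(1)]
      by (intro bexI[of _ "\<lambda>x. u x + v x"]) (simp_all add: plus_abs_L2 schroedinger_add)
  qed
  show "\<forall>c. \<forall>(u, v)\<in>T. (c *\<^sub>C u, c *\<^sub>C v) \<in> T"
  proof safe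
    fix c a b assume "(a, b) \<in> T"
    then obtain u where u: "u \<in> test_functions \<Omega>" "a = abs_L2 u" "b = abs_L2 (schroedinger k u)"
      unfolding H_op_iff by blast
    show "(c *\<^sub>C a, c *\<^sub>C b) \<in> T"
      unfolding H_op_iff u(2,3)
      using test_functions_mult_left[OF u(1)] schroedinger_test(2) u(1) sq_integrable_test_function[OF u(1)]
      by (intro bexI[of _ "\<lambda>x. c * u x"]) (simp_all add: scaleC_abs_L2 schroedinger_mult_left)
  qed
qed

lemma Domain_H_op: "Domain T = abs_L2 ` test_functions \<Omega>"
  unfolding set_eq_iff Domain_iff H_op_iff image_iff by blast

lemma dense_H_op: "densely_defined T"
  using test_space_eq_UNIV[OF open_Omega AE_Omega]
  by (simp add: densely_defined_def Domain_H_op test_space_def)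

text \<open>The potential term is the sum of \<open>schroedinger k u\<close> and
  \<open>laplacian u\<close>, both continuous with compact support, so the singularity is not
  examined again.\<close>

lemma potential_term:
  assumes u: "u \<in> test_functions \<Omega>" and v: "continuous_on UNIV v"
  shows "integrable lborel (\<lambda>x. complex_of_real (k / (norm x)\<^sup>2) * u x * v x)"
    "integrable lborel (\<lambda>x. laplacian u x * v x)"
proof -
  have sm: "smooth_on UNIV u" using u by (rule test_functions_smooth)
  obtain K where K: "compact K" "K \<subseteq> \<Omega>" "\<And>x. x \<notin> K \<Longrightarrow> u x = 0"
    using test_functionsE[OF u] by blast
  note cl = compact_imp_closed[OF K(1)]
  have z2: "dir_deriv b (dir_deriv b u) x = 0" if "x \<notin> K" for b x
    using dir_deriv_eq_0_outside[OF cl dir_deriv_eq_0_outside[OF cl K(3)] that] .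
  have c: "continuous_on UNIV (laplacian u)"
    unfolding laplacian_def[abs_def]
    by (intro continuous_on_sum smooth_on_continuous smooth_on_dir_deriv sm)
  show i: "integrable lborel (\<lambda>x. laplacian u x * v x)"
    by (rule integrable_compact_support[OF _ K(1)])
      (use c v z2 in \<open>auto intro!: continuous_intros simp: laplacian_def\<close>)
  have "integrable lborel (\<lambda>x. schroedinger k u x * v x)"
  proof (rule integrable_compact_support[OF _ K(1)])
    show "continuous_on UNIV (\<lambda>x. schroedinger k u x * v x)"
      by (intro continuous_intros schroedinger_test(1) u v)
    show "schroedinger k u x * v x = 0" if "x \<notin> K" for x
      using that z2 K(3) by (simp add: schroedinger_def laplacian_def)
  qed
  from Bochner_Integration.integrable_add[OF this i]
  show "integrable lborel (\<lambda>x. complex_of_real (k / (norm x)\<^sup>2) * u x * v x)"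
    by (simp add: schroedinger_def algebra_simps)
qed

lemma smooth_cnj: "smooth_on UNIV v \<Longrightarrow> smooth_on UNIV (\<lambda>x. cnj (v x))"
  by (rule smooth_on_bounded_linear[OF bounded_linear_cnj open_UNIV])

lemma dir_deriv_cnj:
  "smooth_on UNIV v \<Longrightarrow> dir_deriv b (\<lambda>x. cnj (v x)) x = cnj (dir_deriv b v x)"
  by (intro dir_deriv_eq bounded_linear.has_derivative[OF bounded_linear_cnj] dir_deriv_works
      smooth_on_differentiable[of UNIV]) auto

lemma cinner_schroedinger:
  assumes u: "u \<in> test_functions \<Omega>" and v: "v \<in> test_functions \<Omega>"
  shows "cinner (abs_L2 (schroedinger k u)) (abs_L2 v)
    = (\<Sum>b\<in>Basis. \<integral>x. dir_deriv b u x * cnj (dir_deriv b v x) \<partial>lborel)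
      + (\<integral>x. complex_of_real (k / (norm x)\<^sup>2) * u x * cnj (v x) \<partial>lborel)"
proof -
  have su: "smooth_on UNIV u" and sv: "smooth_on UNIV v"
    using u v test_functions_smooth by blast+
  obtain K where K: "compact K" "K \<subseteq> \<Omega>" "\<And>x. x \<notin> K \<Longrightarrow> u x = 0"
    using test_functionsE[OF u] by blast
  have cv: "continuous_on UNIV (\<lambda>x. cnj (v x))" using smooth_cnj[OF sv] by (rule smooth_on_continuous)
  have "cinner (abs_L2 (schroedinger k u)) (abs_L2 v) = (\<integral>x. schroedinger k u x * cnj (v x) \<partial>lborel)"
    by (intro cinner_abs_L2 schroedinger_test u sq_integrable_test_function[OF v])
  also have "\<dots> = (\<integral>x. complex_of_real (k / (norm x)\<^sup>2) * u x * cnj (v x) - laplacian u x * cnj (v x) \<partial>lborel)"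
    by (simp add: schroedinger_def algebra_simps)
  also have "\<dots> = (\<integral>x. complex_of_real (k / (norm x)\<^sup>2) * u x * cnj (v x) \<partial>lborel)
      - (\<integral>x. laplacian u x * cnj (v x) \<partial>lborel)"
    by (rule Bochner_Integration.integral_diff[OF potential_term[OF u cv]])
  also have "(\<integral>x. laplacian u x * cnj (v x) \<partial>lborel)
      = - (\<Sum>b\<in>Basis. \<integral>x. dir_deriv b u x * cnj (dir_deriv b v x) \<partial>lborel)"
    using green_identity(1)[OF su smooth_cnj[OF sv] K(1,3)] by (simp add: dir_deriv_cnj sv)
  finally show ?thesis by simp
qed

lemma symmetric_H_op: "symmetric_op T"
  unfolding symmetric_op_def
proof safe
  fix a a' b b' assume "(a, a') \<in> T" "(b, b') \<in> T"
  then obtain u v where u: "u \<in> test_functions \<Omega>" "a = abs_L2 u" "a' = abs_L2 (schroedinger k u)"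
    and v: "v \<in> test_functions \<Omega>" "b = abs_L2 v" "b' = abs_L2 (schroedinger k v)"
    unfolding H_op_iff by blast
  have "cinner a b' = cnj (cinner b' a)" by (rule cinner_commute)
  also have "\<dots> = cinner a' b"
    unfolding u v cinner_schroedinger[OF u(1) v(1)] cinner_schroedinger[OF v(1) u(1)]
    by (simp add: mult_ac flip: Bochner_Integration.integral_cnj)
  finally show "cinner a' b = cinner a b'" ..
qed

text \<open>Ground state substitution: \<open>\<psi>\<close> solves \<open>- \<Delta> \<psi> - c \<bar>x\<bar>\<^sup>-\<^sup>2 \<psi> = 0\<close> with \<open>c \<ge> - k\<close>, and
  \<open>\<bar>\<nabla>u - u \<nabla>\<psi> / \<psi>\<bar>\<^sup>2 = \<bar>\<nabla>u\<bar>\<^sup>2 + \<bar>u\<bar>\<^sup>2 \<Delta>\<psi> / \<psi> - div (\<bar>u\<bar>\<^sup>2 \<nabla>\<psi> / \<psi>)\<close>.\<close>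

lemma nonneg_H_op:
  assumes "(a, b) \<in> T"
  shows "0 \<le> Re (cinner b a)"
proof -
  obtain u where u: "u \<in> test_functions \<Omega>" "a = abs_L2 u" "b = abs_L2 (schroedinger k u)"
    using assms unfolding H_op_iff by blast
  have su: "smooth_on UNIV u" using u(1) by (rule test_functions_smooth)
  obtain K where K: "compact K" "K \<subseteq> \<Omega>" "\<And>x. x \<notin> K \<Longrightarrow> u x = 0"
    using test_functionsE[OF u(1)] by blast
  note cl = compact_imp_closed[OF K(1)]
  define \<psi> where "\<psi> x = norm x powr (- (real DIM('a) - 2) / 2) * f x" for x
  have psi_nz: "\<psi> x \<noteq> 0" if "x \<in> \<Omega>" for x using that unfolding Omega_iff \<psi>_def by simp
  have sub: "\<Omega> \<subseteq> - {0}" using Omega_iff by auto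
  have smpsi: "smooth_on \<Omega> \<psi>"
    unfolding \<psi>_def[abs_def]
    by (rule smooth_on_subset[OF smooth_on_mult[OF open_punctured smooth_on_norm_powr smooth_f] sub])
  have lap_psi: "laplacian \<psi> x = - (sphere_eigenvalue DIM('a) l + (real DIM('a) - 2)\<^sup>2 / 4) / (norm x)\<^sup>2 * \<psi> x" if "x \<in> \<Omega>" for x
  proof -
    have x: "x \<noteq> 0" using that sub by auto
    define \<sigma> where "\<sigma> = - (real DIM('a) - 2) / 2"
    have "laplacian \<psi> x = (\<sigma> * (\<sigma> + real DIM('a) - 2) - sphere_eigenvalue DIM('a) l) * norm x powr (\<sigma> - 2) * f x"
      unfolding \<psi>_def[abs_def] \<sigma>_def[symmetric] by (rule laplacian_powr_f[OF x])
    also have "norm x powr (\<sigma> - 2) = norm x powr \<sigma> / (norm x)\<^sup>2"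
      using x by (simp add: powr_diff)
    also have "\<sigma> * (\<sigma> + real DIM('a) - 2) = - ((real DIM('a) - 2)\<^sup>2 / 4)"
      by (simp add: \<sigma>_def power2_eq_square field_simps)
    finally have "laplacian \<psi> x = (- ((real DIM('a) - 2)\<^sup>2 / 4) - sphere_eigenvalue DIM('a) l)
        * (norm x powr \<sigma> / (norm x)\<^sup>2) * f x" .
    moreover have "(- c - m) * (p / n) * F = - (m + c) / n * (p * F)" for c m p n F :: real
      by (simp add: divide_inverse algebra_simps)
    ultimately show ?thesis by (simp only: \<psi>_def \<sigma>_def)
  qed
  \<comment> \<open>The components of |u|^2 \<nabla>\<psi> / \<psi>. Here \<open>inner\<close> is
    the real inner product on the complex numbers, so the field is real.\<close>
  define X where "X b x = inner (u x) (u x) * (dir_deriv b \<psi> x * inverse (\<psi> x))" for b x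
  have d\<psi>: "\<psi> differentiable (at x)" "dir_deriv b \<psi> differentiable (at x)" if "x \<in> \<Omega>" for x b
    using smooth_on_differentiable[OF smpsi that] smooth_on_differentiable[OF smooth_on_dir_deriv[OF smpsi] that] .
  have C1psi: "Ck_on 1 \<Omega> \<psi>" "Ck_on 1 \<Omega> (dir_deriv b \<psi>)" for b
    using smooth_onD[OF smpsi] smooth_onD[OF smooth_on_dir_deriv[OF smpsi]] by blast+
  have du: "u differentiable (at x)" for x using smooth_on_differentiable[OF su] by simp
  have dX: "dir_deriv b (X b) x = (norm (dir_deriv b u x))\<^sup>2
      - (norm (dir_deriv b u x - (dir_deriv b \<psi> x / \<psi> x) *\<^sub>R u x))\<^sup>2
      + (norm (u x))\<^sup>2 * (dir_deriv b (dir_deriv b \<psi>) x / \<psi> x)" if x: "x \<in> \<Omega>" for b x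
  proof -
    have di: "(\<lambda>x. inverse (\<psi> x)) differentiable (at x)"
      using d\<psi>(1)[OF x] psi_nz[OF x] by (rule differentiable_inverse)
    have duu: "((\<lambda>x. inner (u x) (u x)) has_derivative (\<lambda>v. 2 * inner (u x) (dir_deriv v u x))) (at x)"
      using has_derivative_inner[OF dir_deriv_works[OF du] dir_deriv_works[OF du]]
      by (simp add: inner_commute)
    have "dir_deriv b (X b) x = inner (u x) (u x) * dir_deriv b (\<lambda>x. dir_deriv b \<psi> x * inverse (\<psi> x)) x
      + dir_deriv b (\<lambda>x. inner (u x) (u x)) x * (dir_deriv b \<psi> x * inverse (\<psi> x))"
      unfolding X_def[abs_def]
      by (intro dir_deriv_mult differentiable_mult differentiableI[OF duu] di d\<psi>(2)[OF x])
    also have "dir_deriv b (\<lambda>x. inner (u x) (u x)) x = 2 * inner (u x) (dir_deriv b u x)"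
      using dir_deriv_eq[OF duu] .
    also have "dir_deriv b (\<lambda>x. dir_deriv b \<psi> x * inverse (\<psi> x)) x
      = dir_deriv b \<psi> x * (- dir_deriv b \<psi> x / (\<psi> x)\<^sup>2) + dir_deriv b (dir_deriv b \<psi>) x * inverse (\<psi> x)"
      by (subst dir_deriv_mult[OF d\<psi>(2)[OF x] di], subst Ck_on_1_inverse(2)[OF open_Omega C1psi(1) psi_nz x]) simp_all
    finally show ?thesis
      unfolding power2_norm_eq_inner
      by (simp add: inner_diff_left inner_diff_right inner_commute
          divide_inverse power2_eq_square algebra_simps)
  qed
  \<comment> \<open>The quotient makes sense only on \<Omega>, but u is 0 off K: regularity on
    \<Omega> and on the complement of K glues to the whole space.\<close>
  have C1X: "Ck_on 1 UNIV (X b)" for b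
  proof -
    have "Ck_on 1 \<Omega> (X b)"
      unfolding X_def[abs_def]
      by (intro Ck_on_mult Ck_on_bilinear[OF bounded_bilinear_inner] open_Omega C1psi
          Ck_on_1_inverse(1) psi_nz Ck_on_subset[OF smooth_onD[OF su] subset_UNIV])
    moreover have "Ck_on 1 (- K) (X b)"
      by (rule Ck_on_cong[OF _ _ Ck_on_const[of 1 _ 0]]) (use cl K(3) in \<open>auto simp: X_def\<close>)
    ultimately have "Ck_on 1 (\<Omega> \<union> - K) (X b)"
      using open_Omega cl by (intro Ck_on_Un) auto
    moreover have "\<Omega> \<union> - K = UNIV" using K(2) by auto
    ultimately show ?thesis by simp
  qed
  have X0: "X b x = 0" if "x \<notin> K" for b x using that K(3) by (simp add: X_def)
  define G where "G x = (\<Sum>b\<in>Basis. (norm (dir_deriv b u x))\<^sup>2) + k / (norm x)\<^sup>2 * (norm (u x))\<^sup>2" for x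
  \<comment> \<open>Dropping the square leaves div X \<le> G pointwise; the hypothesis
    \<open>l\<close> is what replaces - (\<lambda> + (N - 2)^2 / 4) by the larger k.\<close>
  have G: "(\<Sum>b\<in>Basis. dir_deriv b (X b) x) \<le> G x" for x
  proof (cases "x \<in> K")
    case True
    then have x: "x \<in> \<Omega>" using K(2) by blast
    then have x0: "x \<noteq> 0" using sub by auto
    have "(\<Sum>b\<in>Basis. dir_deriv b (X b) x) \<le> (\<Sum>b\<in>Basis. (norm (dir_deriv b u x))\<^sup>2
      + (norm (u x))\<^sup>2 * (dir_deriv b (dir_deriv b \<psi>) x / \<psi> x))"
      unfolding dX[OF x] by (intro sum_mono) simp
    also have "\<dots> = (\<Sum>b\<in>Basis. (norm (dir_deriv b u x))\<^sup>2) + (norm (u x))\<^sup>2 * (laplacian \<psi> x / \<psi> x)"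
      by (simp add: laplacian_def sum.distrib sum_distrib_left sum_divide_distrib)
    also have "laplacian \<psi> x / \<psi> x = - (sphere_eigenvalue DIM('a) l + (real DIM('a) - 2)\<^sup>2 / 4) / (norm x)\<^sup>2"
      unfolding lap_psi[OF x] using psi_nz[OF x] by simp
    also have "(norm (u x))\<^sup>2 * (- (sphere_eigenvalue DIM('a) l + (real DIM('a) - 2)\<^sup>2 / 4) / (norm x)\<^sup>2) \<le> (norm (u x))\<^sup>2 * (k / (norm x)\<^sup>2)"
      using l by (intro mult_left_mono divide_right_mono) auto
    finally show ?thesis by (simp add: G_def mult.commute)
  next
    case False
    have "dir_deriv b u x = 0" for b using dir_deriv_eq_0_outside[OF cl K(3) False] .
    moreover have "dir_deriv b (X b) x = 0" for b using dir_deriv_eq_0_outside[OF cl X0 False] .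
    ultimately show ?thesis using K(3)[OF False] by (simp add: G_def)
  qed
  have iX: "integrable lborel (dir_deriv b (X b))" for b
    by (rule integrable_compact_support[OF _ K(1)])
      (use C1X[of b] dir_deriv_eq_0_outside[OF cl X0] in auto)
  have i1: "integrable lborel (\<lambda>x. (norm (dir_deriv b u x))\<^sup>2)" for b
    by (rule integrable_compact_support[OF _ K(1)])
      (use smooth_on_continuous[OF smooth_on_dir_deriv[OF su]] dir_deriv_eq_0_outside[OF cl K(3)]
        in \<open>auto intro!: continuous_intros\<close>)
  have eq: "complex_of_real (k / (norm x)\<^sup>2) * u x * cnj (u x) = of_real (k / (norm x)\<^sup>2 * (norm (u x))\<^sup>2)" for x
    by (simp only: of_real_mult complex_norm_square mult.assoc)
  have i2: "integrable lborel (\<lambda>x. k / (norm x)\<^sup>2 * (norm (u x))\<^sup>2)"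
    using integrable_Re[OF potential_term(1)[OF u(1) smooth_on_continuous[OF smooth_cnj[OF su]]]]
    unfolding eq by (simp del: of_real_mult of_real_power of_real_divide)
  have "0 = (\<Sum>b\<in>Basis. \<integral>x. dir_deriv b (X b) x \<partial>lborel)"
    using integral_dir_deriv_eq_0[OF C1X K(1) X0] by simp
  also have "\<dots> = (\<integral>x. (\<Sum>b\<in>Basis. dir_deriv b (X b) x) \<partial>lborel)"
    using iX by (intro Bochner_Integration.integral_sum[symmetric])
  also have "\<dots> \<le> (\<integral>x. G x \<partial>lborel)"
    using iX i1 i2 G unfolding G_def by (intro integral_mono Bochner_Integration.integrable_add Bochner_Integration.integrable_sum) auto
  also have "\<dots> = (\<Sum>b\<in>Basis. \<integral>x. (norm (dir_deriv b u x))\<^sup>2 \<partial>lborel) + (\<integral>x. k / (norm x)\<^sup>2 * (norm (u x))\<^sup>2 \<partial>lborel)"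
    unfolding G_def using i1 i2 by (simp add: Bochner_Integration.integral_sum)
  also have "\<dots> = Re (cinner b a)"
  proof -
    have "cinner b a = (\<Sum>b\<in>Basis. \<integral>x. complex_of_real ((norm (dir_deriv b u x))\<^sup>2) \<partial>lborel)
      + (\<integral>x. complex_of_real (k / (norm x)\<^sup>2 * (norm (u x))\<^sup>2) \<partial>lborel)"
      unfolding u(2,3) cinner_schroedinger[OF u(1) u(1)] eq by (simp only: complex_norm_square)
    then show ?thesis by (simp del: of_real_power of_real_mult of_real_divide)
  qed
  finally show ?thesis .
qed

sublocale nonneg_symmetric_op T
  by unfold_locales (use linear_H_op dense_H_op symmetric_H_op nonneg_H_op in auto)

section \<open>Dilations and the bottom of the spectrum\<close>

lemma scaled_test_function:
  assumes u: "u \<in> test_functions \<Omega>" and t: "t > 0"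
  shows "(\<lambda>x. u (t *\<^sub>R x)) \<in> test_functions \<Omega>"
    and "schroedinger k (\<lambda>x. u (t *\<^sub>R x)) = (\<lambda>x. of_real (t\<^sup>2) * schroedinger k u (t *\<^sub>R x))"
proof -
  have su: "smooth_on UNIV u" using u by (rule test_functions_smooth)
  obtain K where K: "compact K" "K \<subseteq> \<Omega>" "\<And>x. x \<notin> K \<Longrightarrow> u x = 0"
    using test_functionsE[OF u] by blast
  show "(\<lambda>x. u (t *\<^sub>R x)) \<in> test_functions \<Omega>"
  proof (rule test_functionsI[where K="(*\<^sub>R) (1 / t) ` K"])
    show "smooth_on UNIV (\<lambda>x. u (t *\<^sub>R x))"
      using Ck_on_scale[OF open_UNIV smooth_onD[OF su]] by (intro smooth_onI) simp
    show "compact ((*\<^sub>R) (1 / t) ` K)" using K(1) by (rule compact_scaling)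
    show "(*\<^sub>R) (1 / t) ` K \<subseteq> \<Omega>" using K(2) scale_Omega[of "1 / t"] t by auto
    show "u (t *\<^sub>R x) = 0" if "x \<notin> (*\<^sub>R) (1 / t) ` K" for x
    proof (rule K(3))
      have "x = (1 / t) *\<^sub>R (t *\<^sub>R x)" using t by simp
      then show "t *\<^sub>R x \<notin> K" using that by blast
    qed
  qed
  have "laplacian (\<lambda>x. u (t *\<^sub>R x)) x = t\<^sup>2 *\<^sub>R laplacian u (t *\<^sub>R x)" for x
    by (rule laplacian_scale[OF open_UNIV UNIV_I smooth_onD[OF su]])
  moreover have "t \<noteq> 0" using t by simp
  ultimately show "schroedinger k (\<lambda>x. u (t *\<^sub>R x)) = (\<lambda>x. of_real (t\<^sup>2) * schroedinger k u (t *\<^sub>R x))"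
    unfolding schroedinger_def by (simp add: fun_eq_iff scaleR_conv_of_real algebra_simps power_mult_distrib)
qed

text \<open>The factor t^N is the same for a function and for its image under the operator, so it
  cancels when their norms are compared.\<close>

lemma norm_scaled:
  fixes g :: "'a \<Rightarrow> complex"
  assumes g: "sq_integrable g" and t: "t > 0"
  shows "sq_integrable (\<lambda>x. g (t *\<^sub>R x))"
    and "(norm (abs_L2 g))\<^sup>2 = t ^ DIM('a) * (norm (abs_L2 (\<lambda>x. g (t *\<^sub>R x))))\<^sup>2"
proof -
  have [measurable]: "g \<in> borel_measurable borel" using g by (simp add: sq_integrable_def)
  show s: "sq_integrable (\<lambda>x. g (t *\<^sub>R x))"
    using g integrable_scale[OF _ t, of "\<lambda>x. (cmod (g x))\<^sup>2"] by (simp add: sq_integrable_def)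
  show "(norm (abs_L2 g))\<^sup>2 = t ^ DIM('a) * (norm (abs_L2 (\<lambda>x. g (t *\<^sub>R x))))\<^sup>2"
    unfolding norm_abs_L2[OF g] norm_abs_L2[OF s] by (rule lborel_integral_scale[where f="\<lambda>x. (cmod (g x))\<^sup>2", OF _ t]) simp
qed

text \<open>If every test function were null, density would make L2 trivial, which the unit cube
  refutes.\<close>

lemma exists_nonzero_domain: "\<exists>u\<in>test_functions \<Omega>. abs_L2 u \<noteq> 0"
proof (rule ccontr)
  assume "\<not> ?thesis"
  then have "abs_L2 ` test_functions \<Omega> \<subseteq> {0}" by auto
  then have "test_space \<Omega> \<subseteq> {0}" unfolding test_space_def by (rule closure_minimal) simp
  then have all: "g = 0" for g :: "'a L2" using test_space_eq_UNIV[OF open_Omega AE_Omega] by auto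
  have m: "emeasure lborel (cbox 0 One :: 'a set) = 1" by (simp add: emeasure_lborel_cbox_eq)
  then have s: "sq_integrable (\<lambda>x. indicator (cbox 0 One :: 'a set) x)"
    by (intro sq_integrable_indicator) auto
  have "(norm (abs_L2 (\<lambda>x. indicator (cbox 0 One :: 'a set) x)))\<^sup>2
      = (\<integral>x. indicator (cbox 0 One :: 'a set) x \<partial>lborel)"
    unfolding norm_abs_L2[OF s] by (intro Bochner_Integration.integral_cong) (auto simp: indicator_def)
  also have "\<dots> = 1" using m by (simp add: measure_def)
  finally show False using all[of "abs_L2 (\<lambda>x. indicator (cbox 0 One) x)"] by simp
qed

text \<open>The operator is homogeneous of degree \<open>-2\<close> under dilations, so dilating one nonzero test
  function yields an approximate null sequence.\<close>

lemma zero_in_spectrum: "0 \<in> spectrum A"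
proof (rule ccontr)
  assume "0 \<notin> spectrum A"
  then obtain C where C: "\<And>u v. (u, v) \<in> A \<Longrightarrow> norm u \<le> C * norm v"
    unfolding spectrum_def resolvent_set_def by auto
  obtain u where u: "u \<in> test_functions \<Omega>" "abs_L2 u \<noteq> 0" using exists_nonzero_domain by blast
  define v where "v = schroedinger k u"
  have su: "sq_integrable u" and sv: "sq_integrable v"
    using sq_integrable_test_function[OF u(1)] schroedinger_test(2)[OF u(1)] by (auto simp: v_def)
  have main: "norm (abs_L2 u) \<le> \<bar>C\<bar> * (t\<^sup>2 * norm (abs_L2 v))" if t: "t > 0" for t
  proof -
    define ut where "ut x = u (t *\<^sub>R x)" for x
    define vt where "vt x = v (t *\<^sub>R x)" for x
    have "(abs_L2 ut, of_real (t\<^sup>2) *\<^sub>C abs_L2 vt) \<in> T"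
      unfolding H_op_iff
      using scaled_test_function[OF u(1) t] scaleC_abs_L2[OF norm_scaled(1)[OF sv t]]
      by (intro bexI[of _ ut]) (auto simp: ut_def[abs_def] vt_def[abs_def] v_def)
    then have "norm (abs_L2 ut) \<le> C * norm (of_real (t\<^sup>2) *\<^sub>C abs_L2 vt)"
      using extends C by blast
    also have "\<dots> \<le> \<bar>C\<bar> * (t\<^sup>2 * norm (abs_L2 vt))"
      by (simp add: norm_scaleC mult_right_mono del: of_real_power)
    finally have "(norm (abs_L2 ut))\<^sup>2 \<le> (\<bar>C\<bar> * t\<^sup>2)\<^sup>2 * (norm (abs_L2 vt))\<^sup>2"
      by (metis mult.assoc norm_ge_zero power_mono power_mult_distrib)
    then have "t ^ DIM('a) * (norm (abs_L2 ut))\<^sup>2 \<le> t ^ DIM('a) * ((\<bar>C\<bar> * t\<^sup>2)\<^sup>2 * (norm (abs_L2 vt))\<^sup>2)"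
      using t by (intro mult_left_mono) auto
    then have "(norm (abs_L2 u))\<^sup>2 \<le> (\<bar>C\<bar> * t\<^sup>2)\<^sup>2 * (norm (abs_L2 v))\<^sup>2"
      using norm_scaled(2)[OF su t] norm_scaled(2)[OF sv t]
      by (simp add: ut_def[abs_def] vt_def[abs_def] mult_ac)
    then have "(norm (abs_L2 u))\<^sup>2 \<le> (\<bar>C\<bar> * t\<^sup>2 * norm (abs_L2 v))\<^sup>2" by (simp add: power_mult_distrib)
    then show ?thesis by (simp add: mult.assoc power2_le_iff_abs_le)
  qed
  define c where "c = norm (abs_L2 u)"
  define d where "d = \<bar>C\<bar> * norm (abs_L2 v)"
  have cd: "c > 0" "d \<ge> 0" using u(2) by (auto simp: c_def d_def)
  \<comment> \<open>Makes d t^2 less than c / 2; the + 1 keeps the quotient meaningful for d =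
    0.\<close>
  define t where "t = sqrt (c / (2 * (d + 1)))"
  have t: "t > 0" "t\<^sup>2 = c / (2 * (d + 1))" using cd by (auto simp: t_def)
  have "c \<le> d * t\<^sup>2" using main[OF t(1)] by (simp add: c_def d_def mult_ac)
  also have "\<dots> < c"
  proof -
    have "d * c < c * (2 * (d + 1))" using cd by (simp add: algebra_simps add_nonneg_pos)
    then show ?thesis using cd unfolding t(2) by (simp add: pos_divide_less_eq)
  qed
  finally show False by simp
qed

lemma Inf_spectrum:
  "bdd_below (Re ` spectrum A)" "Inf (Re ` spectrum A) = 0"
proof -
  show "bdd_below (Re ` spectrum A)" using spectrum_friedrichs by (intro bdd_belowI[of _ 0]) auto
  show "Inf (Re ` spectrum A) = 0"
    by (rule cInf_eq_minimum) (use zero_in_spectrum spectrum_friedrichs in force)+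
qed

end

section \<open>Large eigenvalues and the conclusion\<close>

lemma sphere_eigenvalue_unbounded:
  assumes "n \<ge> 2"
  shows "\<exists>l. sphere_eigenvalue n l \<ge> c"
proof
  \<comment> \<open>The maximum with 1 makes the factor N - 2 + l at least 1, so the eigenvalue is
    at least l.\<close>
  define l where "l = nat \<lceil>max c 1\<rceil>"
  have l: "real l \<ge> c" "real l \<ge> 1" unfolding l_def by linarith+
  have "real l * 1 \<le> real l * (real n - 2 + real l)"
    using l assms by (intro mult_left_mono) auto
  then show "sphere_eigenvalue n l \<ge> c" using l unfolding sphere_eigenvalue_def by linarith
qed

theorem theorem1p1:
  fixes k :: real
  assumes "CARD('n::finite) \<ge> 2"
  shows
    "(\<forall>(l::nat) (P :: real ^ 'n \<Rightarrow> real).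
        sphere_eigenvalue CARD('n) l \<ge> - ((real CARD('n) - 2)\<^sup>2) / 4 - k \<longrightarrow>
        sphere_eigenfunction P (sphere_eigenvalue CARD('n) l) \<longrightarrow>
        densely_defined (H_op k P) \<and>
        has_friedrichs_extension (H_op k P) \<and>
        spectrum (friedrichs_extension (H_op k P)) \<noteq> {} \<and>
        bdd_below (Re ` spectrum (friedrichs_extension (H_op k P))) \<and>
        Inf (Re ` spectrum (friedrichs_extension (H_op k P))) = 0) \<and>
     (\<exists>(l::nat) (P :: real ^ 'n \<Rightarrow> real).
        sphere_eigenvalue CARD('n) l \<ge> - ((real CARD('n) - 2)\<^sup>2) / 4 - k \<and>
        sphere_eigenfunction P (sphere_eigenvalue CARD('n) l) \<and>
        (\<exists>A. H_op k P \<subseteq> A \<and> selfadjoint_op A \<and> bdd_below (Re ` spectrum A)))"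
proof -
  have dim: "DIM(real ^ 'n) = CARD('n)" by simp
  have loc: "nodal_schroedinger k l P"
    if "sphere_eigenvalue CARD('n) l \<ge> - ((real CARD('n) - 2)\<^sup>2) / 4 - k"
      and "sphere_eigenfunction P (sphere_eigenvalue CARD('n) l)" for l and P :: "real ^ 'n \<Rightarrow> real"
    using that assms unfolding nodal_schroedinger_def dim by simp
  show ?thesis
  proof (intro conjI allI impI)
    fix l and P :: "real ^ 'n \<Rightarrow> real"
    assume "sphere_eigenvalue CARD('n) l \<ge> - ((real CARD('n) - 2)\<^sup>2) / 4 - k"
      and "sphere_eigenfunction P (sphere_eigenvalue CARD('n) l)"
    then interpret nodal_schroedinger k l P by (rule loc)
    show "densely_defined T" by (rule dense)
    show "has_friedrichs_extension T" by (rule has_friedrichs)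
    \<comment> \<open>Over an empty spectrum the infimum would carry no information.\<close>
    show "spectrum A \<noteq> {}" using zero_in_spectrum by blast
    show "bdd_below (Re ` spectrum A)" "Inf (Re ` spectrum A) = 0" by (fact Inf_spectrum)+
  next
    \<comment> \<open>No restriction on k arises because the eigenvalues are unbounded: a high
      degree pays for a strongly attractive potential.\<close>
    obtain l where hl: "sphere_eigenvalue CARD('n) l \<ge> - ((real CARD('n) - 2)\<^sup>2) / 4 - k"
      using sphere_eigenvalue_unbounded[OF assms] by blast
    obtain P :: "real ^ 'n \<Rightarrow> real" where hP: "sphere_eigenfunction P (sphere_eigenvalue CARD('n) l)"
      using sphere_eigenfunction_exists[where 'a="real ^ 'n"] assms unfolding dim by blast
    interpret nodal_schroedinger k l P using hl hP by (rule loc)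
    show "\<exists>l (P :: real ^ 'n \<Rightarrow> real).
        sphere_eigenvalue CARD('n) l \<ge> - ((real CARD('n) - 2)\<^sup>2) / 4 - k \<and>
        sphere_eigenfunction P (sphere_eigenvalue CARD('n) l) \<and>
        (\<exists>A. H_op k P \<subseteq> A \<and> selfadjoint_op A \<and> bdd_below (Re ` spectrum A))"
      using hl hP extends selfadjoint_friedrichs Inf_spectrum(1) by blast
  qed
qed

end
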